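(* Let $(\mathscr{C},\mathbf{W})$ satisfy conditions (BF), and fix a set of choices $\mathrm{C}(\mathbf{W})$. Let $\underline g=(B',u,g):B\to C$ and $\underline f^m:=(A^m,w^m,f^m):A\to B$ for $m=1,2$ be morphisms and $\Gamma:\underline f^1\Rightarrow\underline f^2$ a 2-morphism in $\mathscr{C}[\mathbf{W}^{-1}]$. Fix any representative $(A^3,v^1,v^2,\alpha,\beta)$ for $\Gamma$ (so $v^m:A^3\to A^m$, $\alpha:w^1\circ v^1\Rightarrow w^2\circ v^2$, $\beta:f^1\circ v^1\Rightarrow f^2\circ v^2$) and suppose that $\mathrm{C}(\mathbf{W})$ gives, for the pairs $(f^m,u)$, $m=1,2$, the data $(D^m,\ u^m:D^m\to A^m,\ h^m:D^m\to B',\ \rho^m:f^m\circ u^m\Rightarrow u\circ h^m)$ with $u^m$ in $\mathbf{W}$ and $\rho^m$ invertible (so that $\underline g\circ\underline f^m=(D^m,w^m\circ u^m,g\circ h^m)$). Fix any set of data in $\mathscr{C}$ as follows: (F8) objects $D^3,D^4$, morphisms $u^3:D^3\to A^3$ and $u^5:D^4\to A^3$ in $\mathbf{W}$, morphisms $u^4:D^3\to D^1$, $u^6:D^4\to D^2$, and invertible 2-morphisms $\eta^1:v^1\circ u^3\Rightarrow u^1\circ u^4$, $\eta^2:v^2\circ u^5\Rightarrow u^2\circ u^6$; (F9) an object $D^5$, a morphism $u^7:D^5\to D^3$ in $\mathbf{W}$, a morphism $u^8:D^5\to D^4$ and an invertible 2-morphism $\eta^3:u^3\circ u^7\Rightarrow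 u^5\circ u^8$; (F10) a 2-morphism $\lambda:h^1\circ u^4\circ u^7\Rightarrow h^2\circ u^6\circ u^8$ such that $u\circ\lambda$ equals $$(\rho^2\circ u^6\circ u^8)\bullet(f^2\circ\eta^2\circ u^8)\bullet(f^2\circ v^2\circ\eta^3)\bullet(\beta\circ u^3\circ u^7)\bullet(f^1\circ(\eta^1)^{-1}\circ u^7)\bullet((\rho^1)^{-1}\circ u^4\circ u^7).$$ Then $\underline g\circ\Gamma$ is represented by $(D^5,u^4\circ u^7,u^6\circ u^8,\mu,g\circ\lambda)$, where $$\mu:=(w^2\circ\eta^2\circ u^8)\bullet(w^2\circ v^2\circ\eta^3)\bullet(\alpha\circ u^3\circ u^7)\bullet(w^1\circ(\eta^1)^{-1}\circ u^7).$$ Given any other representative for $\Gamma$, and any other set of data as in (F8)–(F10), the quintuple induced by the new data is equivalent to this one.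
   Context: Conventions. $\mathscr{C}$ is a bicategory and $\mathbf{W}$ a class of 1-morphisms in it. $\circ$ denotes composition of 1-morphisms and whiskering; $\bullet$ denotes vertical composition of 2-morphisms of $\mathscr{C}$ ($\beta\bullet\alpha$ means first $\alpha$, then $\beta$). Associators and unitors of $\mathscr{C}$ are omitted from the notation, as if $\mathscr{C}$ were a 2-category (by coherence they can be inserted unambiguously); the statement is meant for arbitrary bicategories. Conditions (BF): (BF1) every $\mathrm{id}_A$ is in $\mathbf{W}$. (BF2) $\mathbf{W}$ is closed under composition. (BF3) For every $w:A\to B$ in $\mathbf{W}$ and every $f:C\to B$ there are an object $D$, $w':D\to C$ in $\mathbf{W}$, $f':D\to A$ and an invertible 2-morphism $f\circ w'\Rightarrow w\circ f'$. (BF4a) For every $w:B\to A$ in $\mathbf{W}$, $f^1,f^2:C\to B$ and $\alpha:w\circ f^1\Rightarrow w\circ f^2$ there are an object $D$, $v:D\to C$ in $\mathbf{W}$ and $\beta:f^1\circ v\Rightarrow f^2\circ v$ with $\alpha\circ v=w\circ\beta$. (BF4b) If $\alpha$ in (BF4a) is invertible, so is $\beta$. (BF4c) If $(D',v',\beta')$ is another triple with the same properties as $(D,v,\beta)$ in (BF4a), there are an object $E$, $u:E\to D$, $u':E\to D'$ and an invertible $\zeta:v\circ u\Rightarrow v'\circ u'$ with $v\circ u\in\mathbf{W}$ and $(\beta'\circ u')\bullet(f^1\circ\zeta)=(f^2\circ\zeta)\bullet(\beta\circ u)$. (BF5) If $w:A\to B$ is in $\mathbf{W}$ and there is an invertible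 $v\Rightarrow w$, then $v\in\mathbf{W}$. Choices. $\mathrm{C}(\mathbf{W})$: for every $f:A'\to B$ and $v:B'\to B$ in $\mathbf{W}$, a chosen $(A'',v',f',\rho)$ with $v':A''\to A'$ in $\mathbf{W}$, $f':A''\to B'$, $\rho:f\circ v'\Rightarrow v\circ f'$ invertible. $\mathrm{D}(\mathbf{W})$: for every $w:B\to A$ in $\mathbf{W}$, $f^1,f^2:C\to B$, $\alpha:w\circ f^1\Rightarrow w\circ f^2$, a chosen $v:D\to C$ in $\mathbf{W}$ and $\beta:f^1\circ v\Rightarrow f^2\circ v$ with $\alpha\circ v=w\circ\beta$. Bicategory of fractions $\mathscr{C}[\mathbf{W}^{-1}]$ (Pronk). Objects: those of $\mathscr{C}$. A morphism $A\to B$ is a triple $(A',w,f)$ with $w:A'\to A$ in $\mathbf{W}$, $f:A'\to B$. Composition: $(B',v,g)\circ(A',w,f):=(A'',w\circ v',g\circ f')$ with $(A'',v',f',\rho)$ the choice in $\mathrm{C}(\mathbf{W})$ for $(f,v)$. A 2-morphism $(A^1,w^1,f^1)\Rightarrow(A^2,w^2,f^2)$ (both $A\to B$) is an equivalence class of data (its representatives) $(A^3,v^1,v^2,\alpha,\beta)$ with $v^m:A^3\to A^m$, $w^1\circ v^1\in\mathbf{W}$, $\alpha:w^1\circ v^1\Rightarrow w^2\circ v^2$ invertible, $\beta:f^1\circ v^1\Rightarrow f^2\circ v^2$; $(A^3,v^1,v^2,\alpha,\beta)$ and $(A'^3,v'^1,v'^2,\alpha',\beta')$ are equivalent iff there are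 $z:A^4\to A^3$, $z':A^4\to A'^3$ and invertible $\sigma^1:v'^1\circ z'\Rightarrow v^1\circ z$, $\sigma^2:v^2\circ z\Rightarrow v'^2\circ z'$ with $w^1\circ v^1\circ z\in\mathbf{W}$, $(w^2\circ\sigma^2)\bullet(\alpha\circ z)\bullet(w^1\circ\sigma^1)=\alpha'\circ z'$ and $(f^2\circ\sigma^2)\bullet(\beta\circ z)\bullet(f^1\circ\sigma^1)=\beta'\circ z'$. In Pronk's construction the composition $\underline g\circ\Gamma:\underline g\circ\underline f^1\Rightarrow\underline g\circ\underline f^2$ is defined as the class of the quintuple of the claim for any representative of $\Gamma$ and for one particular set of data (F8)–(F10), selected by means of the fixed choices $\mathrm{C}(\mathbf{W})$ and $\mathrm{D}(\mathbf{W})$; by Pronk, the result does not depend on the representative used. *)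

theory Defs
  imports Main
begin

text \<open>
  Bicategories are presented by carriers of objects, 1-morphisms and 2-morphisms inside three types,
  with hom-categories disjoint (sources and targets are functions).
  Operations are total functions, meaningful only on composable arguments.
\<close>

record ('o, 'm, 'c) bicat =
  Obj :: "'o set"
  Mor :: "'m set"
  Cell :: "'c set"
  src :: "'m \<Rightarrow> 'o"
  trg :: "'m \<Rightarrow> 'o"
  dom2 :: "'c \<Rightarrow> 'm"
  cod2 :: "'c \<Rightarrow> 'm"
  id1 :: "'o \<Rightarrow> 'm"
  comp1 :: "'m \<Rightarrow> 'm \<Rightarrow> 'm"  (infixr \<open>\<cdot>\<index>\<close> 80)
  id2 :: "'m \<Rightarrow> 'c"
  vcomp :: "'c \<Rightarrow> 'c \<Rightarrow> 'c"  (infixr \<open>\<bullet>\<index>\<close> 65)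
  hcomp :: "'c \<Rightarrow> 'c \<Rightarrow> 'c"  (infixr \<open>\<star>\<index>\<close> 75)
  assoc :: "'m \<Rightarrow> 'm \<Rightarrow> 'm \<Rightarrow> 'c"
  lunit :: "'m \<Rightarrow> 'c"
  runit :: "'m \<Rightarrow> 'c"

definition Hom :: "('o, 'm, 'c, 'x) bicat_scheme \<Rightarrow> 'o \<Rightarrow> 'o \<Rightarrow> 'm set"
  where "Hom C A B = {f \<in> Mor C. src C f = A \<and> trg C f = B}"

definition Cells :: "('o, 'm, 'c, 'x) bicat_scheme \<Rightarrow> 'm \<Rightarrow> 'm \<Rightarrow> 'c set"
  where "Cells C f g = {a \<in> Cell C. dom2 C a = f \<and> cod2 C a = g}"

definition inverse2 :: "('o, 'm, 'c, 'x) bicat_scheme \<Rightarrow> 'c \<Rightarrow> 'c \<Rightarrow> bool"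
  where "inverse2 C a b \<longleftrightarrow>
    b \<in> Cells C (cod2 C a) (dom2 C a) \<and>
    b \<bullet>\<^bsub>C\<^esub> a = id2 C (dom2 C a) \<and> a \<bullet>\<^bsub>C\<^esub> b = id2 C (cod2 C a)"

definition Isos :: "('o, 'm, 'c, 'x) bicat_scheme \<Rightarrow> 'm \<Rightarrow> 'm \<Rightarrow> 'c set"
  where "Isos C f g = {a \<in> Cells C f g. \<exists>b. inverse2 C a b}"

definition inv2 :: "('o, 'm, 'c, 'x) bicat_scheme \<Rightarrow> 'c \<Rightarrow> 'c"
  where "inv2 C a = (THE b. inverse2 C a b)"

definition lwhisker :: "('o, 'm, 'c, 'x) bicat_scheme \<Rightarrow> 'm \<Rightarrow> 'c \<Rightarrow> 'c"  (infixr \<open>\<rhd>\<index>\<close> 75)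
  where "f \<rhd>\<^bsub>C\<^esub> a = id2 C f \<star>\<^bsub>C\<^esub> a"

definition rwhisker :: "('o, 'm, 'c, 'x) bicat_scheme \<Rightarrow> 'c \<Rightarrow> 'm \<Rightarrow> 'c"  (infixl \<open>\<lhd>\<index>\<close> 75)
  where "a \<lhd>\<^bsub>C\<^esub> f = a \<star>\<^bsub>C\<^esub> id2 C f"

locale bicategory =
  fixes C :: "('o, 'm, 'c, 'x) bicat_scheme" (structure)
  assumes src_Obj: "f \<in> Mor C \<Longrightarrow> src C f \<in> Obj C"
    and trg_Obj: "f \<in> Mor C \<Longrightarrow> trg C f \<in> Obj C"
    and dom2_Mor: "a \<in> Cell C \<Longrightarrow> dom2 C a \<in> Mor C"
    and cod2_Mor: "a \<in> Cell C \<Longrightarrow> cod2 C a \<in> Mor C"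
    and src_parallel: "a \<in> Cell C \<Longrightarrow> src C (dom2 C a) = src C (cod2 C a)"
    and trg_parallel: "a \<in> Cell C \<Longrightarrow> trg C (dom2 C a) = trg C (cod2 C a)"
    and id1_Hom: "A \<in> Obj C \<Longrightarrow> id1 C A \<in> Hom C A A"
    and comp1_Hom: "\<lbrakk>f \<in> Hom C A B; g \<in> Hom C B D\<rbrakk> \<Longrightarrow> g \<cdot> f \<in> Hom C A D"
    and id2_Cells: "f \<in> Mor C \<Longrightarrow> id2 C f \<in> Cells C f f"
    and vcomp_Cells: "\<lbrakk>a \<in> Cells C f g; b \<in> Cells C g h\<rbrakk> \<Longrightarrow> b \<bullet> a \<in> Cells C f h"
    and vcomp_id_left: "a \<in> Cells C f g \<Longrightarrow> id2 C g \<bullet> a = a"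
    and vcomp_id_right: "a \<in> Cells C f g \<Longrightarrow> a \<bullet> id2 C f = a"
    and vcomp_assoc: "\<lbrakk>a \<in> Cells C f g; b \<in> Cells C g h; c \<in> Cells C h k\<rbrakk>
        \<Longrightarrow> (c \<bullet> b) \<bullet> a = c \<bullet> (b \<bullet> a)"
    and hcomp_Cells: "\<lbrakk>a \<in> Cells C f f'; b \<in> Cells C g g'; src C g = trg C f\<rbrakk>
        \<Longrightarrow> b \<star> a \<in> Cells C (g \<cdot> f) (g' \<cdot> f')"
    and hcomp_id2: "\<lbrakk>f \<in> Mor C; g \<in> Mor C; src C g = trg C f\<rbrakk>
        \<Longrightarrow> id2 C g \<star> id2 C f = id2 C (g \<cdot> f)"
    and interchange: "\<lbrakk>a \<in> Cells C f f'; a' \<in> Cells C f' f''; b \<in> Cells C g g'; b' \<in> Cells C g' g'';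
          src C g = trg C f\<rbrakk>
        \<Longrightarrow> (b' \<bullet> b) \<star> (a' \<bullet> a) = (b' \<star> a') \<bullet> (b \<star> a)"
    and assoc_Isos: "\<lbrakk>f \<in> Mor C; g \<in> Mor C; h \<in> Mor C; src C g = trg C f; src C h = trg C g\<rbrakk>
        \<Longrightarrow> assoc C h g f \<in> Isos C ((h \<cdot> g) \<cdot> f) (h \<cdot> (g \<cdot> f))"
    and assoc_natural: "\<lbrakk>a \<in> Cells C f f'; b \<in> Cells C g g'; c \<in> Cells C h h';
          src C g = trg C f; src C h = trg C g\<rbrakk>
        \<Longrightarrow> assoc C h' g' f' \<bullet> ((c \<star> b) \<star> a) = (c \<star> (b \<star> a)) \<bullet> assoc C h g f"
    and lunit_Isos: "f \<in> Mor C \<Longrightarrow> lunit C f \<in> Isos C (id1 C (trg C f) \<cdot> f) f"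
    and runit_Isos: "f \<in> Mor C \<Longrightarrow> runit C f \<in> Isos C (f \<cdot> id1 C (src C f)) f"
    and lunit_natural: "a \<in> Cells C f f' \<Longrightarrow>
        lunit C f' \<bullet> (id1 C (trg C f) \<rhd> a) = a \<bullet> lunit C f"
    and runit_natural: "a \<in> Cells C f f' \<Longrightarrow>
        runit C f' \<bullet> (a \<lhd> id1 C (src C f)) = a \<bullet> runit C f"
    and pentagon: "\<lbrakk>f \<in> Mor C; g \<in> Mor C; h \<in> Mor C; k \<in> Mor C;
          src C g = trg C f; src C h = trg C g; src C k = trg C h\<rbrakk>
        \<Longrightarrow> assoc C k h (g \<cdot> f) \<bullet> assoc C (k \<cdot> h) g f
          = (k \<rhd> assoc C h g f) \<bullet> assoc C k (h \<cdot> g) f \<bullet> (assoc C k h g \<lhd> f)"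
    and triangle: "\<lbrakk>f \<in> Mor C; g \<in> Mor C; src C g = trg C f\<rbrakk>
        \<Longrightarrow> (g \<rhd> lunit C f) \<bullet> assoc C g (id1 C (src C g)) f = runit C g \<lhd> f"

text \<open>
  Whiskering by u on the right followed by rebracketing.  If a is a 2-morphism from f . v to f' . v',
  then rw C f v f' v' a u is the 2-morphism from f . (v . u) to f' . (v' . u) that is written
  a o u when associators are suppressed.  With it, every pasting below is composed along
  1-morphisms that are bracketed to the right.
\<close>

definition rw :: "('o, 'm, 'c, 'x) bicat_scheme \<Rightarrow> 'm \<Rightarrow> 'm \<Rightarrow> 'm \<Rightarrow> 'm \<Rightarrow> 'c \<Rightarrow> 'm \<Rightarrow> 'c"
  where "rw C f v f' v' a u = assoc C f' v' u \<bullet> (a \<lhd> u) \<bullet> inv2 C (assoc C f v u)"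
  for C (structure)

definition BF4a_triple ::
    "('o, 'm, 'c, 'x) bicat_scheme \<Rightarrow> 'm set \<Rightarrow> 'm \<Rightarrow> 'm \<Rightarrow> 'm \<Rightarrow> 'c \<Rightarrow> 'o \<times> 'm \<times> 'c \<Rightarrow> bool"
  where "BF4a_triple C W w f1 f2 \<alpha> = (\<lambda>(D, v, \<beta>).
    v \<in> W \<and> v \<in> Hom C D (src C f1) \<and> \<beta> \<in> Cells C (f1 \<cdot> v) (f2 \<cdot> v) \<and>
    rw C w f1 w f2 \<alpha> v = w \<rhd> \<beta>)"
  for C (structure)

definition filled_square ::
    "('o, 'm, 'c, 'x) bicat_scheme \<Rightarrow> 'm set \<Rightarrow> 'm \<Rightarrow> 'm \<Rightarrow> 'o \<times> 'm \<times> 'm \<times> 'c \<Rightarrow> bool"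
  where "filled_square C W f v = (\<lambda>(D, v', f', \<rho>).
    v' \<in> W \<and> v' \<in> Hom C D (src C f) \<and> f' \<in> Hom C D (src C v) \<and> \<rho> \<in> Isos C (f \<cdot> v') (v \<cdot> f'))"
  for C (structure)

text \<open>
  BF4b asks, for invertible \<alpha>, that BF4a can be achieved with an invertible \<beta>; it does not ask that
  every \<beta> as in BF4a be invertible.  BF4c is about arbitrary pairs of triples as in BF4a.
\<close>

locale BF = bicategory C for C :: "('o, 'm, 'c, 'x) bicat_scheme" (structure) +
  fixes W :: "'m set"
  assumes W_Mor: "W \<subseteq> Mor C"
    and BF1: "A \<in> Obj C \<Longrightarrow> id1 C A \<in> W"
    and BF2: "\<lbrakk>v \<in> W; w \<in> W; src C w = trg C v\<rbrakk> \<Longrightarrow> w \<cdot> v \<in> W"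
    and BF3: "\<lbrakk>w \<in> W; w \<in> Hom C A B; f \<in> Hom C D B\<rbrakk> \<Longrightarrow> \<exists>S. filled_square C W f w S"
    and BF4a: "\<lbrakk>w \<in> W; w \<in> Hom C B A; f1 \<in> Hom C D B; f2 \<in> Hom C D B;
          \<alpha> \<in> Cells C (w \<cdot> f1) (w \<cdot> f2)\<rbrakk>
        \<Longrightarrow> \<exists>T. BF4a_triple C W w f1 f2 \<alpha> T"
    and BF4b: "\<lbrakk>w \<in> W; w \<in> Hom C B A; f1 \<in> Hom C D B; f2 \<in> Hom C D B;
          \<alpha> \<in> Isos C (w \<cdot> f1) (w \<cdot> f2)\<rbrakk>
        \<Longrightarrow> \<exists>E v \<beta>. BF4a_triple C W w f1 f2 \<alpha> (E, v, \<beta>) \<and> \<beta> \<in> Isos C (f1 \<cdot> v) (f2 \<cdot> v)"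
    and BF4c: "\<lbrakk>w \<in> W; w \<in> Hom C B A; f1 \<in> Hom C F B; f2 \<in> Hom C F B;
          \<alpha> \<in> Cells C (w \<cdot> f1) (w \<cdot> f2);
          BF4a_triple C W w f1 f2 \<alpha> (D, v, \<beta>); BF4a_triple C W w f1 f2 \<alpha> (D', v', \<beta>')\<rbrakk>
        \<Longrightarrow> \<exists>E u u' \<zeta>. u \<in> Hom C E D \<and> u' \<in> Hom C E D' \<and>
              \<zeta> \<in> Isos C (v \<cdot> u) (v' \<cdot> u') \<and> v \<cdot> u \<in> W \<and>
              rw C f1 v' f2 v' \<beta>' u' \<bullet> (f1 \<rhd> \<zeta>) = (f2 \<rhd> \<zeta>) \<bullet> rw C f1 v f2 v \<beta> u"
    and BF5: "\<lbrakk>w \<in> W; \<gamma> \<in> Isos C v w\<rbrakk> \<Longrightarrow> v \<in> W"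

definition choices_C ::
    "('o, 'm, 'c, 'x) bicat_scheme \<Rightarrow> 'm set \<Rightarrow> ('m \<Rightarrow> 'm \<Rightarrow> 'o \<times> 'm \<times> 'm \<times> 'c) \<Rightarrow> bool"
  where "choices_C C W CW \<longleftrightarrow>
    (\<forall>A' B' B f v. f \<in> Hom C A' B \<longrightarrow> v \<in> Hom C B' B \<longrightarrow> v \<in> W \<longrightarrow> filled_square C W f v (CW f v))"

definition choices_D ::
    "('o, 'm, 'c, 'x) bicat_scheme \<Rightarrow> 'm set \<Rightarrow> ('m \<Rightarrow> 'm \<Rightarrow> 'm \<Rightarrow> 'c \<Rightarrow> 'o \<times> 'm \<times> 'c) \<Rightarrow> bool"
  where "choices_D C W DW \<longleftrightarrow>
    (\<forall>A B D w f1 f2 \<alpha>. w \<in> W \<longrightarrow> w \<in> Hom C B A \<longrightarrow> f1 \<in> Hom C D B \<longrightarrow> f2 \<in> Hom C D B \<longrightarrow>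
      \<alpha> \<in> Cells C (w \<cdot> f1) (w \<cdot> f2) \<longrightarrow> BF4a_triple C W w f1 f2 \<alpha> (DW w f1 f2 \<alpha>))"
  for C (structure)

definition frac_Hom ::
    "('o, 'm, 'c, 'x) bicat_scheme \<Rightarrow> 'm set \<Rightarrow> 'o \<Rightarrow> 'o \<Rightarrow> ('o \<times> 'm \<times> 'm) set"
  where "frac_Hom C W A B = {(A', w, f). w \<in> W \<and> w \<in> Hom C A' A \<and> f \<in> Hom C A' B}"

definition frac_comp ::
    "('o, 'm, 'c, 'x) bicat_scheme \<Rightarrow> ('m \<Rightarrow> 'm \<Rightarrow> 'o \<times> 'm \<times> 'm \<times> 'c) \<Rightarrow>
     'o \<times> 'm \<times> 'm \<Rightarrow> 'o \<times> 'm \<times> 'm \<Rightarrow> 'o \<times> 'm \<times> 'm"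
  where "frac_comp C CW = (\<lambda>(B', v, g) (A', w, f).
    case CW f v of (A'', v', f', \<rho>) \<Rightarrow> (A'', w \<cdot> v', g \<cdot> f'))"
  for C (structure)

definition frac_reps ::
    "('o, 'm, 'c, 'x) bicat_scheme \<Rightarrow> 'm set \<Rightarrow> 'o \<times> 'm \<times> 'm \<Rightarrow> 'o \<times> 'm \<times> 'm \<Rightarrow>
     ('o \<times> 'm \<times> 'm \<times> 'c \<times> 'c) set"
  where "frac_reps C W = (\<lambda>(A1, w1, f1) (A2, w2, f2). {(A3, v1, v2, \<alpha>, \<beta>).
    v1 \<in> Hom C A3 A1 \<and> v2 \<in> Hom C A3 A2 \<and> w1 \<cdot> v1 \<in> W \<and>
    \<alpha> \<in> Isos C (w1 \<cdot> v1) (w2 \<cdot> v2) \<and> \<beta> \<in> Cells C (f1 \<cdot> v1) (f2 \<cdot> v2)})"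
  for C (structure)

definition frac_equiv ::
    "('o, 'm, 'c, 'x) bicat_scheme \<Rightarrow> 'm set \<Rightarrow> 'o \<times> 'm \<times> 'm \<Rightarrow> 'o \<times> 'm \<times> 'm \<Rightarrow>
     ('o \<times> 'm \<times> 'm \<times> 'c \<times> 'c) rel"
  where "frac_equiv C W F1 F2 = (case (F1, F2) of ((A1, w1, f1), (A2, w2, f2)) \<Rightarrow>
    {((A3, v1, v2, \<alpha>, \<beta>), (A3', v1', v2', \<alpha>', \<beta>')).
      (A3, v1, v2, \<alpha>, \<beta>) \<in> frac_reps C W F1 F2 \<and> (A3', v1', v2', \<alpha>', \<beta>') \<in> frac_reps C W F1 F2 \<and>
      (\<exists>A4 z z' \<sigma>1 \<sigma>2. z \<in> Hom C A4 A3 \<and> z' \<in> Hom C A4 A3' \<and>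
        \<sigma>1 \<in> Isos C (v1' \<cdot> z') (v1 \<cdot> z) \<and> \<sigma>2 \<in> Isos C (v2 \<cdot> z) (v2' \<cdot> z') \<and>
        w1 \<cdot> (v1 \<cdot> z) \<in> W \<and>
        (w2 \<rhd> \<sigma>2) \<bullet> rw C w1 v1 w2 v2 \<alpha> z \<bullet> (w1 \<rhd> \<sigma>1) = rw C w1 v1' w2 v2' \<alpha>' z' \<and>
        (f2 \<rhd> \<sigma>2) \<bullet> rw C f1 v1 f2 v2 \<beta> z \<bullet> (f1 \<rhd> \<sigma>1) = rw C f1 v1' f2 v2' \<beta>' z')})"
  for C (structure)

definition frac_Cells ::
    "('o, 'm, 'c, 'x) bicat_scheme \<Rightarrow> 'm set \<Rightarrow> 'o \<times> 'm \<times> 'm \<Rightarrow> 'o \<times> 'm \<times> 'm \<Rightarrow>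
     ('o \<times> 'm \<times> 'm \<times> 'c \<times> 'c) set set"
  where "frac_Cells C W F1 F2 = frac_reps C W F1 F2 // frac_equiv C W F1 F2"

text \<open>
  Notation from here on: (D1, u1, h1, \<rho>1) and (D2, u2, h2, \<rho>2) are the squares chosen for
  (f1, u) and (f2, u); (D3, u3, u4, \<eta>1), (D4, u5, u6, \<eta>2) and (D5, u7, u8, \<eta>3) are squares on
  (v1, u1), (v2, u2) and (u3, u5).

  Given \<theta> from k1 . v1 to k2 . v2, the 2-morphism transport goes from k1 . (u1 . (u4 . u7)) to
  k2 . (u2 . (u6 . u8)); without associators it is the vertical composite of
  k1 o \<eta>1^-1 o u7, then \<theta> o u3 o u7, then k2 o v2 o \<eta>3, then k2 o \<eta>2 o u8.
  It is used with (f1, f2, \<beta>) and with (w1, w2, \<alpha>).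
\<close>

definition transport ::
    "('o, 'm, 'c, 'x) bicat_scheme \<Rightarrow> 'm \<Rightarrow> 'm \<Rightarrow> 'm \<Rightarrow> 'm \<Rightarrow> 'c \<Rightarrow> 'm \<Rightarrow> 'm \<Rightarrow>
     'o \<times> 'm \<times> 'm \<times> 'c \<Rightarrow> 'o \<times> 'm \<times> 'm \<times> 'c \<Rightarrow> 'o \<times> 'm \<times> 'm \<times> 'c \<Rightarrow> 'c"
  where "transport C k1 v1 k2 v2 \<theta> u1 u2 = (\<lambda>(D3, u3, u4, \<eta>1) (D4, u5, u6, \<eta>2) (D5, u7, u8, \<eta>3).
      (k2 \<rhd> rw C v2 u5 u2 u6 \<eta>2 u8)
    \<bullet> (k2 \<rhd> (v2 \<rhd> \<eta>3))
    \<bullet> rw C k1 v1 k2 v2 \<theta> (u3 \<cdot> u7)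
    \<bullet> (k1 \<rhd> rw C u1 u4 v1 u3 (inv2 C \<eta>1) u7))"
  for C (structure)

definition whisker_target ::
    "('o, 'm, 'c, 'x) bicat_scheme \<Rightarrow> 'm \<Rightarrow> 'm \<Rightarrow> 'm \<Rightarrow> 'o \<times> 'm \<times> 'm \<times> 'c \<Rightarrow> 'o \<times> 'm \<times> 'm \<times> 'c \<Rightarrow>
     'o \<times> 'm \<times> 'm \<times> 'c \<times> 'c \<Rightarrow>
     'o \<times> 'm \<times> 'm \<times> 'c \<Rightarrow> 'o \<times> 'm \<times> 'm \<times> 'c \<Rightarrow> 'o \<times> 'm \<times> 'm \<times> 'c \<Rightarrow> 'c"
  where "whisker_target C u f1 f2 = (\<lambda>(D1, u1, h1, \<rho>1) (D2, u2, h2, \<rho>2) (A3, v1, v2, \<alpha>, \<beta>)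
      (D3, u3, u4, \<eta>1) (D4, u5, u6, \<eta>2) (D5, u7, u8, \<eta>3).
      rw C f2 u2 u h2 \<rho>2 (u6 \<cdot> u8)
    \<bullet> transport C f1 v1 f2 v2 \<beta> u1 u2 (D3, u3, u4, \<eta>1) (D4, u5, u6, \<eta>2) (D5, u7, u8, \<eta>3)
    \<bullet> rw C u h1 f1 u1 (inv2 C \<rho>1) (u4 \<cdot> u7))"
  for C (structure)

definition whisker_data ::
    "('o, 'm, 'c, 'x) bicat_scheme \<Rightarrow> 'm set \<Rightarrow> 'm \<Rightarrow> 'm \<Rightarrow> 'm \<Rightarrow>
     'o \<times> 'm \<times> 'm \<times> 'c \<Rightarrow> 'o \<times> 'm \<times> 'm \<times> 'c \<Rightarrow> 'o \<times> 'm \<times> 'm \<times> 'c \<times> 'c \<Rightarrow>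
     'o \<times> 'm \<times> 'm \<times> 'c \<Rightarrow> 'o \<times> 'm \<times> 'm \<times> 'c \<Rightarrow> 'o \<times> 'm \<times> 'm \<times> 'c \<Rightarrow> 'c \<Rightarrow> bool"
  where "whisker_data C W u f1 f2 = (\<lambda>(D1, u1, h1, \<rho>1) (D2, u2, h2, \<rho>2) (A3, v1, v2, \<alpha>, \<beta>)
      (D3, u3, u4, \<eta>1) (D4, u5, u6, \<eta>2) (D5, u7, u8, \<eta>3) lam.
    filled_square C W v1 u1 (D3, u3, u4, \<eta>1) \<and>
    filled_square C W v2 u2 (D4, u5, u6, \<eta>2) \<and>
    filled_square C W u3 u5 (D5, u7, u8, \<eta>3) \<and>
    lam \<in> Cells C (h1 \<cdot> (u4 \<cdot> u7)) (h2 \<cdot> (u6 \<cdot> u8)) \<and>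
    u \<rhd> lam = whisker_target C u f1 f2 (D1, u1, h1, \<rho>1) (D2, u2, h2, \<rho>2) (A3, v1, v2, \<alpha>, \<beta>)
      (D3, u3, u4, \<eta>1) (D4, u5, u6, \<eta>2) (D5, u7, u8, \<eta>3))"
  for C (structure)

text \<open>
  The outer associators in the last two components pass from (w1 . u1) . (u4 . u7) to
  w1 . (u1 . (u4 . u7)), and so on, since the composite span has legs w1 . u1 and g . h1.
\<close>

definition whisker_rep ::
    "('o, 'm, 'c, 'x) bicat_scheme \<Rightarrow> 'm \<Rightarrow> 'm \<Rightarrow> 'm \<Rightarrow>
     'o \<times> 'm \<times> 'm \<times> 'c \<Rightarrow> 'o \<times> 'm \<times> 'm \<times> 'c \<Rightarrow> 'o \<times> 'm \<times> 'm \<times> 'c \<times> 'c \<Rightarrow>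
     'o \<times> 'm \<times> 'm \<times> 'c \<Rightarrow> 'o \<times> 'm \<times> 'm \<times> 'c \<Rightarrow> 'o \<times> 'm \<times> 'm \<times> 'c \<Rightarrow> 'c \<Rightarrow>
     'o \<times> 'm \<times> 'm \<times> 'c \<times> 'c"
  where "whisker_rep C g w1 w2 = (\<lambda>(D1, u1, h1, \<rho>1) (D2, u2, h2, \<rho>2) (A3, v1, v2, \<alpha>, \<beta>)
      (D3, u3, u4, \<eta>1) (D4, u5, u6, \<eta>2) (D5, u7, u8, \<eta>3) lam.
    (D5, u4 \<cdot> u7, u6 \<cdot> u8,
     inv2 C (assoc C w2 u2 (u6 \<cdot> u8))
       \<bullet> transport C w1 v1 w2 v2 \<alpha> u1 u2 (D3, u3, u4, \<eta>1) (D4, u5, u6, \<eta>2) (D5, u7, u8, \<eta>3)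
       \<bullet> assoc C w1 u1 (u4 \<cdot> u7),
     inv2 C (assoc C g h2 (u6 \<cdot> u8)) \<bullet> (g \<rhd> lam) \<bullet> assoc C g h1 (u4 \<cdot> u7)))"
  for C (structure)

text \<open>
  Pronk's selection.  The squares are the chosen ones.  Then DW is applied to u and to
  whisker_target, a 2-morphism from u . (h1 . (u4 . u7)) to u . (h2 . (u6 . u8)).  The morphism p
  it gives is absorbed into the third square, and \<kappa>, rebracketed, is the 2-morphism lam.
\<close>

definition chosen_whisker_rep ::
    "('o, 'm, 'c, 'x) bicat_scheme \<Rightarrow> ('m \<Rightarrow> 'm \<Rightarrow> 'o \<times> 'm \<times> 'm \<times> 'c) \<Rightarrow>
     ('m \<Rightarrow> 'm \<Rightarrow> 'm \<Rightarrow> 'c \<Rightarrow> 'o \<times> 'm \<times> 'c) \<Rightarrow>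
     'o \<times> 'm \<times> 'm \<Rightarrow> 'o \<times> 'm \<times> 'm \<Rightarrow> 'o \<times> 'm \<times> 'm \<Rightarrow> 'o \<times> 'm \<times> 'm \<times> 'c \<times> 'c \<Rightarrow>
     'o \<times> 'm \<times> 'm \<times> 'c \<times> 'c"
  where "chosen_whisker_rep C CW DW = (\<lambda>(B', u, g) (A1, w1, f1) (A2, w2, f2) (A3, v1, v2, \<alpha>, \<beta>).
    let (D1, u1, h1, \<rho>1) = CW f1 u;
        (D2, u2, h2, \<rho>2) = CW f2 u;
        (D3, u3, u4, \<eta>1) = CW v1 u1;
        (D4, u5, u6, \<eta>2) = CW v2 u2;
        (D5, u7, u8, \<eta>3) = CW u3 u5;
        (D, p, \<kappa>) = DW u (h1 \<cdot> (u4 \<cdot> u7)) (h2 \<cdot> (u6 \<cdot> u8))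
          (whisker_target C u f1 f2 (D1, u1, h1, \<rho>1) (D2, u2, h2, \<rho>2) (A3, v1, v2, \<alpha>, \<beta>)
            (D3, u3, u4, \<eta>1) (D4, u5, u6, \<eta>2) (D5, u7, u8, \<eta>3))
    in whisker_rep C g w1 w2 (D1, u1, h1, \<rho>1) (D2, u2, h2, \<rho>2) (A3, v1, v2, \<alpha>, \<beta>)
         (D3, u3, u4, \<eta>1) (D4, u5, u6, \<eta>2)
         (D, u7 \<cdot> p, u8 \<cdot> p, rw C u3 u7 u5 u8 \<eta>3 p)
         ((h2 \<rhd> assoc C u6 u8 p) \<bullet> assoc C h2 (u6 \<cdot> u8) p \<bullet> \<kappa>
            \<bullet> inv2 C (assoc C h1 (u4 \<cdot> u7) p) \<bullet> (h1 \<rhd> inv2 C (assoc C u4 u7 p))))"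
  for C (structure)

text \<open>
  The union is over all representatives of \<Gamma>; it is a single equivalence class as soon as the
  class of the chosen quintuple does not depend on the representative.
\<close>

definition frac_whisker ::
    "('o, 'm, 'c, 'x) bicat_scheme \<Rightarrow> 'm set \<Rightarrow> ('m \<Rightarrow> 'm \<Rightarrow> 'o \<times> 'm \<times> 'm \<times> 'c) \<Rightarrow>
     ('m \<Rightarrow> 'm \<Rightarrow> 'm \<Rightarrow> 'c \<Rightarrow> 'o \<times> 'm \<times> 'c) \<Rightarrow>
     'o \<times> 'm \<times> 'm \<Rightarrow> 'o \<times> 'm \<times> 'm \<Rightarrow> 'o \<times> 'm \<times> 'm \<Rightarrow> ('o \<times> 'm \<times> 'm \<times> 'c \<times> 'c) set \<Rightarrow>
     ('o \<times> 'm \<times> 'm \<times> 'c \<times> 'c) set"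
  where "frac_whisker C W CW DW G F1 F2 \<Gamma> =
    (\<Union>r\<in>\<Gamma>. frac_equiv C W (frac_comp C CW G F1) (frac_comp C CW G F2)
              `` {chosen_whisker_rep C CW DW G F1 F2 r})"

end

(*
Strictification: a 2-morphism between right-bracketed composites is regarded as a 2-morphism between
the lists of their factors, and for these whiskering and composition are strictly associative.

In the strict calculus the data (F8)-(F10) only matter through a := u3 u7 in W, x := u4 u7,
y := u6 u8, the invertible 2-morphisms E1 : v1 a => u1 x and E2 : v2 a => u2 y, and lam with
  u lam = (rho2 y) (f2 E2) (beta a) (f1 E1^-1) (rho1^-1 x),
while mu = (w2 E2) (alpha a) (w1 E1^-1).  Let (a, x, y, E1, E2, lam) and (a', x', y', E1', E2', lam')
belong to representatives that are equivalent through z, z'.  BF3 gives a t = z b and a' t' = z' b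
up to isomorphism with b in W.  Pasting yields u1 x' t' = u1 x t and u2 y t = u2 y' t', and BF4b,
applied to u1 and u2, removes u1 and u2 after restriction along some s in W.  The resulting
2-morphisms satisfy the equation for mu at once, but the one for lam only after composition
with u.  By BF4a and BF4c, u G = u G' implies G e = G' e for some e in W, which removes u.

The same use of BF3 and BF4b shows that equivalence of representatives is transitive.
*)

theory Submission
  imports Defs
begin

text \<open>In the formal statement every pasting carries its associators, and the legs of a
  composite span are genuine composites \<open>w1 \<cdot> u1\<close>. The comparison is therefore
  proved for lists, where \<open>[w1, u1]\<close> stays unbracketed, and then moved to the
  composites by conjugation with identities read as 2-morphisms between a list and its composite.

  One comparison of two sets of data settles all three claims. The quintuple selected through the
  choices is itself induced by data (F8)-(F10), the third square being restricted along the morphism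
  that \<open>DW\<close> provides. So for every representative it is equivalent to the given
  quintuple, and the union in \<open>frac_whisker\<close> collapses to one class.

  The equations for mu and lam behave differently because u1 and u2 remain in the legs of the
  composite span: the comparison cells enter the equation for mu whiskered by u1 and u2, which is
  how they arose. In the equation for lam they are whiskered by h1 and h2, and only rho1 and rho2,
  which live under u, relate the two.\<close>

type_synonym ('m, 'c) path_cell = "'m list \<times> 'c \<times> 'm list"

lemma frac_equiv_reps:
  "(r, r') \<in> frac_equiv C W F1 F2 \<Longrightarrow> r \<in> frac_reps C W F1 F2"
  unfolding frac_equiv_def by (cases F1; cases F2; cases r; cases r') simp

section \<open>Bicategories and right-bracketed composites\<close>

context bicategory
begin

section \<open>Typing rules and the bicategory laws in simplifier form\<close>

lemma comp1_simps [simp]: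
  assumes "f \<in> Mor C" "g \<in> Mor C" "src C g = trg C f"
  shows "g \<cdot> f \<in> Mor C" "src C (g \<cdot> f) = src C f" "trg C (g \<cdot> f) = trg C g"
  using comp1_Hom[of f "src C f" "trg C f" g "trg C g"] assms by (auto simp: Hom_def)

lemma cell_simps [simp]:
  assumes "a \<in> Cell C"
  shows "dom2 C a \<in> Mor C" "cod2 C a \<in> Mor C"
    "src C (cod2 C a) = src C (dom2 C a)" "trg C (cod2 C a) = trg C (dom2 C a)"
  using assms dom2_Mor cod2_Mor src_parallel trg_parallel by auto

lemma id2_simps [simp]:
  assumes "f \<in> Mor C"
  shows "id2 C f \<in> Cell C" "dom2 C (id2 C f) = f" "cod2 C (id2 C f) = f"
  using id2_Cells[OF assms] by (auto simp: Cells_def)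

lemma vcomp_simps [simp]:
  assumes "a \<in> Cell C" "b \<in> Cell C" "dom2 C b = cod2 C a"
  shows "b \<bullet> a \<in> Cell C" "dom2 C (b \<bullet> a) = dom2 C a" "cod2 C (b \<bullet> a) = cod2 C b"
  using vcomp_Cells[of a "dom2 C a" "cod2 C a" b "cod2 C b"] assms by (auto simp: Cells_def)

lemma hcomp_simps [simp]:
  assumes "a \<in> Cell C" "b \<in> Cell C" "src C (dom2 C b) = trg C (dom2 C a)"
  shows "b \<star> a \<in> Cell C" "dom2 C (b \<star> a) = dom2 C b \<cdot> dom2 C a"
    "cod2 C (b \<star> a) = cod2 C b \<cdot> cod2 C a"
  using hcomp_Cells[of a "dom2 C a" "cod2 C a" b "dom2 C b" "cod2 C b"] assms
  by (auto simp: Cells_def)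

lemma vcomp_id_simps [simp]:
  assumes "a \<in> Cell C"
  shows "cod2 C a = f \<Longrightarrow> id2 C f \<bullet> a = a" "dom2 C a = f \<Longrightarrow> a \<bullet> id2 C f = a"
  using vcomp_id_left[of a] vcomp_id_right[of a] assms by (auto simp: Cells_def)

text \<open>Vertical composites are kept right-nested. Where a law needs another grouping, the
  composite is first regrouped in an explicit calculation step, which holds because both sides
  normalise to the same nesting.\<close>

lemma vcomp_assoc_simp [simp]:
  assumes "a \<in> Cell C" "b \<in> Cell C" "c \<in> Cell C" "dom2 C b = cod2 C a" "dom2 C c = cod2 C b"
  shows "(c \<bullet> b) \<bullet> a = c \<bullet> (b \<bullet> a)"
  using vcomp_assoc[of a _ _ b _ c] assms by (auto simp: Cells_def)

lemma hcomp_id2_simp [simp]: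
  "\<lbrakk>f \<in> Mor C; g \<in> Mor C; src C g = trg C f\<rbrakk> \<Longrightarrow> id2 C g \<star> id2 C f = id2 C (g \<cdot> f)"
  by (rule hcomp_id2)

lemma hcomp_vcomp:
  assumes "a \<in> Cell C" "a' \<in> Cell C" "b \<in> Cell C" "b' \<in> Cell C"
    "dom2 C a' = cod2 C a" "dom2 C b' = cod2 C b" "src C (dom2 C b) = trg C (dom2 C a)"
  shows "(b' \<star> a') \<bullet> (b \<star> a) = (b' \<bullet> b) \<star> (a' \<bullet> a)"
  using interchange[of a "dom2 C a" "cod2 C a" a' "cod2 C a'" b "dom2 C b" "cod2 C b" b' "cod2 C b'"]
    assms by (auto simp: Cells_def)

lemma lwhisker_simps [simp]:
  assumes "f \<in> Mor C" "a \<in> Cell C" "src C f = trg C (dom2 C a)"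
  shows "f \<rhd> a \<in> Cell C" "dom2 C (f \<rhd> a) = f \<cdot> dom2 C a" "cod2 C (f \<rhd> a) = f \<cdot> cod2 C a"
  using assms by (auto simp: lwhisker_def)

lemma rwhisker_simps [simp]:
  assumes "f \<in> Mor C" "a \<in> Cell C" "trg C f = src C (dom2 C a)"
  shows "a \<lhd> f \<in> Cell C" "dom2 C (a \<lhd> f) = dom2 C a \<cdot> f" "cod2 C (a \<lhd> f) = cod2 C a \<cdot> f"
  using assms by (auto simp: rwhisker_def)

lemma whisker_id2 [simp]:
  assumes "f \<in> Mor C" "g \<in> Mor C" "src C g = trg C f"
  shows "g \<rhd> id2 C f = id2 C (g \<cdot> f)" "id2 C g \<lhd> f = id2 C (g \<cdot> f)"
  using assms by (auto simp: lwhisker_def rwhisker_def)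

lemma lwhisker_vcomp:
  assumes "f \<in> Mor C" "a \<in> Cell C" "b \<in> Cell C" "dom2 C b = cod2 C a" "src C f = trg C (dom2 C a)"
  shows "f \<rhd> (b \<bullet> a) = (f \<rhd> b) \<bullet> (f \<rhd> a)"
  using assms by (simp add: lwhisker_def hcomp_vcomp)

lemma rwhisker_vcomp:
  assumes "f \<in> Mor C" "a \<in> Cell C" "b \<in> Cell C" "dom2 C b = cod2 C a" "src C (dom2 C a) = trg C f"
  shows "(b \<bullet> a) \<lhd> f = (b \<lhd> f) \<bullet> (a \<lhd> f)"
  using assms by (simp add: rwhisker_def hcomp_vcomp)

text \<open>Both sides are \<open>b \<star> a\<close>, by interchange with identities.\<close>

lemma whisker_exchange:
  assumes "a \<in> Cell C" "b \<in> Cell C" "src C (dom2 C b) = trg C (dom2 C a)"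
  shows "(b \<lhd> cod2 C a) \<bullet> (dom2 C b \<rhd> a) = (cod2 C b \<rhd> a) \<bullet> (b \<lhd> dom2 C a)"
  using assms by (simp add: lwhisker_def rwhisker_def hcomp_vcomp)

lemma inverse2_unique:
  assumes "inverse2 C a b" "inverse2 C a b'" "a \<in> Cell C"
  shows "b = b'"
proof -
  have "b = b \<bullet> (a \<bullet> b')"
    using assms by (simp add: inverse2_def Cells_def)
  also have "\<dots> = (b \<bullet> a) \<bullet> b'"
    using assms(3) assms(1,2)[unfolded inverse2_def Cells_def] by (intro vcomp_assoc_simp[symmetric]) auto
  also have "\<dots> = b'"
    using assms by (simp add: inverse2_def Cells_def)
  finally show ?thesis .
qed

lemma inv2_eq:
  "\<lbrakk>inverse2 C a b; a \<in> Cell C\<rbrakk> \<Longrightarrow> inv2 C a = b"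
  unfolding inv2_def using inverse2_unique by blast

lemma inverse2_inv2:
  assumes "a \<in> Isos C f g"
  shows "inverse2 C a (inv2 C a)"
  using assms inv2_eq unfolding Isos_def Cells_def by auto

lemma Isos_simps:
  assumes "a \<in> Isos C f g"
  shows "a \<in> Cell C" "dom2 C a = f" "cod2 C a = g" "inv2 C a \<in> Cell C"
    "dom2 C (inv2 C a) = g" "cod2 C (inv2 C a) = f"
    "inv2 C a \<bullet> a = id2 C f" "a \<bullet> inv2 C a = id2 C g"
  using inverse2_inv2[OF assms] assms by (auto simp: inverse2_def Isos_def Cells_def)

lemma assoc_simps [simp]:
  assumes "f \<in> Mor C" "g \<in> Mor C" "h \<in> Mor C" "src C g = trg C f" "src C h = trg C g"
  shows "assoc C h g f \<in> Cell C" "dom2 C (assoc C h g f) = (h \<cdot> g) \<cdot> f"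
    "cod2 C (assoc C h g f) = h \<cdot> (g \<cdot> f)"
    "inv2 C (assoc C h g f) \<in> Cell C" "dom2 C (inv2 C (assoc C h g f)) = h \<cdot> (g \<cdot> f)"
    "cod2 C (inv2 C (assoc C h g f)) = (h \<cdot> g) \<cdot> f"
    "inv2 C (assoc C h g f) \<bullet> assoc C h g f = id2 C ((h \<cdot> g) \<cdot> f)"
    "assoc C h g f \<bullet> inv2 C (assoc C h g f) = id2 C (h \<cdot> (g \<cdot> f))"
  using Isos_simps[OF assoc_Isos[OF assms]] by auto

lemma assoc_nat:
  assumes "a \<in> Cell C" "b \<in> Cell C" "c \<in> Cell C"
    "src C (dom2 C b) = trg C (dom2 C a)" "src C (dom2 C c) = trg C (dom2 C b)"
  shows "assoc C (cod2 C c) (cod2 C b) (cod2 C a) \<bullet> ((c \<star> b) \<star> a)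
       = (c \<star> (b \<star> a)) \<bullet> assoc C (dom2 C c) (dom2 C b) (dom2 C a)"
  using assms by (intro assoc_natural) (auto simp: Cells_def)

lemma assoc_nat_left:
  assumes "f \<in> Mor C" "g \<in> Mor C" "c \<in> Cell C" "src C g = trg C f" "src C (dom2 C c) = trg C g"
  shows "assoc C (cod2 C c) g f \<bullet> ((c \<lhd> g) \<lhd> f) = (c \<lhd> (g \<cdot> f)) \<bullet> assoc C (dom2 C c) g f"
  using assoc_nat[of "id2 C f" "id2 C g" c] assms by (simp add: rwhisker_def)

lemma assoc_nat_mid:
  assumes "f \<in> Mor C" "b \<in> Cell C" "h \<in> Mor C" "src C (dom2 C b) = trg C f" "src C h = trg C (dom2 C b)"
  shows "assoc C h (cod2 C b) f \<bullet> ((h \<rhd> b) \<lhd> f) = (h \<rhd> (b \<lhd> f)) \<bullet> assoc C h (dom2 C b) f"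
  using assoc_nat[of "id2 C f" b "id2 C h"] assms by (simp add: rwhisker_def lwhisker_def)

lemma assoc_nat_right:
  assumes "a \<in> Cell C" "g \<in> Mor C" "h \<in> Mor C" "src C g = trg C (dom2 C a)" "src C h = trg C g"
  shows "assoc C h g (cod2 C a) \<bullet> ((h \<cdot> g) \<rhd> a) = (h \<rhd> (g \<rhd> a)) \<bullet> assoc C h g (dom2 C a)"
  using assoc_nat[of a "id2 C g" "id2 C h"] assms by (simp add: lwhisker_def)

section \<open>Paths and coherence of their right-bracketed composites\<close>

definition path :: "'m list \<Rightarrow> bool"
  where "path p \<longleftrightarrow> set p \<subseteq> Mor C \<and> successively (\<lambda>f g. src C f = trg C g) p"

lemma path_simps [simp]:
  "path []"
  "path [f] \<longleftrightarrow> f \<in> Mor C"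
  "path (f # g # p) \<longleftrightarrow> f \<in> Mor C \<and> src C f = trg C g \<and> path (g # p)"
  by (auto simp: path_def)

lemma path_append:
  "path (p @ q) \<longleftrightarrow> path p \<and> path q \<and> (p = [] \<or> q = [] \<or> src C (last p) = trg C (hd q))"
  by (auto simp: path_def successively_append_iff)

fun rcomp :: "'m list \<Rightarrow> 'm" where
  "rcomp [] = undefined"
| "rcomp [f] = f"
| "rcomp (f # g # p) = f \<cdot> rcomp (g # p)"

lemma rcomp_Cons: "p \<noteq> [] \<Longrightarrow> rcomp (f # p) = f \<cdot> rcomp p"
  by (cases p) auto

lemma rcomp_simps [simp]:
  assumes "path p" "p \<noteq> []"
  shows "rcomp p \<in> Mor C" "src C (rcomp p) = src C (last p)" "trg C (rcomp p) = trg C (hd p)"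
proof -
  have "rcomp p \<in> Mor C \<and> src C (rcomp p) = src C (last p) \<and> trg C (rcomp p) = trg C (hd p)"
    using assms by (induction p rule: rcomp.induct) auto
  then show "rcomp p \<in> Mor C" "src C (rcomp p) = src C (last p)" "trg C (rcomp p) = trg C (hd p)"
    by auto
qed

text \<open>The canonical isomorphism from \<open>rcomp p \<cdot> rcomp r\<close> to \<open>rcomp (p @ r)\<close>, and its inverse.\<close>

fun rebr :: "'m list \<Rightarrow> 'm list \<Rightarrow> 'c" where
  "rebr [] r = undefined"
| "rebr [f] r = id2 C (f \<cdot> rcomp r)"
| "rebr (f # g # p) r = (f \<rhd> rebr (g # p) r) \<bullet> assoc C f (rcomp (g # p)) (rcomp r)"

fun rebr_inv :: "'m list \<Rightarrow> 'm list \<Rightarrow> 'c" where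
  "rebr_inv [] r = undefined"
| "rebr_inv [f] r = id2 C (f \<cdot> rcomp r)"
| "rebr_inv (f # g # p) r = inv2 C (assoc C f (rcomp (g # p)) (rcomp r)) \<bullet> (f \<rhd> rebr_inv (g # p) r)"

lemma rebr_props:
  assumes "path (p @ r)" "p \<noteq> []" "r \<noteq> []"
  shows "rebr p r \<in> Cell C \<and> dom2 C (rebr p r) = rcomp p \<cdot> rcomp r \<and> cod2 C (rebr p r) = rcomp (p @ r) \<and>
    rebr_inv p r \<in> Cell C \<and> cod2 C (rebr_inv p r) = rcomp p \<cdot> rcomp r \<and> dom2 C (rebr_inv p r) = rcomp (p @ r) \<and>
    rebr_inv p r \<bullet> rebr p r = id2 C (rcomp p \<cdot> rcomp r) \<and> rebr p r \<bullet> rebr_inv p r = id2 C (rcomp (p @ r))"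
  using assms
proof (induction p r rule: rebr.induct)
  case (2 f r)
  then show ?case
    using path_append[of "[f]" r] by (simp add: rcomp_Cons)
next
  case (3 f g p r)
  then have r: "path r" "path (g # p)" "f \<in> Mor C" "src C f = trg C g" "src C (last (g # p)) = trg C (hd r)"
    using path_append[of "f # g # p" r] by auto
  let ?q = "g # p"
  note IH = 3(1)
  have IH: "rebr ?q r \<in> Cell C" "dom2 C (rebr ?q r) = rcomp ?q \<cdot> rcomp r" "cod2 C (rebr ?q r) = rcomp (?q @ r)"
    "rebr_inv ?q r \<in> Cell C" "cod2 C (rebr_inv ?q r) = rcomp ?q \<cdot> rcomp r" "dom2 C (rebr_inv ?q r) = rcomp (?q @ r)"
    "rebr_inv ?q r \<bullet> rebr ?q r = id2 C (rcomp ?q \<cdot> rcomp r)" "rebr ?q r \<bullet> rebr_inv ?q r = id2 C (rcomp (?q @ r))"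
    using 3 by auto
  have T: "rcomp ?q \<in> Mor C" "src C (rcomp ?q) = trg C (hd r)" "trg C (rcomp ?q) = trg C g"
     "rcomp r \<in> Mor C" "trg C (rcomp r) = trg C (hd r)" "rcomp (?q @ r) \<in> Mor C" "trg C (rcomp (?q @ r)) = trg C g"
    using r 3 rcomp_simps[of ?q] rcomp_simps[of "?q @ r"] by auto
  \<comment> \<open>The composites are hidden behind constants whose types are recorded as facts, so
    that only the bicategory laws rewrite. Several proofs below use the same device.\<close>
  define Q where "Q = rcomp ?q"
  define R where "R = rcomp r"
  define QR where "QR = rcomp (?q @ r)"
  define c where "c = rebr ?q r"
  define c' where "c' = rebr_inv ?q r"
  note D = Q_def[symmetric] R_def[symmetric] QR_def[symmetric] c_def[symmetric] c'_def[symmetric]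
  note IH = IH[unfolded D] and T = T[unfolded D]
  have e: "c' \<bullet> c = id2 C (Q \<cdot> R)" "c \<bullet> c' = id2 C QR" using IH by auto
  have cpe: "rcomp (f # g # p) = f \<cdot> Q" "rcomp ((f # g # p) @ r) = f \<cdot> QR"
    by (simp_all add: Q_def QR_def)
  note IHt = IH(1-6)
  have f1: "f \<rhd> (c' \<bullet> c) = (f \<rhd> c') \<bullet> (f \<rhd> c)" "f \<rhd> (c \<bullet> c') = (f \<rhd> c) \<bullet> (f \<rhd> c')"
    using IHt T r by (simp_all add: lwhisker_vcomp)
  have "(f \<rhd> c') \<bullet> (f \<rhd> c) \<bullet> assoc C f Q R = (f \<rhd> (c' \<bullet> c)) \<bullet> assoc C f Q R"
    using IHt T r unfolding f1 by simp
  also have "\<dots> = assoc C f Q R"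
    using T r unfolding e by simp
  finally have g1: "(f \<rhd> c') \<bullet> (f \<rhd> c) \<bullet> assoc C f Q R = assoc C f Q R" .
  have "assoc C f Q R \<bullet> inv2 C (assoc C f Q R) \<bullet> (f \<rhd> c')
     = (assoc C f Q R \<bullet> inv2 C (assoc C f Q R)) \<bullet> (f \<rhd> c')"
    using IHt T r by (simp del: assoc_simps(7,8))
  also have "\<dots> = f \<rhd> c'"
    using IHt T r by simp
  finally have g2: "(f \<rhd> c) \<bullet> assoc C f Q R \<bullet> inv2 C (assoc C f Q R) \<bullet> (f \<rhd> c') = f \<rhd> (c \<bullet> c')"
    unfolding f1 by simp
  show ?case
    using IHt T r g1 g2 e unfolding rebr.simps rebr_inv.simps D cpe by simp
qed auto

lemma rebr_simps [simp]:
  assumes "path (p @ r)" "p \<noteq> []" "r \<noteq> []"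
  shows "rebr p r \<in> Cell C" "dom2 C (rebr p r) = rcomp p \<cdot> rcomp r" "cod2 C (rebr p r) = rcomp (p @ r)"
    "rebr_inv p r \<in> Cell C" "cod2 C (rebr_inv p r) = rcomp p \<cdot> rcomp r" "dom2 C (rebr_inv p r) = rcomp (p @ r)"
    "rebr_inv p r \<bullet> rebr p r = id2 C (rcomp p \<cdot> rcomp r)" "rebr p r \<bullet> rebr_inv p r = id2 C (rcomp (p @ r))"
  using rebr_props[OF assms] by auto

lemma path_appendD:
  assumes "path (p @ q)"
  shows "path p" "path q"
  using assms by (auto simp: path_append)

lemma path_Cons: "p \<noteq> [] \<Longrightarrow> path (f # p) \<longleftrightarrow> f \<in> Mor C \<and> src C f = trg C (hd p) \<and> path p"
  by (cases p) auto

lemma path_append_joint: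
  "\<lbrakk>path (p @ q); p \<noteq> []; q \<noteq> []\<rbrakk> \<Longrightarrow> src C (last p) = trg C (hd q)"
  by (simp add: path_append)

lemma rebr_Cons: "p \<noteq> [] \<Longrightarrow> rebr (f # p) r = (f \<rhd> rebr p r) \<bullet> assoc C f (rcomp p) (rcomp r)"
  by (cases p) auto

lemma rebr_inv_Cons: "p \<noteq> [] \<Longrightarrow> rebr_inv (f # p) r = inv2 C (assoc C f (rcomp p) (rcomp r)) \<bullet> (f \<rhd> rebr_inv p r)"
  by (cases p) auto

text \<open>In a right-nested composite \<open>b \<bullet> a\<close> is not a subterm, so an inverse
  pair in front of a further factor does not cancel by rewriting alone.\<close>

lemma vcomp_cancel:
  assumes "a \<in> Cell C" "b \<in> Cell C" "x \<in> Cell C" "cod2 C a = dom2 C b" "cod2 C x = dom2 C a"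
    "b \<bullet> a = id2 C (cod2 C x)"
  shows "b \<bullet> a \<bullet> x = x"
proof -
  have "b \<bullet> a \<bullet> x = (b \<bullet> a) \<bullet> x"
    using assms(1-5) by simp
  then show ?thesis
    using assms by simp
qed

text \<open>The only use of the pentagon: right whiskering by lists becomes strictly associative.\<close>

lemma rebr_assoc:
  assumes "path (p @ q @ r)" "p \<noteq> []" "q \<noteq> []" "r \<noteq> []"
  shows "rebr (p @ q) r \<bullet> (rebr p q \<lhd> rcomp r)
       = rebr p (q @ r) \<bullet> (rcomp p \<rhd> rebr q r) \<bullet> assoc C (rcomp p) (rcomp q) (rcomp r)"
  using assms
proof (induction p)
  case (Cons f p)
  have qr: "path q" "path r" "path (q @ r)" "src C (last q) = trg C (hd r)"
    using Cons path_appendD[of "f # p"] path_appendD[of q r] path_append_joint[of q r] by auto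
  show ?case
  proof (cases "p = []")
    case True
    have f: "f \<in> Mor C" "src C f = trg C (hd q)"
      using Cons qr True by (auto simp: path_Cons)
    show ?thesis
      using True qr f Cons(3-5) by (simp add: rebr_Cons rcomp_Cons)
  next
    case False
    have fp: "f \<in> Mor C" "path (p @ q @ r)" "src C f = trg C (hd p)"
      using Cons(2) False path_append[of "[f]" "p @ q @ r"] by auto
    have pp: "path p" "src C (last p) = trg C (hd q)" "path (p @ q)"
      using fp Cons(2-5) False path_append_joint[of p "q @ r"] path_appendD[of p "q @ r"]
        path_appendD[of "p @ q" r] by auto
    define P where "P = rcomp p"
    define Q where "Q = rcomp q"
    define R where "R = rcomp r"
    define QR where "QR = rcomp (q @ r)"
    define PQ where "PQ = rcomp (p @ q)"
    define PQR where "PQR = rcomp (p @ q @ r)"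
    note D = P_def[symmetric] Q_def[symmetric] R_def[symmetric] QR_def[symmetric]
      PQ_def[symmetric] PQR_def[symmetric]
    have T: "P \<in> Mor C" "Q \<in> Mor C" "R \<in> Mor C" "PQ \<in> Mor C" "QR \<in> Mor C" "PQR \<in> Mor C"
      "src C P = trg C Q" "src C Q = trg C R" "trg C P = src C f" "trg C PQ = src C f"
      "src C PQ = trg C R" "trg C QR = trg C Q" "trg C PQR = src C f"
      using fp pp qr Cons(3-5) False by (simp_all add: P_def Q_def R_def QR_def PQ_def PQR_def)
    define a where "a = rebr p q"
    define b where "b = rebr q r"
    define d where "d = rebr (p @ q) r"
    define e where "e = rebr p (q @ r)"
    note D2 = a_def[symmetric] b_def[symmetric] d_def[symmetric] e_def[symmetric]
    have ab: "a \<in> Cell C" "dom2 C a = P \<cdot> Q" "cod2 C a = PQ"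
      "b \<in> Cell C" "dom2 C b = Q \<cdot> R" "cod2 C b = QR"
      "d \<in> Cell C" "dom2 C d = PQ \<cdot> R" "cod2 C d = PQR"
      "e \<in> Cell C" "dom2 C e = P \<cdot> QR" "cod2 C e = PQR"
      using fp pp qr Cons(3-5) False
      by (simp_all add: a_def b_def d_def e_def P_def Q_def R_def QR_def PQ_def PQR_def)
    have IH: "d \<bullet> (a \<lhd> R) = e \<bullet> (P \<rhd> b) \<bullet> assoc C P Q R"
      using Cons.IH fp Cons(3-5) False unfolding D D2 by simp
    \<comment> \<open>Naturality moves the associator of the head \<open>f\<close> past
      \<open>a\<close>, the induction hypothesis applies under \<open>f\<close>, the pentagon trades
      three associators for two, and naturality moves one of these past \<open>b\<close>.\<close>
    have "((f \<rhd> d) \<bullet> assoc C f PQ R) \<bullet> (((f \<rhd> a) \<bullet> assoc C f P Q) \<lhd> R)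
       = (f \<rhd> d) \<bullet> (assoc C f PQ R \<bullet> ((f \<rhd> a) \<lhd> R)) \<bullet> (assoc C f P Q \<lhd> R)"
      using ab T fp by (simp add: rwhisker_vcomp)
    also have "assoc C f PQ R \<bullet> ((f \<rhd> a) \<lhd> R) = (f \<rhd> (a \<lhd> R)) \<bullet> assoc C f (P \<cdot> Q) R"
      using assoc_nat_mid[of R a f] ab T fp by simp
    also have "(f \<rhd> d) \<bullet> ((f \<rhd> (a \<lhd> R)) \<bullet> assoc C f (P \<cdot> Q) R) \<bullet> (assoc C f P Q \<lhd> R)
      = (f \<rhd> (d \<bullet> (a \<lhd> R))) \<bullet> assoc C f (P \<cdot> Q) R \<bullet> (assoc C f P Q \<lhd> R)"
      using ab T fp by (simp add: lwhisker_vcomp)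
    also have "\<dots> = (f \<rhd> e) \<bullet> (f \<rhd> (P \<rhd> b)) \<bullet>
        ((f \<rhd> assoc C P Q R) \<bullet> assoc C f (P \<cdot> Q) R \<bullet> (assoc C f P Q \<lhd> R))"
      unfolding IH using ab T fp by (simp add: lwhisker_vcomp)
    also have "(f \<rhd> assoc C P Q R) \<bullet> assoc C f (P \<cdot> Q) R \<bullet> (assoc C f P Q \<lhd> R)
        = assoc C f P (Q \<cdot> R) \<bullet> assoc C (f \<cdot> P) Q R"
      using pentagon[of R Q P f] T fp by simp
    also have "(f \<rhd> e) \<bullet> (f \<rhd> (P \<rhd> b)) \<bullet> assoc C f P (Q \<cdot> R) \<bullet> assoc C (f \<cdot> P) Q R
        = (f \<rhd> e) \<bullet> ((f \<rhd> (P \<rhd> b)) \<bullet> assoc C f P (Q \<cdot> R)) \<bullet> assoc C (f \<cdot> P) Q R"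
      using ab T fp by simp
    also have "(f \<rhd> (P \<rhd> b)) \<bullet> assoc C f P (Q \<cdot> R) = assoc C f P QR \<bullet> ((f \<cdot> P) \<rhd> b)"
      using assoc_nat_right[of b P f] ab T fp by simp
    finally have "((f \<rhd> d) \<bullet> assoc C f PQ R) \<bullet> (((f \<rhd> a) \<bullet> assoc C f P Q) \<lhd> R)
       = ((f \<rhd> e) \<bullet> assoc C f P QR) \<bullet> ((f \<cdot> P) \<rhd> b) \<bullet> assoc C (f \<cdot> P) Q R"
      using ab T fp by simp
    then show ?thesis
      using False Cons(3-5) by (simp add: rebr_Cons rcomp_Cons D D2)
  qed
qed simp

section \<open>The strictly associative calculus of 2-morphisms between lists\<close>

text \<open>
  Composites that are undefined, or involve an ill-typed triple, take the absorbing value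
  \<open>pzero\<close>; so composition is associative and whiskering is functorial without side
  conditions.  The empty list may be whiskered with, but is not a 1-morphism.
\<close>

definition pcell :: "('m, 'c) path_cell \<Rightarrow> bool"
  where "pcell A \<longleftrightarrow> (case A of (p, a, q) \<Rightarrow>
    p \<noteq> [] \<and> q \<noteq> [] \<and> path p \<and> path q \<and> a \<in> Cells C (rcomp p) (rcomp q))"

definition pzero :: "('m, 'c) path_cell"
  where "pzero = ([], undefined, [])"

definition pdom :: "('m, 'c) path_cell \<Rightarrow> 'm list" where "pdom A = fst A"
definition pcod :: "('m, 'c) path_cell \<Rightarrow> 'm list" where "pcod A = snd (snd A)"
definition pval :: "('m, 'c) path_cell \<Rightarrow> 'c" where "pval A = fst (snd A)"

definition pid :: "'m list \<Rightarrow> ('m, 'c) path_cell"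
  where "pid p = (if p \<noteq> [] \<and> path p then (p, id2 C (rcomp p), p) else pzero)"

definition pv :: "('m, 'c) path_cell \<Rightarrow> ('m, 'c) path_cell \<Rightarrow> ('m, 'c) path_cell"
    (infixr \<open>\<odot>\<close> 65)
  where "B \<odot> A = (if pcell A \<and> pcell B \<and> pdom B = pcod A
    then (pdom A, pval B \<bullet> pval A, pcod B) else pzero)"

text \<open>Since composites are bracketed to the right, prepending a 1-morphism at both ends is
  plain whiskering; no associator enters.\<close>

definition pl :: "'m list \<Rightarrow> ('m, 'c) path_cell \<Rightarrow> ('m, 'c) path_cell"
    (infixr \<open>\<triangleright>\<close> 75)
  where "l \<triangleright> A = (if pcell A \<and> path (l @ pdom A)
    then (l @ pdom A, foldr (\<lambda>f a. f \<rhd> a) l (pval A), l @ pcod A) else pzero)"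

text \<open>Appending \<open>r\<close> changes the bracketing, hence the conjugation by
  \<open>rebr\<close>. The empty list is split off because \<open>rcomp []\<close> is not a
  1-morphism.\<close>

definition pr :: "('m, 'c) path_cell \<Rightarrow> 'm list \<Rightarrow> ('m, 'c) path_cell"
    (infixl \<open>\<triangleleft>\<close> 75)
  where "A \<triangleleft> r = (if pcell A \<and> path (pdom A @ r)
    then (pdom A @ r, if r = [] then pval A
        else rebr (pcod A) r \<bullet> (pval A \<lhd> rcomp r) \<bullet> rebr_inv (pdom A) r, pcod A @ r) else pzero)"

lemma not_pcell_pzero [simp]: "\<not> pcell pzero"
  by (simp add: pcell_def pzero_def)

lemma pcellD:
  assumes "pcell A"
  shows "pdom A \<noteq> []" "pcod A \<noteq> []" "path (pdom A)" "path (pcod A)" "pval A \<in> Cell C"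
    "dom2 C (pval A) = rcomp (pdom A)" "cod2 C (pval A) = rcomp (pcod A)"
    "src C (last (pdom A)) = src C (last (pcod A))" "trg C (hd (pdom A)) = trg C (hd (pcod A))"
proof -
  show *: "pdom A \<noteq> []" "pcod A \<noteq> []" "path (pdom A)" "path (pcod A)" "pval A \<in> Cell C"
    "dom2 C (pval A) = rcomp (pdom A)" "cod2 C (pval A) = rcomp (pcod A)"
    using assms by (auto simp: pcell_def pdom_def pcod_def pval_def Cells_def)
  then show "src C (last (pdom A)) = src C (last (pcod A))" "trg C (hd (pdom A)) = trg C (hd (pcod A))"
    using cell_simps(3,4)[of "pval A"] by (metis rcomp_simps)+
qed

lemma pcell_triple [simp]:
  "pcell (p, a, q) \<longleftrightarrow> p \<noteq> [] \<and> q \<noteq> [] \<and> path p \<and> path q \<and>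
     a \<in> Cell C \<and> dom2 C a = rcomp p \<and> cod2 C a = rcomp q"
  "pdom (p, a, q) = p" "pval (p, a, q) = a" "pcod (p, a, q) = q"
  by (auto simp: pcell_def pdom_def pcod_def pval_def Cells_def)

lemma path_parallel:
  assumes "pcell A"
  shows "path (l @ pcod A) \<longleftrightarrow> path (l @ pdom A)" "path (pcod A @ r) \<longleftrightarrow> path (pdom A @ r)"
  using pcellD[OF assms] by (auto simp: path_append)

lemma foldr_lwhisker:
  assumes "a \<in> Cell C" "dom2 C a = rcomp p" "cod2 C a = rcomp q" "p \<noteq> []" "q \<noteq> []"
    "path (l @ p)" "path q" "trg C (hd p) = trg C (hd q)"
  shows "foldr (\<lambda>f a. f \<rhd> a) l a \<in> Cell C \<and> dom2 C (foldr (\<lambda>f a. f \<rhd> a) l a) = rcomp (l @ p)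
    \<and> cod2 C (foldr (\<lambda>f a. f \<rhd> a) l a) = rcomp (l @ q)"
  using assms
proof (induction l)
  case (Cons f l)
  have "f \<in> Mor C" "path (l @ p)" "src C f = trg C (hd (l @ p))"
    using Cons.prems(4,6) path_append[of "[f]" "l @ p"] by auto
  then show ?case
    using Cons by (simp add: rcomp_Cons)
qed simp

lemma pv_type:
  assumes "pcell A" "pcell B" "pdom B = pcod A"
  shows "pcell (B \<odot> A)" "pdom (B \<odot> A) = pdom A" "pcod (B \<odot> A) = pcod B"
    "pval (B \<odot> A) = pval B \<bullet> pval A"
  using assms pcellD[OF assms(1)] pcellD[OF assms(2)] by (simp_all add: pv_def)

lemma pl_type:
  assumes "pcell A" "path (l @ pdom A)"
  shows "pcell (l \<triangleright> A)" "pdom (l \<triangleright> A) = l @ pdom A" "pcod (l \<triangleright> A) = l @ pcod A"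
    "pval (l \<triangleright> A) = foldr (\<lambda>f a. f \<rhd> a) l (pval A)"
  using assms pcellD[OF assms(1)] path_parallel[OF assms(1)]
    foldr_lwhisker[of "pval A" "pdom A" "pcod A" l]
  by (simp_all add: pl_def)

lemma pr_type:
  assumes "pcell A" "path (pdom A @ r)"
  shows "pcell (A \<triangleleft> r)" "pdom (A \<triangleleft> r) = pdom A @ r" "pcod (A \<triangleleft> r) = pcod A @ r"
    "r \<noteq> [] \<Longrightarrow> pval (A \<triangleleft> r) = rebr (pcod A) r \<bullet> (pval A \<lhd> rcomp r) \<bullet> rebr_inv (pdom A) r"
    "r = [] \<Longrightarrow> pval (A \<triangleleft> r) = pval A"
proof -
  have *: "rebr (pcod A) r \<bullet> (pval A \<lhd> rcomp r) \<bullet> rebr_inv (pdom A) r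
      \<in> Cells C (rcomp (pdom A @ r)) (rcomp (pcod A @ r))" if "r \<noteq> []"
  proof -
    have "path r" "src C (last (pdom A)) = trg C (hd r)" "path (pcod A @ r)"
      using assms that pcellD(1)[OF assms(1)] path_appendD[of "pdom A" r]
        path_append_joint[of "pdom A" r] path_parallel(2)[of A] by auto
    then show ?thesis
      using that assms pcellD[OF assms(1)] by (simp add: Cells_def)
  qed
  show "pcell (A \<triangleleft> r)" "pdom (A \<triangleleft> r) = pdom A @ r" "pcod (A \<triangleleft> r) = pcod A @ r"
    "r \<noteq> [] \<Longrightarrow> pval (A \<triangleleft> r) = rebr (pcod A) r \<bullet> (pval A \<lhd> rcomp r) \<bullet> rebr_inv (pdom A) r"
    "r = [] \<Longrightarrow> pval (A \<triangleleft> r) = pval A"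
    using assms pcellD[OF assms(1)] path_parallel[OF assms(1)] * by (auto simp: pr_def Cells_def)
qed

lemma pcell_pv [simp]: "pcell (B \<odot> A) \<longleftrightarrow> pcell A \<and> pcell B \<and> pdom B = pcod A"
  using pv_type(1)[of A B] by (auto simp: pv_def)

lemma pcell_pl [simp]: "pcell (l \<triangleright> A) \<longleftrightarrow> pcell A \<and> path (l @ pdom A)"
  using pl_type(1)[of A l] by (auto simp: pl_def)

lemma pcell_pr [simp]: "pcell (A \<triangleleft> r) \<longleftrightarrow> pcell A \<and> path (pdom A @ r)"
  using pr_type(1)[of A r] by (auto simp: pr_def)

lemma pid_type:
  assumes "p \<noteq> []" "path p"
  shows "pcell (pid p)" "pdom (pid p) = p" "pcod (pid p) = p" "pval (pid p) = id2 C (rcomp p)"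
  using assms by (auto simp: pid_def)

lemma pcell_pid [simp]: "pcell (pid p) \<longleftrightarrow> p \<noteq> [] \<and> path p"
  by (auto simp: pid_def)

lemma path_cell_eqI:
  "\<lbrakk>pdom A = pdom B; pcod A = pcod B; pval A = pval B\<rbrakk> \<Longrightarrow> A = B"
  by (auto simp: pdom_def pcod_def pval_def prod_eq_iff)

lemma pzeroI:
  "\<not> pcell (B \<odot> A) \<Longrightarrow> B \<odot> A = pzero" "\<not> pcell (l \<triangleright> A) \<Longrightarrow> l \<triangleright> A = pzero"
  "\<not> pcell (A \<triangleleft> r) \<Longrightarrow> A \<triangleleft> r = pzero" "\<not> pcell (pid p) \<Longrightarrow> pid p = pzero"
  by (simp_all only: pcell_pv pcell_pl pcell_pr pcell_pid)
     (auto simp: pv_def pl_def pr_def pid_def)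

lemma pv_assoc: "(D \<odot> B) \<odot> A = D \<odot> (B \<odot> A)"
proof (cases "pcell A \<and> pcell B \<and> pcell D \<and> pdom B = pcod A \<and> pdom D = pcod B")
  case True
  then show ?thesis
    using pcellD[of A] pcellD[of B] pcellD[of D]
    by (intro path_cell_eqI) (simp_all add: pv_type)
next
  case False
  then show ?thesis
    using pzeroI(1)[of "D \<odot> B" A] pzeroI(1)[of D "B \<odot> A"] pv_type by (auto simp: pcell_pv)
qed

lemma pv_id_left: "\<lbrakk>pcell A; pcod A = p\<rbrakk> \<Longrightarrow> pid p \<odot> A = A"
  using pcellD[of A] by (intro path_cell_eqI) (simp_all add: pv_type pid_type)

lemma pv_id_right: "\<lbrakk>pcell A; pdom A = p\<rbrakk> \<Longrightarrow> A \<odot> pid p = A"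
  using pcellD[of A] by (intro path_cell_eqI) (simp_all add: pv_type pid_type)

lemma foldr_lwhisker_vcomp:
  assumes "a \<in> Cell C" "b \<in> Cell C" "dom2 C a = rcomp p" "cod2 C a = rcomp q" "dom2 C b = rcomp q" "cod2 C b = rcomp r"
    "p \<noteq> []" "q \<noteq> []" "r \<noteq> []" "path (l @ p)" "path q" "path r"
    "trg C (hd p) = trg C (hd q)" "trg C (hd q) = trg C (hd r)"
  shows "foldr (\<lambda>f a. f \<rhd> a) l (b \<bullet> a) = foldr (\<lambda>f a. f \<rhd> a) l b \<bullet> foldr (\<lambda>f a. f \<rhd> a) l a"
  using assms
proof (induction l)
  case (Cons f l)
  have 1: "f \<in> Mor C" "path (l @ p)" "src C f = trg C (hd (l @ p))"
    using Cons.prems(7,10) path_append[of "[f]" "l @ p"] by auto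
  have 2: "path (l @ q)" "trg C (hd (l @ p)) = trg C (hd (l @ q))" "path (l @ r)"
    using 1 Cons.prems by (auto simp: path_append hd_append)
  have "foldr (\<lambda>f a. f \<rhd> a) l (b \<bullet> a) = foldr (\<lambda>f a. f \<rhd> a) l b \<bullet> foldr (\<lambda>f a. f \<rhd> a) l a"
    using Cons.IH Cons.prems 1 by blast
  then show ?case
    using 1 2 Cons.prems foldr_lwhisker[of a p q l] foldr_lwhisker[of b q r l]
    by (simp add: lwhisker_vcomp)
qed simp

lemma pl_pv: "l \<triangleright> (B \<odot> A) = (l \<triangleright> B) \<odot> (l \<triangleright> A)"
proof (cases "pcell A \<and> pcell B \<and> pdom B = pcod A \<and> path (l @ pdom A)")
  case True
  then show ?thesis
    using pcellD[of A] pcellD[of B] path_parallel[of A l] path_parallel[of B l]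
    by (intro path_cell_eqI)
       (simp_all add: pv_type pl_type foldr_lwhisker_vcomp[where p = "pdom A" and q = "pcod A" and r = "pcod B"])
next
  case False
  then have "\<not> pcell (l \<triangleright> (B \<odot> A))" "\<not> pcell ((l \<triangleright> B) \<odot> (l \<triangleright> A))"
    by (auto simp: pv_type pl_type)
  then show ?thesis
    using pzeroI by metis
qed

lemma pl_pid: "p \<noteq> [] \<Longrightarrow> l \<triangleright> pid p = pid (l @ p)"
proof (cases "path (l @ p)")
  case True
  assume p: "p \<noteq> []"
  have "foldr (\<lambda>f a. f \<rhd> a) l (id2 C (rcomp p)) = id2 C (rcomp (l @ p))"
    using True
  proof (induction l)
    case (Cons f l)
    then have "f \<in> Mor C" "path (l @ p)" "src C f = trg C (hd (l @ p))"
      using p path_append[of "[f]" "l @ p"] by auto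
    then show ?case
      using Cons p by (simp add: rcomp_Cons)
  qed simp
  then show ?thesis
    using True p path_appendD[of l p] by (intro path_cell_eqI) (simp_all add: pl_type pid_type)
next
  case False
  assume p: "p \<noteq> []"
  then have "\<not> pcell (l \<triangleright> pid p)" "\<not> pcell (pid (l @ p))"
    using False path_appendD[of l p] by (auto simp: pid_type)
  then show ?thesis
    using pzeroI by metis
qed

lemma pl_pl: "l \<triangleright> (k \<triangleright> A) = (l @ k) \<triangleright> A"
proof (cases "pcell A \<and> path (l @ k @ pdom A)")
  case True
  then show ?thesis
    using path_appendD[of l "k @ pdom A"] by (intro path_cell_eqI) (simp_all add: pl_type)
next
  case False
  then have "\<not> pcell (l \<triangleright> (k \<triangleright> A))" "\<not> pcell ((l @ k) \<triangleright> A)"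
    by (auto simp: pl_type)
  then show ?thesis
    using pzeroI by metis
qed

text \<open>The rebracketing at the end of \<open>A \<triangleleft> r\<close> cancels against the
  inverse one at the start of \<open>B \<triangleleft> r\<close>.\<close>

lemma pr_pv: "(B \<odot> A) \<triangleleft> r = (B \<triangleleft> r) \<odot> (A \<triangleleft> r)"
proof (cases "pcell A \<and> pcell B \<and> pdom B = pcod A \<and> path (pdom A @ r)")
  case True
  note T = True pcellD[of A] pcellD[of B] path_parallel(2)[of A r] path_parallel(2)[of B r]
    path_appendD[of "pdom A" r] path_append_joint[of "pdom A" r]
  have "rebr_inv (pcod A) r \<bullet> rebr (pcod A) r \<bullet> (pval A \<lhd> rcomp r) \<bullet> rebr_inv (pdom A) r
     = (pval A \<lhd> rcomp r) \<bullet> rebr_inv (pdom A) r" if "r \<noteq> []"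
    using T that by (intro vcomp_cancel) simp_all
  then show ?thesis
    using T by (intro path_cell_eqI) (cases "r = []"; simp_all add: pv_type pr_type rwhisker_vcomp)+
next
  case False
  then have "\<not> pcell ((B \<odot> A) \<triangleleft> r)" "\<not> pcell ((B \<triangleleft> r) \<odot> (A \<triangleleft> r))"
    by (auto simp: pv_type pr_type)
  then show ?thesis
    using pzeroI by metis
qed

lemma pr_pid: "p \<noteq> [] \<Longrightarrow> pid p \<triangleleft> r = pid (p @ r)"
proof (cases "path (p @ r)")
  case True
  assume p: "p \<noteq> []"
  note T = True p path_appendD[of p r] path_append_joint[of p r]
  show ?thesis
    using T by (intro path_cell_eqI) (cases "r = []"; simp_all add: pr_type pid_type)+
next
  case False
  assume p: "p \<noteq> []"
  then have "\<not> pcell (pid p \<triangleleft> r)" "\<not> pcell (pid (p @ r))"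
    using False path_appendD[of p r] by (auto simp: pid_type)
  then show ?thesis
    using pzeroI by metis
qed

lemma pl_Nil: "pcell A \<Longrightarrow> [] \<triangleright> A = A"
  using pcellD[of A] by (intro path_cell_eqI) (simp_all add: pl_type)

lemma pr_Nil: "pcell A \<Longrightarrow> A \<triangleleft> [] = A"
  using pcellD[of A] by (intro path_cell_eqI) (simp_all add: pr_type)

text \<open>For nonempty \<open>p\<close>, \<open>rebr (f # p) r\<close> is one associator followed
  by \<open>f \<rhd> rebr p r\<close>. Naturality of the associator in its middle argument brings it
  next to its inverse, and the rest is whiskered by \<open>f\<close>.\<close>

lemma pl_pr_single: "([f] \<triangleright> A) \<triangleleft> r = [f] \<triangleright> (A \<triangleleft> r)"
proof (cases "pcell A \<and> path (f # pdom A @ r)")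
  case True
  have T: "pcell A" "path (f # pdom A @ r)" "path (pdom A)" "path r" "path (pdom A @ r)"
    "pdom A \<noteq> []" "pcod A \<noteq> []" "path (pcod A)"
    "pval A \<in> Cell C" "dom2 C (pval A) = rcomp (pdom A)" "cod2 C (pval A) = rcomp (pcod A)"
    "src C (last (pcod A)) = src C (last (pdom A))" "trg C (hd (pcod A)) = trg C (hd (pdom A))"
    "path (pcod A @ r)" "f \<in> Mor C" "src C f = trg C (hd (pdom A))" "path (f # pdom A)" "path (f # pcod A)"
    using True pcellD[of A] path_appendD[of "pdom A" r] path_Cons[of "pdom A @ r" f]
      path_parallel(2)[of A r] path_Cons[of "pcod A" f] path_Cons[of "pdom A" f] by auto
  show ?thesis
  proof (cases "r = []")
    case True
    then show ?thesis
      using T by (simp add: pr_Nil)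
  next
    case False
    have r: "src C (last (pdom A)) = trg C (hd r)"
      using path_append_joint T False by blast
    define P where "P = rcomp (pdom A)"
    define Q where "Q = rcomp (pcod A)"
    define R where "R = rcomp r"
    define a where "a = pval A"
    define i where "i = rebr_inv (pdom A) r"
    define j where "j = rebr (pcod A) r"
    have S: "P \<in> Mor C" "Q \<in> Mor C" "R \<in> Mor C" "a \<in> Cell C" "dom2 C a = P" "cod2 C a = Q"
      "i \<in> Cell C" "cod2 C i = P \<cdot> R" "j \<in> Cell C" "dom2 C j = Q \<cdot> R" "trg C R = src C P"
      "src C Q = src C P" "trg C P = src C f" "trg C Q = src C f" "f \<in> Mor C"
      "trg C (dom2 C i) = src C f"
      using T r False unfolding P_def Q_def R_def a_def i_def j_def by simp_all
    have "assoc C f Q R \<bullet> ((f \<rhd> a) \<lhd> R) \<bullet> inv2 C (assoc C f P R) \<bullet> (f \<rhd> i)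
       = (assoc C f Q R \<bullet> ((f \<rhd> a) \<lhd> R)) \<bullet> inv2 C (assoc C f P R) \<bullet> (f \<rhd> i)"
      using S by simp
    also have "\<dots> = ((f \<rhd> (a \<lhd> R)) \<bullet> assoc C f P R) \<bullet> inv2 C (assoc C f P R) \<bullet> (f \<rhd> i)"
      using assoc_nat_mid[of R a f] S by simp
    also have "\<dots> = (f \<rhd> (a \<lhd> R)) \<bullet> (assoc C f P R \<bullet> inv2 C (assoc C f P R)) \<bullet> (f \<rhd> i)"
      using S by (simp del: assoc_simps(7,8))
    also have "\<dots> = (f \<rhd> (a \<lhd> R)) \<bullet> (f \<rhd> i)"
      using S by simp
    finally have "((f \<rhd> j) \<bullet> assoc C f Q R) \<bullet> ((f \<rhd> a) \<lhd> R) \<bullet> inv2 C (assoc C f P R) \<bullet> (f \<rhd> i)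
       = f \<rhd> (j \<bullet> (a \<lhd> R) \<bullet> i)"
      using S by (simp add: lwhisker_vcomp)
    then show ?thesis
      using T False
      by (intro path_cell_eqI)
        (simp_all add: pl_type pr_type rebr_Cons rebr_inv_Cons
         P_def[symmetric] Q_def[symmetric] R_def[symmetric] a_def[symmetric] i_def[symmetric] j_def[symmetric])
  qed
next
  case False
  then have "\<not> pcell (([f] \<triangleright> A) \<triangleleft> r)" "\<not> pcell ([f] \<triangleright> (A \<triangleleft> r))"
    by (auto simp: pr_type pl_type)
  then show ?thesis
    using pzeroI by metis
qed

lemma pl_pr: "(l \<triangleright> A) \<triangleleft> r = l \<triangleright> (A \<triangleleft> r)"
proof (induction l)
  case Nil
  show ?case
  proof (cases "pcell (A \<triangleleft> r)")
    case True
    then have "pcell A"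
      by simp
    then show ?thesis
      using pl_Nil[of A] pl_Nil[OF True] by simp
  next
    case False
    then have "\<not> pcell (([] \<triangleright> A) \<triangleleft> r)" "\<not> pcell ([] \<triangleright> (A \<triangleleft> r))"
      by (auto simp: pl_type)
    then show ?thesis
      using pzeroI by metis
  qed
next
  case (Cons f l)
  have "((f # l) \<triangleright> A) \<triangleleft> r = ([f] \<triangleright> (l \<triangleright> A)) \<triangleleft> r"
    by (simp add: pl_pl)
  also have "\<dots> = [f] \<triangleright> (l \<triangleright> (A \<triangleleft> r))"
    unfolding pl_pr_single Cons ..
  finally show ?case
    by (simp add: pl_pl)
qed

text \<open>\<open>rebr_assoc\<close> at the source and at the target of \<open>A\<close> reduces
  the claim to naturality of the associator in its left argument and one exchange of
  \<open>pval A\<close> with \<open>rebr r s\<close>.\<close>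

lemma pr_pr: "(A \<triangleleft> r) \<triangleleft> s = A \<triangleleft> (r @ s)"
proof (cases "pcell A \<and> path (pdom A @ r @ s) \<and> r \<noteq> [] \<and> s \<noteq> []")
  case True
  define p where "p = pdom A"
  define q where "q = pcod A"
  define a where "a = pval A"
  have T: "pcell A" "r \<noteq> []" "s \<noteq> []" "path (p @ r @ s)" "path p" "path r" "path s" "path (p @ r)"
    "path (r @ s)"
    "path (q @ r @ s)" "path (q @ r)" "p \<noteq> []" "q \<noteq> []" "path q"
    "a \<in> Cell C" "dom2 C a = rcomp p" "cod2 C a = rcomp q" "src C (last q) = trg C (hd r)"
    "src C (last p) = trg C (hd r)" "src C (last r) = trg C (hd s)"
    using True pcellD[of A] path_appendD[of "pdom A" "r @ s"] path_appendD[of r s]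
      path_appendD[of "pdom A @ r" s]
      path_parallel(2)[of A r] path_parallel(2)[of A "r @ s"] path_append_joint[of "pdom A" "r @ s"]
      path_append_joint[of r s]
    by (auto simp: p_def q_def a_def)
  define P where "P = rcomp p"
  define Q where "Q = rcomp q"
  define R where "R = rcomp r"
  define S where "S = rcomp s"
  define RS where "RS = rcomp (r @ s)"
  define f where "f = rebr p r"
  define f' where "f' = rebr_inv p r"
  define g where "g = rebr (p @ r) s"
  define g' where "g' = rebr_inv (p @ r) s"
  define h where "h = rebr q r"
  define k where "k = rebr (q @ r) s"
  define m where "m = rebr q (r @ s)"
  define e where "e = rebr p (r @ s)"
  define e' where "e' = rebr_inv p (r @ s)"
  define d where "d = rebr r s"
  define PR where "PR = rcomp (p @ r)"
  define QR where "QR = rcomp (q @ r)"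
  define PRS where "PRS = rcomp (p @ r @ s)"
  define QRS where "QRS = rcomp (q @ r @ s)"
  note D = P_def Q_def R_def S_def RS_def f_def f'_def g_def g'_def h_def k_def m_def e_def e'_def d_def
    PR_def QR_def PRS_def QRS_def
  have M: "P \<in> Mor C" "Q \<in> Mor C" "R \<in> Mor C" "S \<in> Mor C" "RS \<in> Mor C" "PR \<in> Mor C" "QR \<in> Mor C"
    "PRS \<in> Mor C" "QRS \<in> Mor C"
    "src C P = trg C R" "src C Q = trg C R" "src C R = trg C S" "src C PR = trg C S" "src C QR = trg C S"
    "trg C RS = trg C R"
    using T unfolding D by simp_all
  have N: "a \<in> Cell C" "dom2 C a = P" "cod2 C a = Q"
    "f \<in> Cell C" "dom2 C f = P \<cdot> R" "cod2 C f = PR" "f' \<in> Cell C" "dom2 C f' = PR" "cod2 C f' = P \<cdot> R"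
    "g \<in> Cell C" "dom2 C g = PR \<cdot> S" "cod2 C g = PRS" "g' \<in> Cell C" "dom2 C g' = PRS" "cod2 C g' = PR \<cdot> S"
    "h \<in> Cell C" "dom2 C h = Q \<cdot> R" "cod2 C h = QR"
    "k \<in> Cell C" "dom2 C k = QR \<cdot> S" "cod2 C k = QRS"
    "m \<in> Cell C" "dom2 C m = Q \<cdot> RS" "cod2 C m = QRS"
    "e \<in> Cell C" "dom2 C e = P \<cdot> RS" "cod2 C e = PRS" "e' \<in> Cell C" "dom2 C e' = PRS" "cod2 C e' = P \<cdot> RS"
    "d \<in> Cell C" "dom2 C d = R \<cdot> S" "cod2 C d = RS"
    using T unfolding D by simp_all
  have E: "f' \<bullet> f = id2 C (P \<cdot> R)" "f \<bullet> f' = id2 C PR" "g' \<bullet> g = id2 C (PR \<cdot> S)" "g \<bullet> g' = id2 C PRS"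
    "e' \<bullet> e = id2 C (P \<cdot> RS)"
    using T unfolding D by simp_all
  have A1: "g \<bullet> (f \<lhd> S) = e \<bullet> (P \<rhd> d) \<bullet> assoc C P R S"
    and A2: "k \<bullet> (h \<lhd> S) = m \<bullet> (Q \<rhd> d) \<bullet> assoc C Q R S"
    using rebr_assoc[of p r s] rebr_assoc[of q r s] T unfolding D by simp_all
  have F: "(f' \<lhd> S) \<bullet> (f \<lhd> S) = id2 C ((P \<cdot> R) \<cdot> S)" "(f \<lhd> S) \<bullet> (f' \<lhd> S) = id2 C (PR \<cdot> S)"
    using rwhisker_vcomp[of S f f'] rwhisker_vcomp[of S f' f] N M E by simp_all
  define L where "L = k \<bullet> ((h \<bullet> (a \<lhd> R) \<bullet> f') \<lhd> S) \<bullet> g'"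
  define R' where "R' = m \<bullet> (a \<lhd> RS) \<bullet> e'"
  \<comment> \<open>The two sides \<open>L\<close> and \<open>R'\<close> are compared after
    precomposition with the invertible \<open>g \<bullet> (f \<lhd> S)\<close>, the left-hand side
    of \<open>rebr_assoc\<close> for \<open>p\<close>; this cancels \<open>f'\<close> and
    \<open>g'\<close> in \<open>L\<close>.\<close>
  have "L \<bullet> (g \<bullet> (f \<lhd> S)) = k \<bullet> (h \<lhd> S) \<bullet> ((a \<lhd> R) \<lhd> S) \<bullet> (f' \<lhd> S) \<bullet> g' \<bullet> g \<bullet> (f \<lhd> S)"
    using N M by (simp add: L_def rwhisker_vcomp)
  also have "g' \<bullet> g \<bullet> (f \<lhd> S) = f \<lhd> S"
    using N M E by (intro vcomp_cancel) simp_all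
  also have "k \<bullet> (h \<lhd> S) \<bullet> ((a \<lhd> R) \<lhd> S) \<bullet> (f' \<lhd> S) \<bullet> (f \<lhd> S) = (k \<bullet> (h \<lhd> S)) \<bullet> ((a \<lhd> R) \<lhd> S)"
    unfolding F using N M by simp
  also have "\<dots> = m \<bullet> (Q \<rhd> d) \<bullet> (assoc C Q R S \<bullet> ((a \<lhd> R) \<lhd> S))"
    unfolding A2 using N M by simp
  also have "assoc C Q R S \<bullet> ((a \<lhd> R) \<lhd> S) = (a \<lhd> (R \<cdot> S)) \<bullet> assoc C P R S"
    using assoc_nat_left[of S R a] N M by simp
  also have "m \<bullet> (Q \<rhd> d) \<bullet> (a \<lhd> (R \<cdot> S)) \<bullet> assoc C P R S
     = m \<bullet> ((Q \<rhd> d) \<bullet> (a \<lhd> (R \<cdot> S))) \<bullet> assoc C P R S"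
    using N M by simp
  also have "(Q \<rhd> d) \<bullet> (a \<lhd> (R \<cdot> S)) = (a \<lhd> RS) \<bullet> (P \<rhd> d)"
    using whisker_exchange[of d a] N M by simp
  also have "m \<bullet> ((a \<lhd> RS) \<bullet> (P \<rhd> d)) \<bullet> assoc C P R S = m \<bullet> (a \<lhd> RS) \<bullet> ((P \<rhd> d) \<bullet> assoc C P R S)"
    using N M by simp
  also have "(P \<rhd> d) \<bullet> assoc C P R S = e' \<bullet> e \<bullet> (P \<rhd> d) \<bullet> assoc C P R S"
    using N M E by (intro vcomp_cancel[symmetric]) simp_all
  also have "m \<bullet> (a \<lhd> RS) \<bullet> e' \<bullet> e \<bullet> (P \<rhd> d) \<bullet> assoc C P R S = R' \<bullet> (g \<bullet> (f \<lhd> S))"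
    unfolding A1 R'_def using N M by simp
  finally have 1: "L \<bullet> (g \<bullet> (f \<lhd> S)) = R' \<bullet> (g \<bullet> (f \<lhd> S))" .
  have 2: "(g \<bullet> (f \<lhd> S)) \<bullet> ((f' \<lhd> S) \<bullet> g') = id2 C PRS"
  proof -
    have "(f \<lhd> S) \<bullet> (f' \<lhd> S) \<bullet> g' = g'"
      using N M F by (intro vcomp_cancel) simp_all
    then show ?thesis
      using N M E by simp
  qed
  have LR: "L \<in> Cell C" "dom2 C L = PRS" "R' \<in> Cell C" "dom2 C R' = PRS"
    using N M by (simp_all add: L_def R'_def)
  have "L = L \<bullet> ((g \<bullet> (f \<lhd> S)) \<bullet> ((f' \<lhd> S) \<bullet> g'))"
    unfolding 2 using LR by simp
  also have "\<dots> = (L \<bullet> (g \<bullet> (f \<lhd> S))) \<bullet> ((f' \<lhd> S) \<bullet> g')"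
    using LR N M by simp
  also have "\<dots> = R' \<bullet> ((g \<bullet> (f \<lhd> S)) \<bullet> ((f' \<lhd> S) \<bullet> g'))"
    unfolding 1 using LR N M by simp
  also have "\<dots> = R'"
    unfolding 2 using LR by simp
  finally have LR': "L = R'" .
  show ?thesis
    using T LR'[unfolded L_def R'_def D, unfolded a_def]
    by (intro path_cell_eqI) (simp_all add: pr_type p_def q_def)
next
  case False
  show ?thesis
  proof (cases "pcell A \<and> path (pdom A @ r @ s)")
    case True
    note T = this path_appendD[of "pdom A" "r @ s"] path_appendD[of "pdom A @ r" s]
    consider "r = []" | "s = []" using False True by blast
    then show ?thesis
      by cases (use T in \<open>simp_all add: pr_Nil\<close>)
  next
    case False
    then have "\<not> pcell ((A \<triangleleft> r) \<triangleleft> s)" "\<not> pcell (A \<triangleleft> (r @ s))"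
      by (auto simp: pr_type)
    then show ?thesis
      using pzeroI by metis
  qed
qed

text \<open>Naturality of \<open>rebr\<close> in its second argument, by induction from naturality
  of the associator. It relates iterated left whiskering to whiskering by a single composite, which
  is what the exchange law needs.\<close>

lemma foldr_lwhisker_rebr:
  assumes "b \<in> Cell C" "dom2 C b = rcomp q" "cod2 C b = rcomp q'" "path (p @ q)" "path q'" "p \<noteq> []" "q \<noteq> []"
    "q' \<noteq> []" "trg C (hd q) = trg C (hd q')"
  shows "foldr (\<lambda>f a. f \<rhd> a) p b \<bullet> rebr p q = rebr p q' \<bullet> (rcomp p \<rhd> b)"
  using assms
proof (induction p)
  case (Cons f p)
  have q: "path q" "path q'"
    using Cons.prems path_appendD[of "f # p" q] by auto
  show ?case
  proof (cases "p = []")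
    case True
    then show ?thesis
      using Cons.prems q by (simp add: path_Cons)
  next
    case False
    have fp: "f \<in> Mor C" "path (p @ q)" "src C f = trg C (hd p)"
      using Cons.prems False path_Cons[of "p @ q" f] by auto
    have p: "path p" "src C (last p) = trg C (hd q)" "path (p @ q')"
      using fp Cons.prems False path_append_joint[of p q] path_appendD[of p q]
      by (auto simp: path_append[of p q'])
    define P where "P = rcomp p"
    define Q where "Q = rcomp q"
    define Q' where "Q' = rcomp q'"
    define c where "c = rebr p q"
    define c' where "c' = rebr p q'"
    define F where "F = foldr (\<lambda>f a. f \<rhd> a) p b"
    note D = P_def Q_def Q'_def c_def c'_def
    have T: "P \<in> Mor C" "Q \<in> Mor C" "Q' \<in> Mor C" "src C P = trg C Q" "src C P = trg C Q'"
      "trg C P = src C f" "c \<in> Cell C" "dom2 C c = P \<cdot> Q" "c' \<in> Cell C" "dom2 C c' = P \<cdot> Q'"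
      "b \<in> Cell C" "dom2 C b = Q" "cod2 C b = Q'"
      "trg C (rcomp (p @ q)) = src C f" "trg C (rcomp (p @ q')) = src C f"
      using Cons.prems q fp p False unfolding D by simp_all
    have c: "cod2 C c = rcomp (p @ q)" "cod2 C c' = rcomp (p @ q')"
      using Cons.prems q fp p False unfolding D by simp_all
    have F: "F \<in> Cell C" "dom2 C F = rcomp (p @ q)" "cod2 C F = rcomp (p @ q')"
      using foldr_lwhisker[of b q q' p] Cons.prems p fp False q unfolding F_def by auto
    have IH: "F \<bullet> c = c' \<bullet> (P \<rhd> b)"
      using Cons.IH Cons.prems fp False unfolding D F_def by simp
    have "(f \<rhd> F) \<bullet> ((f \<rhd> c) \<bullet> assoc C f P Q) = (f \<rhd> (F \<bullet> c)) \<bullet> assoc C f P Q"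
      using T F c fp by (simp add: lwhisker_vcomp)
    also have "\<dots> = (f \<rhd> c') \<bullet> ((f \<rhd> (P \<rhd> b)) \<bullet> assoc C f P Q)"
      unfolding IH using T c fp by (simp add: lwhisker_vcomp)
    also have "(f \<rhd> (P \<rhd> b)) \<bullet> assoc C f P Q = assoc C f P Q' \<bullet> ((f \<cdot> P) \<rhd> b)"
      using assoc_nat_right[of b P f] T fp by simp
    finally show ?thesis
      using False Cons.prems T c fp
      by (simp add: rebr_Cons rcomp_Cons D[symmetric] F_def[symmetric])
  qed
qed simp

text \<open>After rebracketing, this is \<open>whisker_exchange\<close> for the composites of the
  four lists.\<close>

lemma exchange:
  assumes "pcell A" "pcell B" "path (pdom A @ pdom B)"
  shows "(pcod A \<triangleright> B) \<odot> (A \<triangleleft> pdom B) = (A \<triangleleft> pcod B) \<odot> (pdom A \<triangleright> B)"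
proof -
  define p where "p = pdom A"
  define p' where "p' = pcod A"
  define q where "q = pdom B"
  define q' where "q' = pcod B"
  define a where "a = pval A"
  define b where "b = pval B"
  have T: "p \<noteq> []" "p' \<noteq> []" "q \<noteq> []" "q' \<noteq> []" "path p" "path p'" "path q" "path q'"
    "path (p @ q)" "path (p @ q')" "path (p' @ q)" "path (p' @ q')"
    "a \<in> Cell C" "dom2 C a = rcomp p" "cod2 C a = rcomp p'" "b \<in> Cell C" "dom2 C b = rcomp q" "cod2 C b = rcomp q'"
    "trg C (hd q) = trg C (hd q')" "src C (last p) = trg C (hd q)" "src C (last p') = trg C (hd q)"
    "src C (last p') = trg C (hd q')" "src C (last p) = trg C (hd q')"
    using assms pcellD[of A] pcellD[of B] path_parallel[of A] path_parallel[of B]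
      path_append_joint[of "pdom A" "pdom B"]
    by (auto simp: p_def p'_def q_def q'_def a_def b_def)
  define F where "F = foldr (\<lambda>f a. f \<rhd> a) p b"
  define F' where "F' = foldr (\<lambda>f a. f \<rhd> a) p' b"
  have F: "F \<in> Cell C" "dom2 C F = rcomp (p @ q)" "cod2 C F = rcomp (p @ q')" "F' \<in> Cell C" "dom2 C F' = rcomp (p' @ q)"
    "cod2 C F' = rcomp (p' @ q')"
    using foldr_lwhisker[of b q q'] T unfolding F_def F'_def by auto
  have e: "F \<bullet> rebr p q = rebr p q' \<bullet> (rcomp p \<rhd> b)" "F' \<bullet> rebr p' q = rebr p' q' \<bullet> (rcomp p' \<rhd> b)"
    unfolding F_def F'_def using T by (simp_all add: foldr_lwhisker_rebr)
  have "F' \<bullet> rebr p' q \<bullet> (a \<lhd> rcomp q) \<bullet> rebr_inv p q = (F' \<bullet> rebr p' q) \<bullet> (a \<lhd> rcomp q) \<bullet> rebr_inv p q"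
    using T F by simp
  also have "\<dots> = rebr p' q' \<bullet> ((rcomp p' \<rhd> b) \<bullet> (a \<lhd> rcomp q)) \<bullet> rebr_inv p q"
    unfolding e using T by simp
  also have "(rcomp p' \<rhd> b) \<bullet> (a \<lhd> rcomp q) = (a \<lhd> rcomp q') \<bullet> (rcomp p \<rhd> b)"
    using whisker_exchange[of b a] T by simp
  also have "rebr p' q' \<bullet> ((a \<lhd> rcomp q') \<bullet> (rcomp p \<rhd> b)) \<bullet> rebr_inv p q
    = rebr p' q' \<bullet> (a \<lhd> rcomp q') \<bullet> (rcomp p \<rhd> b) \<bullet> rebr_inv p q"
    using T by simp
  also have "(rcomp p \<rhd> b) \<bullet> rebr_inv p q = rebr_inv p q' \<bullet> rebr p q' \<bullet> (rcomp p \<rhd> b) \<bullet> rebr_inv p q"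
    using T by (intro vcomp_cancel[symmetric]) simp_all
  also have "rebr p q' \<bullet> (rcomp p \<rhd> b) \<bullet> rebr_inv p q = (rebr p q' \<bullet> (rcomp p \<rhd> b)) \<bullet> rebr_inv p q"
    using T by simp
  also have "\<dots> = F \<bullet> (rebr p q \<bullet> rebr_inv p q)"
    unfolding e[symmetric] using T F by (simp del: rebr_simps(8))
  also have "\<dots> = F"
    using T F by simp
  finally have "F' \<bullet> rebr p' q \<bullet> (a \<lhd> rcomp q) \<bullet> rebr_inv p q = rebr p' q' \<bullet> (a \<lhd> rcomp q') \<bullet> rebr_inv p q' \<bullet> F" .
  then have "F' \<bullet> rebr p' q \<bullet> (a \<lhd> rcomp q) \<bullet> rebr_inv p q = (rebr p' q' \<bullet> (a \<lhd> rcomp q') \<bullet> rebr_inv p q') \<bullet> F"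
    using T F by simp
  then show ?thesis
    using T assms
    by (intro path_cell_eqI) (simp_all add: pv_type pl_type pr_type F_def F'_def
        p_def[symmetric] p'_def[symmetric] q_def[symmetric] q'_def[symmetric] a_def[symmetric] b_def[symmetric])
qed

section \<open>Typed cells, inverse pairs and conjugation\<close>

definition parr :: "('m, 'c) path_cell \<Rightarrow> 'm list \<Rightarrow> 'm list \<Rightarrow> bool"
  where "parr A p q \<longleftrightarrow> pcell A \<and> pdom A = p \<and> pcod A = q"

lemma parr_pv: "\<lbrakk>parr A p q; parr B q r\<rbrakk> \<Longrightarrow> parr (B \<odot> A) p r"
  by (auto simp: parr_def pv_type)

lemma parr_pl: "\<lbrakk>parr A p q; path (l @ p)\<rbrakk> \<Longrightarrow> parr (l \<triangleright> A) (l @ p) (l @ q)"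
  by (auto simp: parr_def pl_type)

lemma parr_pr: "\<lbrakk>parr A p q; path (p @ r)\<rbrakk> \<Longrightarrow> parr (A \<triangleleft> r) (p @ r) (q @ r)"
  by (auto simp: parr_def pr_type)

lemma parrD:
  assumes "parr A p q"
  shows "path p" "path q" "p \<noteq> []" "q \<noteq> []" "path (l @ p) \<longleftrightarrow> path (l @ q)" "path (p @ r) \<longleftrightarrow> path (q @ r)"
    "pcell A" "pdom A = p" "pcod A = q"
  using assms pcellD[of A] path_parallel[of A] by (auto simp: parr_def)

lemma parr_id_left: "parr A p q \<Longrightarrow> pid q \<odot> A = A"
  by (auto simp: parr_def pv_id_left)

lemma parr_id_right: "parr A p q \<Longrightarrow> A \<odot> pid p = A"
  by (auto simp: parr_def pv_id_right)

lemma parr_exchange: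
  assumes "parr A p p'" "parr B q q'" "path (p @ q)"
  shows "(p' \<triangleright> B) \<odot> (A \<triangleleft> q) = (A \<triangleleft> q') \<odot> (p \<triangleright> B)"
  using exchange[of A B] assms by (auto simp: parr_def)

text \<open>The inverse is an explicit argument: the closure rules below build it along with the
  cell, so the inverse of a long pasting is again an explicit pasting.\<close>

definition pinv :: "('m, 'c) path_cell \<Rightarrow> ('m, 'c) path_cell \<Rightarrow> 'm list \<Rightarrow> 'm list \<Rightarrow> bool"
  where "pinv A A' p q \<longleftrightarrow> parr A p q \<and> parr A' q p \<and> A' \<odot> A = pid p \<and> A \<odot> A' = pid q"

lemma pinvD:
  assumes "pinv A A' p q"
  shows "parr A p q" "parr A' q p" "A' \<odot> A = pid p" "A \<odot> A' = pid q"
  using assms by (auto simp: pinv_def)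

lemma pinv_sym: "pinv A A' p q \<Longrightarrow> pinv A' A q p"
  by (auto simp: pinv_def)

lemma pinv_path:
  assumes "pinv A A' p q"
  shows "path p" "path q" "p \<noteq> []" "q \<noteq> []"
  using parrD(1-4)[OF pinvD(1)[OF assms]] by auto

lemma pinv_cancel:
  assumes "pinv A A' p q" "parr X r p"
  shows "A' \<odot> (A \<odot> X) = X"
  using assms by (simp add: pv_assoc[symmetric] pinv_def parr_id_left)

lemma pinv_cancel':
  assumes "pinv A A' p q" "parr X r q"
  shows "A \<odot> (A' \<odot> X) = X"
  using assms by (simp add: pv_assoc[symmetric] pinv_def parr_id_left)

lemma pinv_pv:
  assumes "pinv A A' p q" "pinv B B' q r"
  shows "pinv (B \<odot> A) (A' \<odot> B') p r"
proof -
  note a = pinvD[OF assms(1)] and b = pinvD[OF assms(2)]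
  have "(A' \<odot> B') \<odot> (B \<odot> A) = pid p"
    using pinv_cancel[OF assms(2) a(1)] a by (simp add: pv_assoc)
  moreover have "(B \<odot> A) \<odot> (A' \<odot> B') = pid r"
    using pinv_cancel'[OF assms(1) b(2)] b by (simp add: pv_assoc)
  ultimately show ?thesis
    using a b by (auto simp: pinv_def intro: parr_pv)
qed

lemma pinv_pl:
  assumes "pinv A A' p q" "path (l @ p)"
  shows "pinv (l \<triangleright> A) (l \<triangleright> A') (l @ p) (l @ q)"
proof -
  note a = pinvD[OF assms(1)]
  have "path (l @ q)" "p \<noteq> []" "q \<noteq> []"
    using parrD[OF a(1)] assms by auto
  then show ?thesis
    using a assms(2) by (auto simp: pinv_def pl_pv[symmetric] pl_pid intro: parr_pl)
qed

lemma pinv_pr: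
  assumes "pinv A A' p q" "path (p @ r)"
  shows "pinv (A \<triangleleft> r) (A' \<triangleleft> r) (p @ r) (q @ r)"
proof -
  note a = pinvD[OF assms(1)]
  have "path (q @ r)" "p \<noteq> []" "q \<noteq> []"
    using parrD[OF a(1)] assms by auto
  then show ?thesis
    using a assms(2) by (auto simp: pinv_def pr_pv[symmetric] pr_pid intro: parr_pr)
qed

text \<open>By exchange \<open>I\<close> slides past \<open>B\<close> and meets its inverse. With
  \<open>I\<close> a flattening this replaces a list by its composite in a left whiskering.\<close>

lemma conj_pl:
  assumes "pinv I I' p p'" "parr B q q'" "path (p @ q)"
  shows "(I \<triangleleft> q') \<odot> (p \<triangleright> B) \<odot> (I' \<triangleleft> q) = p' \<triangleright> B"
proof -
  note i = pinvD[OF assms(1)]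
  have pq: "path (p' @ q)" "p' \<noteq> []"
    using parrD[OF i(1)] assms by auto
  have "(I \<triangleleft> q') \<odot> (p \<triangleright> B) \<odot> (I' \<triangleleft> q) = ((I \<triangleleft> q') \<odot> (p \<triangleright> B)) \<odot> (I' \<triangleleft> q)"
    by (simp add: pv_assoc)
  also have "\<dots> = (p' \<triangleright> B) \<odot> (I \<odot> I') \<triangleleft> q"
    unfolding parr_exchange[OF i(1) assms(2,3), symmetric] by (simp add: pv_assoc pr_pv)
  also have "\<dots> = p' \<triangleright> B"
    using parr_pl[OF assms(2) pq(1)] pq by (simp add: i pr_pid parr_id_right)
  finally show ?thesis .
qed

text \<open>Mirror image for restrictions: a cell restricted along \<open>p\<close> becomes its
  restriction along an isomorphic \<open>p'\<close>. Comparisons of two restrictions, and of a list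
  with its composite, act on \<alpha> and \<beta> in this way.\<close>

lemma conj_pr:
  assumes "pinv I I' p p'" "parr B q q'" "path (q @ p)"
  shows "(q' \<triangleright> I) \<odot> (B \<triangleleft> p) \<odot> (q \<triangleright> I') = B \<triangleleft> p'"
proof -
  note i = pinvD[OF assms(1)]
  have pq: "path (q @ p')" "p' \<noteq> []"
    using parrD[OF i(1)] assms by auto
  have "(q' \<triangleright> I) \<odot> (B \<triangleleft> p) \<odot> (q \<triangleright> I') = ((q' \<triangleright> I) \<odot> (B \<triangleleft> p)) \<odot> (q \<triangleright> I')"
    by (simp add: pv_assoc)
  also have "\<dots> = (B \<triangleleft> p') \<odot> q \<triangleright> (I \<odot> I')"
    unfolding parr_exchange[OF assms(2) i(1) assms(3)] by (simp add: pv_assoc pl_pv)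
  also have "\<dots> = B \<triangleleft> p'"
    using parr_pr[OF assms(2) pq(1)] pq by (simp add: i pl_pid parr_id_right)
  finally show ?thesis .
qed

section \<open>Translation between list cells and 2-morphisms of the bicategory\<close>

lemma parr_triple:
  "parr (p, a, q) r s \<longleftrightarrow> p = r \<and> q = s \<and> p \<noteq> [] \<and> q \<noteq> [] \<and> path p \<and> path q \<and> a \<in> Cells C (rcomp p) (rcomp q)"
  by (auto simp: parr_def Cells_def)

lemma pinv_triple:
  assumes "a \<in> Isos C (rcomp p) (rcomp q)" "path p" "path q" "p \<noteq> []" "q \<noteq> []"
  shows "pinv (p, a, q) (q, inv2 C a, p) p q"
proof -
  have a: "parr (p, a, q) p q" "parr (q, inv2 C a, p) q p"
    using assms Isos_simps[OF assms(1)] by (auto simp: parr_triple Cells_def)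
  moreover have "(q, inv2 C a, p) \<odot> (p, a, q) = pid p" "(p, a, q) \<odot> (q, inv2 C a, p) = pid q"
    using a assms Isos_simps[OF assms(1)]
    by (auto intro!: path_cell_eqI simp: pv_type pid_type)
  ultimately show ?thesis
    by (simp add: pinv_def)
qed

lemma pinv_Isos:
  assumes "pinv A A' p q"
  shows "pval A \<in> Isos C (rcomp p) (rcomp q)" "inv2 C (pval A) = pval A'"
proof -
  note a = pinvD[OF assms]
  note T = parrD[OF a(1)] parrD[OF a(2)]
  have "pval (A' \<odot> A) = pval A' \<bullet> pval A" "pval (A \<odot> A') = pval A \<bullet> pval A'"
    using T by (simp_all add: pv_type)
  then have "inverse2 C (pval A) (pval A')"
    using T a pcellD[of A] pcellD[of A'] by (simp add: inverse2_def pid_type Cells_def)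
  moreover have "pval A \<in> Cells C (rcomp p) (rcomp q)"
    using T pcellD[of A] by (auto simp: Cells_def)
  ultimately show "pval A \<in> Isos C (rcomp p) (rcomp q)" "inv2 C (pval A) = pval A'"
    by (auto simp: Isos_def Cells_def intro: inv2_eq)
qed

lemma pv_triple:
  assumes "parr (p, a, q) p q" "parr (q, b, r) q r"
  shows "(q, b, r) \<odot> (p, a, q) = (p, b \<bullet> a, r)"
  using assms by (intro path_cell_eqI) (simp_all add: pv_type parr_def)

lemma pl_triple:
  assumes "parr (p, a, q) p q" "path (k # p)"
  shows "[k] \<triangleright> (p, a, q) = (k # p, k \<rhd> a, k # q)"
  using assms by (intro path_cell_eqI) (simp_all add: pl_type parr_def)

text \<open>Right whiskering of a cell between two-element lists is exactly \<open>rw\<close>;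
  through this identity the pastings of the definitions enter the list calculus.\<close>

lemma pr_triple:
  assumes "parr ([f, v], a, [f', v']) [f, v] [f', v']" "r \<noteq> []" "path (f # v # r)"
  shows "([f, v], a, [f', v']) \<triangleleft> r = (f # v # r, rw C f v f' v' a (rcomp r), f' # v' # r)"
proof -
  note T = parrD(7)[OF assms(1)] parrD(6)[OF assms(1), of r] assms(2,3)
  have r: "path (v # r)" "path r" "src C v = trg C (hd r)" "src C v' = trg C (hd r)"
    using T path_Cons[of r v] path_Cons[of r v'] by auto
  have "([f, v], a, [f', v']) \<triangleleft> r = (f # v # r, rebr [f', v'] r \<bullet> (a \<lhd> rcomp r) \<bullet> rebr_inv [f, v] r, f' # v' # r)"
    using T by (intro path_cell_eqI) (simp_all add: pr_type)
  moreover have "rebr [f', v'] r = assoc C f' v' (rcomp r)" "rebr_inv [f, v] r = inv2 C (assoc C f v (rcomp r))"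
    using T r by simp_all
  ultimately show ?thesis
    by (simp add: rw_def)
qed

lemma pr_triple_single:
  assumes "parr ([f], a, [f']) [f] [f']" "r \<noteq> []" "path (f # r)"
  shows "([f], a, [f']) \<triangleleft> r = (f # r, a \<lhd> rcomp r, f' # r)"
proof -
  have "path ([f'] @ r)" "path r" "src C f = trg C (hd r)" "src C f' = trg C (hd r)"
    using assms parrD(6)[OF assms(1), of r] by (auto simp: path_Cons)
  then show ?thesis
    using assms by (intro path_cell_eqI) (simp_all add: pr_type parr_def)
qed

text \<open>The identity of \<open>rcomp p\<close>, read as a 2-morphism between \<open>p\<close> and the list of length one.\<close>

definition flat :: "'m list \<Rightarrow> ('m, 'c) path_cell"
  where "flat p = ([rcomp p], id2 C (rcomp p), p)"

definition unflat :: "'m list \<Rightarrow> ('m, 'c) path_cell"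
  where "unflat p = (p, id2 C (rcomp p), [rcomp p])"

lemma pinv_flat:
  assumes "path p" "p \<noteq> []"
  shows "pinv (flat p) (unflat p) [rcomp p] p"
proof -
  have "parr (flat p) [rcomp p] p" "parr (unflat p) p [rcomp p]"
    using assms by (simp_all add: flat_def unflat_def parr_triple Cells_def)
  moreover have "unflat p \<odot> flat p = pid [rcomp p]" "flat p \<odot> unflat p = pid p"
    using assms unfolding flat_def unflat_def
    by (auto intro!: path_cell_eqI simp: pv_type pid_type Cells_def)
  ultimately show ?thesis
    by (simp add: pinv_def)
qed

definition phom :: "'m list \<Rightarrow> 'o \<Rightarrow> 'o \<Rightarrow> bool"
  where "phom p A B \<longleftrightarrow> p \<noteq> [] \<and> path p \<and> src C (last p) = A \<and> trg C (hd p) = B"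

lemma phom_append: "\<lbrakk>phom q A B; phom p B D\<rbrakk> \<Longrightarrow> phom (p @ q) A D"
  by (simp add: phom_def path_append)

lemma phom_parr: "\<lbrakk>parr X p q; phom p A B\<rbrakk> \<Longrightarrow> phom q A B"
  using parrD[of X p q] pcellD[of X] by (auto simp: phom_def)

lemma phom_pinv: "pinv X X' p q \<Longrightarrow> phom p A B \<longleftrightarrow> phom q A B"
  using phom_parr[of X p q] phom_parr[of X' q p] by (auto simp: pinv_def)

lemma phom_appendD:
  assumes "phom (p @ q) A D"
  shows "phom p B D \<Longrightarrow> q \<noteq> [] \<Longrightarrow> phom q A B" "phom q A B \<Longrightarrow> p \<noteq> [] \<Longrightarrow> phom p B D"
  using assms by (auto simp: phom_def path_append)

text \<open>Solves \<open>S2 \<odot> X \<odot> S1 = Y\<close> for \<open>X\<close>, as the symmetry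
  of equivalence requires.\<close>

lemma pinv_sandwich:
  assumes "pinv S1 T1 d a" "pinv S2 T2 b e" "parr X a b" "S2 \<odot> X \<odot> S1 = Y"
  shows "T2 \<odot> Y \<odot> T1 = X"
proof -
  have "T2 \<odot> Y \<odot> T1 = T2 \<odot> (S2 \<odot> (X \<odot> (S1 \<odot> T1)))"
    using assms(4) by (auto simp: pv_assoc)
  also have "S1 \<odot> T1 = pid a"
    using assms(1) by (simp add: pinv_def)
  finally show ?thesis
    using pinv_cancel[OF assms(2,3)] parr_id_right[OF assms(3)] by simp
qed

text \<open>Rewriting with these rules turns a pasting into a right-nested vertical composite of
  factors \<open>l \<triangleright> (A \<triangleleft> r)\<close>. None of the rules has a side
  condition.\<close>

lemmas pdistr = pv_assoc pl_pv pr_pv pl_pl pr_pr pl_pr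

end

section \<open>The conditions (BF) for lists of 1-morphisms\<close>

context BF
begin

definition inW :: "'m list \<Rightarrow> bool"
  where "inW p \<longleftrightarrow> p \<noteq> [] \<and> path p \<and> rcomp p \<in> W"

lemma inWD: "inW p \<Longrightarrow> p \<noteq> []" "inW p \<Longrightarrow> path p" "inW p \<Longrightarrow> rcomp p \<in> W"
  by (auto simp: inW_def)

lemma inW_single: "inW [f] \<longleftrightarrow> f \<in> W"
  using W_Mor by (auto simp: inW_def)

lemma inW_iso:
  assumes "inW q" "pinv A A' p q"
  shows "inW p"
  using assms pinv_Isos[OF assms(2)] parrD[OF pinvD(1)[OF assms(2)]] BF5[of "rcomp q" "pval A" "rcomp p"]
  by (auto simp: inW_def)

text \<open>Flattening each half on its own leads to a two-element list of composites, the shape in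
  which the (BF) conditions and the composite spans are stated.\<close>

lemma pinv_flat2:
  assumes "path (p @ q)" "p \<noteq> []" "q \<noteq> []"
  shows "pinv ((flat p \<triangleleft> q) \<odot> [rcomp p] \<triangleright> flat q) ([rcomp p] \<triangleright> unflat q \<odot> unflat p \<triangleleft> q) [rcomp p, rcomp q] (p @ q)"
proof -
  have q: "path p" "path q" "src C (last p) = trg C (hd q)"
    using assms by (auto simp: path_append)
  then have "path [rcomp p, rcomp q]" "path (rcomp p # q)"
    using assms by (auto simp: path_Cons)
  then show ?thesis
    using pinv_pv[OF pinv_pl[OF pinv_flat[of q], of "[rcomp p]"] pinv_pr[OF pinv_flat[of p], of q]] assms q
    by simp
qed

text \<open>BF2 applies to the two composites, and BF5 passes along the rebracketing to the
  concatenated list.\<close>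

lemma inW_append:
  assumes "inW p" "inW q" "path (p @ q)"
  shows "inW (p @ q)"
proof -
  note p = inWD[OF assms(1)] and q = inWD[OF assms(2)]
  have "src C (last p) = trg C (hd q)"
    using assms p q by (auto simp: path_append)
  then have "inW [rcomp p, rcomp q]"
    using p q BF2[of "rcomp q" "rcomp p"] by (auto simp: inW_def)
  then show ?thesis
    using inW_iso[OF _ pinv_sym[OF pinv_flat2]] assms p q by blast
qed

lemma BF3_path:
  assumes "inW w" "path f" "f \<noteq> []" "trg C (hd f) = trg C (hd w)"
  shows "\<exists>w' f' R R'. inW [w'] \<and> path (f @ [w']) \<and> path (w @ [f']) \<and> pinv R R' (f @ [w']) (w @ [f'])"
proof -
  note w = inWD[OF assms(1)]
  have "rcomp w \<in> Hom C (src C (rcomp w)) (trg C (rcomp w))" "rcomp f \<in> Hom C (src C (rcomp f)) (trg C (rcomp w))"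
    using assms w by (auto simp: Hom_def)
  then obtain D w' f' \<rho> where S: "filled_square C W (rcomp f) (rcomp w) (D, w', f', \<rho>)"
    using BF3[OF w(3)] by (metis surj_pair)
  then have s: "w' \<in> W" "w' \<in> Mor C" "trg C w' = src C (last f)" "f' \<in> Mor C" "trg C f' = src C (last w)"
    "\<rho> \<in> Isos C (rcomp [rcomp f, w']) (rcomp [rcomp w, f'])"
    using assms w by (auto simp: filled_square_def Hom_def)
  have P: "path (f @ [w'])" "path (w @ [f'])" "path [rcomp f, w']" "path [rcomp w, f']"
    using s assms w by (auto simp: path_append)
  have 1: "pinv ([rcomp f, w'], \<rho>, [rcomp w, f']) ([rcomp w, f'], inv2 C \<rho>, [rcomp f, w']) [rcomp f, w'] [rcomp w, f']"
    using s P by (intro pinv_triple) auto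
  have 2: "pinv (flat f \<triangleleft> [w']) (unflat f \<triangleleft> [w']) [rcomp f, w'] (f @ [w'])"
    using pinv_pr[OF pinv_flat[OF assms(2,3)], of "[w']"] P by simp
  have 3: "pinv (flat w \<triangleleft> [f']) (unflat w \<triangleleft> [f']) [rcomp w, f'] (w @ [f'])"
    using pinv_pr[OF pinv_flat[OF w(2,1)], of "[f']"] P by simp
  show ?thesis
    using pinv_pv[OF pinv_pv[OF pinv_sym[OF 2] 1] 3] s(1) P(1,2) inW_single by blast
qed

text \<open>BF4b is applied to the conjugate \<open>X\<close> of \<open>A\<close> whose source and
  target are built from the composites of \<open>w\<close>, \<open>f1\<close> and \<open>f2\<close>.
  The 2-morphism that it gives is conjugated back to lists.\<close>

lemma BF4b_path:
  assumes "inW w" "pinv A A' (w @ f1) (w @ f2)" "f1 \<noteq> []" "f2 \<noteq> []"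
  shows "\<exists>v B B'. inW [v] \<and> path (f1 @ [v]) \<and> pinv B B' (f1 @ [v]) (f2 @ [v]) \<and> A \<triangleleft> [v] = w \<triangleright> B"
proof -
  note w = inWD[OF assms(1)]
  note a = pinvD[OF assms(2)]
  have wf: "path (w @ f1)" "path (w @ f2)" "path f1" "path f2" "src C (last (w @ f1)) = src C (last (w @ f2))"
    "src C (last w) = trg C (hd f1)" "src C (last w) = trg C (hd f2)"
    using parrD[OF a(1)] pcellD(8)[of A] path_append[of w f1] path_append[of w f2] w assms(3,4) by auto
  have f: "src C (last f1) = src C (last f2)"
    using wf assms by simp
  define K1 where "K1 = (flat w \<triangleleft> f1) \<odot> [rcomp w] \<triangleright> flat f1"
  define L1 where "L1 = [rcomp w] \<triangleright> unflat f1 \<odot> unflat w \<triangleleft> f1"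
  define K2 where "K2 = (flat w \<triangleleft> f2) \<odot> [rcomp w] \<triangleright> flat f2"
  define L2 where "L2 = [rcomp w] \<triangleright> unflat f2 \<odot> unflat w \<triangleleft> f2"
  have K1: "pinv K1 L1 [rcomp w, rcomp f1] (w @ f1)" and K2: "pinv K2 L2 [rcomp w, rcomp f2] (w @ f2)"
    unfolding K1_def L1_def K2_def L2_def using pinv_flat2 wf w assms(3,4) by auto
  define X where "X = L2 \<odot> (A \<odot> K1)"
  have X: "pinv X ((L1 \<odot> A') \<odot> K2) [rcomp w, rcomp f1] [rcomp w, rcomp f2]"
    unfolding X_def using pinv_pv[OF pinv_pv[OF K1 assms(2)] pinv_sym[OF K2]] by simp
  have "pval X \<in> Isos C (rcomp w \<cdot> rcomp f1) (rcomp w \<cdot> rcomp f2)"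
    using pinv_Isos(1)[OF X] by simp
  moreover have "rcomp w \<in> Hom C (src C (rcomp w)) (trg C (rcomp w))"
    "rcomp f1 \<in> Hom C (src C (rcomp f1)) (src C (rcomp w))" "rcomp f2 \<in> Hom C (src C (rcomp f1)) (src C (rcomp w))"
    using w wf f assms(3,4) by (auto simp: Hom_def)
  ultimately obtain E v \<beta> where t: "BF4a_triple C W (rcomp w) (rcomp f1) (rcomp f2) (pval X) (E, v, \<beta>)"
    "\<beta> \<in> Isos C (rcomp f1 \<cdot> v) (rcomp f2 \<cdot> v)"
    using BF4b[OF w(3)] by blast
  then have v: "v \<in> W" "v \<in> Mor C" "trg C v = src C (last f1)"
    "rw C (rcomp w) (rcomp f1) (rcomp w) (rcomp f2) (pval X) v = rcomp w \<rhd> \<beta>"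
    using wf assms(3) by (auto simp: BF4a_triple_def Hom_def)
  have P: "path (f1 @ [v])" "path (f2 @ [v])" "path [rcomp f1, v]" "path [rcomp f2, v]" "path [rcomp w, rcomp f1, v]"
    "path [rcomp w, rcomp f1]" "path [rcomp w, rcomp f2, v]" "path (rcomp w # f1 @ [v])" "path (rcomp w # f2 @ [v])"
    using v wf w f assms(3,4) by (auto simp: path_append path_Cons)
  define Y where "Y = ([rcomp f1, v], \<beta>, [rcomp f2, v])"
  define Y' where "Y' = ([rcomp f2, v], inv2 C \<beta>, [rcomp f1, v])"
  have Y: "pinv Y Y' [rcomp f1, v] [rcomp f2, v]"
    unfolding Y_def Y'_def using P t by (intro pinv_triple) auto
  have F1: "pinv (flat f1 \<triangleleft> [v]) (unflat f1 \<triangleleft> [v]) [rcomp f1, v] (f1 @ [v])"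
    using pinv_pr[OF pinv_flat[of f1], of "[v]"] P wf assms(3) by simp
  have F2: "pinv (flat f2 \<triangleleft> [v]) (unflat f2 \<triangleleft> [v]) [rcomp f2, v] (f2 @ [v])"
    using pinv_pr[OF pinv_flat[of f2], of "[v]"] P wf assms(4) by simp
  define B where "B = flat f2 \<triangleleft> [v] \<odot> Y \<odot> unflat f1 \<triangleleft> [v]"
  define B' where "B' = flat f1 \<triangleleft> [v] \<odot> Y' \<odot> unflat f2 \<triangleleft> [v]"
  have B: "pinv B B' (f1 @ [v]) (f2 @ [v])"
    using pinv_pv[OF pinv_pv[OF pinv_sym[OF F1] Y] F2] by (simp add: B_def B'_def pv_assoc)
  have XY: "X \<triangleleft> [v] = [rcomp w] \<triangleright> Y"
  proof -
    have x: "X = ([rcomp w, rcomp f1], pval X, [rcomp w, rcomp f2])"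
      using parrD[OF pinvD(1)[OF X]] by (intro path_cell_eqI) simp_all
    note px = pinvD(1)[OF X] and py = pinvD(1)[OF Y]
    have "X \<triangleleft> [v] = ([rcomp w, rcomp f1, v], rcomp w \<rhd> \<beta>, [rcomp w, rcomp f2, v])"
      using pr_triple[of "rcomp w" "rcomp f1" "pval X" "rcomp w" "rcomp f2" "[v]"] px P v by (simp flip: x)
    also have "\<dots> = [rcomp w] \<triangleright> Y"
      using pl_triple[of "[rcomp f1, v]" \<beta> "[rcomp f2, v]" "rcomp w"] py P by (simp add: Y_def)
    finally show ?thesis .
  qed
  \<comment> \<open>Undoing the conjugation turns
    \<open>X \<triangleleft> [v] = [rcomp w] \<triangleright> Y\<close> into a statement about
    \<open>A\<close>. The flattenings of \<open>f1\<close> and \<open>f2\<close> go into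
    \<open>B\<close>; those of \<open>w\<close> are absorbed by \<open>conj_pl\<close>.\<close>
  have "A = K2 \<odot> (X \<odot> L1)"
    unfolding X_def pv_assoc
    using pinv_cancel'[OF K2, of "A \<odot> (K1 \<odot> L1)"] a K1 parr_id_right[OF a(1)]
    by (simp add: pinv_def)
  then have "A \<triangleleft> [v] = K2 \<triangleleft> [v] \<odot> [rcomp w] \<triangleright> Y \<odot> L1 \<triangleleft> [v]"
    by (simp add: pr_pv XY)
  also have "\<dots> = flat w \<triangleleft> (f2 @ [v]) \<odot> [rcomp w] \<triangleright> B \<odot> unflat w \<triangleleft> (f1 @ [v])"
    unfolding K2_def L1_def B_def by (simp add: pr_pv pl_pv pr_pr pl_pr pv_assoc)
  also have "\<dots> = w \<triangleright> B"
    using conj_pl[OF pinv_flat pinvD(1)[OF B]] w P by simp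
  finally show ?thesis
    using v(1) B P(1) inW_single by blast
qed

text \<open>
  Whiskered with \<open>v\<close> from BF4a, both \<open>A\<close> and \<open>B\<close> solve the lifting problem posed by \<open>w \<triangleright> A\<close>, so BF4c
  compares them; its \<open>\<zeta>\<close> is cancelled by exchange.
\<close>

lemma restrict_eq:
  assumes "inW w" "parr A p q" "parr B p q" "path (w @ p)" "w \<triangleright> A = w \<triangleright> B"
  shows "\<exists>e. inW [e] \<and> path (p @ [e]) \<and> A \<triangleleft> [e] = B \<triangleleft> [e]"
proof -
  note w = inWD[OF assms(1)]
  note pq = parrD(1-4)[OF assms(2)]
  have P: "path (w @ q)" "src C (last p) = src C (last q)" "trg C (hd p) = trg C (hd q)"
    "src C (last w) = trg C (hd p)"
    using parrD(5)[OF assms(2)] parrD(7-9)[OF assms(2)] pcellD(8,9)[of A] assms(4) w pq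
    by (auto simp: path_append)
  \<comment> \<open>Conjugation by flattenings makes \<open>A\<close> and \<open>B\<close> cells
    between single 1-morphisms, where BF4a and BF4c apply.\<close>
  define conj where "conj Z = unflat q \<odot> Z \<odot> flat p" for Z
  have conj: "parr (conj Z) [rcomp p] [rcomp q]" "Z = flat q \<odot> conj Z \<odot> unflat p" if "parr Z p q" for Z
  proof -
    note fp = pinv_flat[OF pq(1,3)] and fq = pinv_flat[OF pq(2,4)]
    show "parr (conj Z) [rcomp p] [rcomp q]"
      unfolding conj_def using that fp fq by (blast intro: parr_pv pinvD)
    show "Z = flat q \<odot> conj Z \<odot> unflat p"
      unfolding conj_def pv_assoc
      using pinv_cancel'[OF fq, of "Z \<odot> (flat p \<odot> unflat p)"] that fp parr_id_right[OF that]
      by (simp add: pinv_def)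
  qed
  define a where "a = pval (conj A)"
  define b where "b = pval (conj B)"
  have ab: "conj A = ([rcomp p], a, [rcomp q])" "conj B = ([rcomp p], b, [rcomp q])"
    using conj(1)[OF assms(2)] conj(1)[OF assms(3)] unfolding a_def b_def
    by (auto intro!: path_cell_eqI simp: parr_def)
  have pab: "parr ([rcomp p], a, [rcomp q]) [rcomp p] [rcomp q]" "parr ([rcomp p], b, [rcomp q]) [rcomp p] [rcomp q]"
    using conj(1)[OF assms(2)] conj(1)[OF assms(3)] unfolding ab by auto
  have wp: "path [rcomp w, rcomp p]" "path [rcomp w, rcomp q]" "rcomp p \<in> Mor C" "rcomp q \<in> Mor C"
    using w pq P by auto
  have "w \<triangleright> conj A = w \<triangleright> conj B"
    using assms(5) by (simp add: conj_def pl_pv)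
  then have "[rcomp w] \<triangleright> conj A = [rcomp w] \<triangleright> conj B"
    using conj_pl[OF pinv_sym[OF pinv_flat[OF w(2,1)]] conj(1)[OF assms(2)]]
      conj_pl[OF pinv_sym[OF pinv_flat[OF w(2,1)]] conj(1)[OF assms(3)]] w P pq
    by (auto simp: path_append)
  then have "([rcomp w, rcomp p], rcomp w \<rhd> a, [rcomp w, rcomp q]) = ([rcomp w, rcomp p], rcomp w \<rhd> b, [rcomp w, rcomp q])"
    using pl_triple[OF pab(1), of "rcomp w"] pl_triple[OF pab(2), of "rcomp w"] wp unfolding ab by simp
  then have wab: "rcomp w \<rhd> a = rcomp w \<rhd> b"
    by simp
  have H: "rcomp w \<in> Hom C (src C (rcomp w)) (trg C (rcomp w))"
    "rcomp p \<in> Hom C (src C (rcomp p)) (src C (rcomp w))" "rcomp q \<in> Hom C (src C (rcomp p)) (src C (rcomp w))"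
    "rcomp w \<rhd> a \<in> Cells C (rcomp w \<cdot> rcomp p) (rcomp w \<cdot> rcomp q)"
    using w pq P pab by (auto simp: Hom_def Cells_def parr_def)
  then obtain D v \<beta> where v0: "BF4a_triple C W (rcomp w) (rcomp p) (rcomp q) (rcomp w \<rhd> a) (D, v, \<beta>)"
    using BF4a[OF w(3)] by (metis surj_pair)
  then have v: "v \<in> W" "v \<in> Hom C D (src C (rcomp p))" "v \<in> Mor C" "trg C v = src C (last p)"
    using pq by (auto simp: BF4a_triple_def Hom_def)
  have Pv: "path [rcomp p, v]" "path [rcomp q, v]" "path [rcomp w, rcomp p, v]"
    using v wp w pq P by auto
  \<comment> \<open>\<open>c\<close> stands for \<open>a\<close> and for \<open>b\<close>. Left and
    right whiskering commute, so restricting \<open>rcomp w \<rhd> c\<close> along \<open>v\<close>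
    gives \<open>rcomp w \<rhd> (c \<lhd> v)\<close>. By \<open>wab\<close> the two triples then
    solve the same lifting problem.\<close>
  have t: "BF4a_triple C W (rcomp w) (rcomp p) (rcomp q) (rcomp w \<rhd> c) (D, v, c \<lhd> v)"
    if c: "parr ([rcomp p], c, [rcomp q]) [rcomp p] [rcomp q]" for c
  proof -
    have "([rcomp p], c, [rcomp q]) \<triangleleft> [v] = ([rcomp p, v], c \<lhd> v, [rcomp q, v])"
      using pr_triple_single[OF c, of "[v]"] Pv by simp
    moreover have "parr (([rcomp p], c, [rcomp q]) \<triangleleft> [v]) [rcomp p, v] [rcomp q, v]"
      using parr_pr[OF c, of "[v]"] Pv by simp
    ultimately have cv: "parr ([rcomp p, v], c \<lhd> v, [rcomp q, v]) [rcomp p, v] [rcomp q, v]"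
      "([rcomp p, v], c \<lhd> v, [rcomp q, v]) = ([rcomp p], c, [rcomp q]) \<triangleleft> [v]"
      by auto
    have wc: "[rcomp w] \<triangleright> ([rcomp p], c, [rcomp q]) = ([rcomp w, rcomp p], rcomp w \<rhd> c, [rcomp w, rcomp q])"
      "parr ([rcomp w, rcomp p], rcomp w \<rhd> c, [rcomp w, rcomp q]) [rcomp w, rcomp p] [rcomp w, rcomp q]"
      using pl_triple[OF c, of "rcomp w"] parr_pl[OF c, of "[rcomp w]"] wp by auto
    have "([rcomp w, rcomp p, v], rw C (rcomp w) (rcomp p) (rcomp w) (rcomp q) (rcomp w \<rhd> c) v, [rcomp w, rcomp q, v])
      = ([rcomp w] \<triangleright> ([rcomp p], c, [rcomp q])) \<triangleleft> [v]"
      using pr_triple[OF wc(2), of "[v]"] Pv by (simp add: wc)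
    also have "\<dots> = [rcomp w] \<triangleright> ([rcomp p, v], c \<lhd> v, [rcomp q, v])"
      by (simp add: pl_pr cv(2))
    also have "\<dots> = ([rcomp w, rcomp p, v], rcomp w \<rhd> (c \<lhd> v), [rcomp w, rcomp q, v])"
      using pl_triple[OF cv(1), of "rcomp w"] Pv by simp
    finally show ?thesis
      using v cv(1) by (auto simp: BF4a_triple_def parr_triple)
  qed
  obtain E x x' \<zeta> where x: "x \<in> Hom C E D" "x' \<in> Hom C E D" "\<zeta> \<in> Isos C (v \<cdot> x) (v \<cdot> x')" "v \<cdot> x \<in> W"
    "rw C (rcomp p) v (rcomp q) v (b \<lhd> v) x' \<bullet> (rcomp p \<rhd> \<zeta>) = (rcomp q \<rhd> \<zeta>) \<bullet> rw C (rcomp p) v (rcomp q) v (a \<lhd> v) x"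
    using BF4c[OF w(3) H t[OF pab(1)] t[OF pab(2), folded wab]] by blast
  have Px: "path [v, x]" "path [v, x']" "path [rcomp p, v, x]" "path [rcomp p, v, x']"
    using x v Pv by (auto simp: Hom_def)
  define Z where "Z = ([v, x], \<zeta>, [v, x'])"
  define Z' where "Z' = ([v, x'], inv2 C \<zeta>, [v, x])"
  have Z: "pinv Z Z' [v, x] [v, x']"
    unfolding Z_def Z'_def using x Px by (intro pinv_triple) auto
  have c: "conj A \<triangleleft> [v] = ([rcomp p, v], a \<lhd> v, [rcomp q, v])" "conj B \<triangleleft> [v] = ([rcomp p, v], b \<lhd> v, [rcomp q, v])"
    "parr (conj A \<triangleleft> [v]) [rcomp p, v] [rcomp q, v]" "parr (conj B \<triangleleft> [v]) [rcomp p, v] [rcomp q, v]"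
    using pr_triple_single[OF pab(1), of "[v]"] pr_triple_single[OF pab(2), of "[v]"]
      parr_pr[OF pab(1), of "[v]"] parr_pr[OF pab(2), of "[v]"] Pv by (simp_all add: ab)
  have ca: "conj A \<triangleleft> [v, x] = ([rcomp p, v, x], rw C (rcomp p) v (rcomp q) v (a \<lhd> v) x, [rcomp q, v, x])"
    using pr_triple[OF c(3)[unfolded c], of "[x]"] Px pr_pr[of "conj A" "[v]" "[x]"] by (simp add: c)
  have cb: "conj B \<triangleleft> [v, x'] = ([rcomp p, v, x'], rw C (rcomp p) v (rcomp q) v (b \<lhd> v) x', [rcomp q, v, x'])"
    using pr_triple[OF c(4)[unfolded c], of "[x']"] Px pr_pr[of "conj B" "[v]" "[x']"] by (simp add: c)
  have pc: "parr (conj A \<triangleleft> [v, x]) [rcomp p, v, x] [rcomp q, v, x]" "parr (conj B \<triangleleft> [v, x]) [rcomp p, v, x] [rcomp q, v, x]"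
    "parr (conj B \<triangleleft> [v, x']) [rcomp p, v, x'] [rcomp q, v, x']"
    using parr_pr[OF pab(1), of "[v, x]"] parr_pr[OF pab(2), of "[v, x]"] parr_pr[OF pab(2), of "[v, x']"]
      Px by (simp_all add: ab)
  have qz: "path [rcomp q, v, x]"
    using parrD(2)[OF pc(1)] .
  have "(conj B \<triangleleft> [v, x']) \<odot> ([rcomp p] \<triangleright> Z) = ([rcomp q] \<triangleright> Z) \<odot> (conj A \<triangleleft> [v, x])"
  proof -
    have z: "[rcomp p] \<triangleright> Z = ([rcomp p, v, x], rcomp p \<rhd> \<zeta>, [rcomp p, v, x'])"
      "parr ([rcomp p] \<triangleright> Z) [rcomp p, v, x] [rcomp p, v, x']"
      "[rcomp q] \<triangleright> Z = ([rcomp q, v, x], rcomp q \<rhd> \<zeta>, [rcomp q, v, x'])"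
      "parr ([rcomp q] \<triangleright> Z) [rcomp q, v, x] [rcomp q, v, x']"
      using pl_triple[OF pinvD(1)[OF Z, unfolded Z_def], of "rcomp p"]
        pl_triple[OF pinvD(1)[OF Z, unfolded Z_def], of "rcomp q"]
        parr_pl[OF pinvD(1)[OF Z], of "[rcomp p]"] parr_pl[OF pinvD(1)[OF Z], of "[rcomp q]"] Px qz
      by (simp_all add: Z_def)
    show ?thesis
      using z(2,4) pc(1,3) x(5) unfolding z(1,3) ca cb by (simp add: pv_triple)
  qed
  moreover have "(conj B \<triangleleft> [v, x']) \<odot> ([rcomp p] \<triangleright> Z) = ([rcomp q] \<triangleright> Z) \<odot> (conj B \<triangleleft> [v, x])"
    using parr_exchange[OF conj(1)[OF assms(3)] pinvD(1)[OF Z]] Px by simp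
  ultimately have "conj A \<triangleleft> [v, x] = conj B \<triangleleft> [v, x]"
    using pinv_cancel[OF pinv_pl[OF Z, of "[rcomp q]"]] pc(1,2) qz by (metis append_Cons append_Nil)
  \<comment> \<open>BF4c puts the composite \<open>v \<cdot> x\<close> into \<open>W\<close>, so the
    equality along the list \<open>[v, x]\<close> is carried over to this single 1-morphism.\<close>
  moreover have "conj Y \<triangleleft> [v \<cdot> x] = ([rcomp q] \<triangleright> unflat [v, x]) \<odot> (conj Y \<triangleleft> [v, x]) \<odot> ([rcomp p] \<triangleright> flat [v, x])"
    if "parr Y p q" for Y
    using conj_pr[OF pinv_sym[OF pinv_flat[OF Px(1)]] conj(1)[OF that]] Px by simp
  ultimately have "conj A \<triangleleft> [v \<cdot> x] = conj B \<triangleleft> [v \<cdot> x]"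
    using assms(2,3) by simp
  then have "A \<triangleleft> [v \<cdot> x] = B \<triangleleft> [v \<cdot> x]"
    using conj(2)[OF assms(2)] conj(2)[OF assms(3)] by (metis pr_pv)
  moreover have "path (p @ [v \<cdot> x])"
    using Px v pq by (auto simp: path_append)
  ultimately show ?thesis
    using x(4) by (auto simp: inW_single)
qed

subsection \<open>Equivalence of representatives\<close>

text \<open>Legs and restrictions are lists, so composites such as those in a composite span need no
  brackets. The types of \<open>z\<close> and \<open>z'\<close> are implied by the two inverse
  pairs.\<close>

definition path_equiv :: "'m list \<Rightarrow> 'm list \<Rightarrow> 'm list \<Rightarrow> 'm list \<Rightarrow>
    'm list \<times> 'm list \<times> ('m, 'c) path_cell \<times> ('m, 'c) path_cell \<Rightarrow>
    'm list \<times> 'm list \<times> ('m, 'c) path_cell \<times> ('m, 'c) path_cell \<Rightarrow> bool"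
  where "path_equiv w1 w2 f1 f2 = (\<lambda>(v1, v2, \<alpha>, \<beta>) (v1', v2', \<alpha>', \<beta>').
    \<exists>z z' S1 T1 S2 T2. z \<noteq> [] \<and> z' \<noteq> [] \<and>
      pinv S1 T1 (v1' @ z') (v1 @ z) \<and> pinv S2 T2 (v2 @ z) (v2' @ z') \<and> inW (w1 @ v1 @ z) \<and>
      w2 \<triangleright> S2 \<odot> \<alpha> \<triangleleft> z \<odot> w1 \<triangleright> S1 = \<alpha>' \<triangleleft> z' \<and>
      f2 \<triangleright> S2 \<odot> \<beta> \<triangleleft> z \<odot> f1 \<triangleright> S1 = \<beta>' \<triangleleft> z')"

definition path_rep :: "'o \<Rightarrow> 'o \<Rightarrow> 'm list \<Rightarrow> 'm list \<Rightarrow> 'm list \<Rightarrow> 'm list \<Rightarrow>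
    'm list \<times> 'm list \<times> ('m, 'c) path_cell \<times> ('m, 'c) path_cell \<Rightarrow> bool"
  where "path_rep A B w1 w2 f1 f2 = (\<lambda>(v1, v2, \<alpha>, \<beta>).
    \<exists>A1 A2 A3 \<alpha>'. inW w1 \<and> inW w2 \<and> phom w1 A1 A \<and> phom w2 A2 A \<and> phom f1 A1 B \<and> phom f2 A2 B \<and>
      phom v1 A3 A1 \<and> phom v2 A3 A2 \<and> inW (w1 @ v1) \<and>
      pinv \<alpha> \<alpha>' (w1 @ v1) (w2 @ v2) \<and> parr \<beta> (f1 @ v1) (f2 @ v2))"

text \<open>The witnesses are inverted and each equation is solved by \<open>pinv_sandwich\<close>.
  The condition on \<open>W\<close> mentions only \<open>w1\<close>, \<open>v1\<close> and
  \<open>z\<close>; with the roles reversed it follows from BF5 along \<open>S1\<close>.\<close>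

lemma path_equiv_sym:
  assumes "path_rep A B w1 w2 f1 f2 (v1, v2, \<alpha>, \<beta>)" "path_rep A B w1 w2 f1 f2 (v1', v2', \<alpha>', \<beta>')"
    and "path_equiv w1 w2 f1 f2 (v1, v2, \<alpha>, \<beta>) (v1', v2', \<alpha>', \<beta>')"
  shows "path_equiv w1 w2 f1 f2 (v1', v2', \<alpha>', \<beta>') (v1, v2, \<alpha>, \<beta>)"
proof -
  obtain A1 A2 A3 \<alpha>i where r: "phom w1 A1 A" "phom w2 A2 A" "phom f1 A1 B" "phom f2 A2 B"
      "phom v1 A3 A1" "phom v2 A3 A2" "pinv \<alpha> \<alpha>i (w1 @ v1) (w2 @ v2)" "parr \<beta> (f1 @ v1) (f2 @ v2)"
    using assms(1) by (auto simp: path_rep_def)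
  obtain z z' S1 T1 S2 T2 where z: "z \<noteq> []" "z' \<noteq> []"
      and S: "pinv S1 T1 (v1' @ z') (v1 @ z)" "pinv S2 T2 (v2 @ z) (v2' @ z')" "inW (w1 @ v1 @ z)"
      and e: "w2 \<triangleright> S2 \<odot> \<alpha> \<triangleleft> z \<odot> w1 \<triangleright> S1 = \<alpha>' \<triangleleft> z'"
        "f2 \<triangleright> S2 \<odot> \<beta> \<triangleleft> z \<odot> f1 \<triangleright> S1 = \<beta>' \<triangleleft> z'"
    using assms(3) unfolding path_equiv_def by auto
  have P: "path (w1 @ v1' @ z')" "path (w2 @ v2 @ z)" "path (f1 @ v1' @ z')" "path (f2 @ v2 @ z)"
    "path (w1 @ v1 @ z)" "path (f1 @ v1 @ z)"
  proof -
    obtain A4 where "phom z A4 A3"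
      using inWD(2)[OF S(3)] r z by (auto simp: phom_def path_append)
    then have "phom (v1 @ z) A4 A1" "phom (v2 @ z) A4 A2"
      using r phom_append by blast+
    moreover from this have "phom (v1' @ z') A4 A1"
      using phom_pinv[OF S(1)] by blast
    ultimately have "phom (w1 @ v1' @ z') A4 A" "phom (w2 @ v2 @ z) A4 A" "phom (f1 @ v1' @ z') A4 B"
      "phom (f2 @ v2 @ z) A4 B" "phom (w1 @ v1 @ z) A4 A" "phom (f1 @ v1 @ z) A4 B"
      using r phom_append by blast+
    then show "path (w1 @ v1' @ z')" "path (w2 @ v2 @ z)" "path (f1 @ v1' @ z')" "path (f2 @ v2 @ z)"
      "path (w1 @ v1 @ z)" "path (f1 @ v1 @ z)"
      by (auto simp: phom_def)
  qed
  have "w2 \<triangleright> T2 \<odot> \<alpha>' \<triangleleft> z' \<odot> w1 \<triangleright> T1 = \<alpha> \<triangleleft> z"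
    using pinv_sandwich[OF pinv_pl[OF S(1) P(1)] pinv_pl[OF S(2) P(2)] _ e(1)]
      parr_pr[OF pinvD(1)[OF r(7)], of z] P by simp
  moreover have "f2 \<triangleright> T2 \<odot> \<beta>' \<triangleleft> z' \<odot> f1 \<triangleright> T1 = \<beta> \<triangleleft> z"
    using pinv_sandwich[OF pinv_pl[OF S(1) P(3)] pinv_pl[OF S(2) P(4)] _ e(2)]
      parr_pr[OF r(8), of z] P by simp
  moreover have "inW (w1 @ v1' @ z')"
    using inW_iso[OF S(3) pinv_pl[OF S(1) P(1)]] .
  ultimately show ?thesis
    unfolding path_equiv_def prod.case using z pinv_sym[OF S(1)] pinv_sym[OF S(2)] by blast
qed

text \<open>\<open>D\<close> identifies the two restrictions of the middle representative, so
  conjugating \<theta>' by it joins the two given equations. \<theta> stands for \<alpha> as well as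
  for \<beta>.\<close>

lemma path_equiv_trans_aux:
  assumes "pinv D D' (z' @ k) (y @ l)" "parr \<theta>' (h1 @ v1') (h2 @ v2')" "path (h1 @ v1' @ z' @ k)"
    and e: "h2 \<triangleright> S2 \<odot> \<theta> \<triangleleft> z \<odot> h1 \<triangleright> S1 = \<theta>' \<triangleleft> z'"
      "h2 \<triangleright> U2 \<odot> \<theta>' \<triangleleft> y \<odot> h1 \<triangleright> U1 = \<theta>'' \<triangleleft> y''"
  shows "h2 \<triangleright> (U2 \<triangleleft> l \<odot> v2' \<triangleright> D \<odot> S2 \<triangleleft> k) \<odot> \<theta> \<triangleleft> (z @ k) \<odot>
      h1 \<triangleright> (S1 \<triangleleft> k \<odot> v1' \<triangleright> D' \<odot> U1 \<triangleleft> l) = \<theta>'' \<triangleleft> (y'' @ l)"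
proof -
  have "h2 \<triangleright> (U2 \<triangleleft> l \<odot> v2' \<triangleright> D \<odot> S2 \<triangleleft> k) \<odot> \<theta> \<triangleleft> (z @ k) \<odot>
      h1 \<triangleright> (S1 \<triangleleft> k \<odot> v1' \<triangleright> D' \<odot> U1 \<triangleleft> l)
    = (h2 \<triangleright> U2) \<triangleleft> l \<odot> ((h2 @ v2') \<triangleright> D \<odot>
        ((h2 \<triangleright> S2 \<odot> \<theta> \<triangleleft> z \<odot> h1 \<triangleright> S1) \<triangleleft> k) \<odot> (h1 @ v1') \<triangleright> D') \<odot> (h1 \<triangleright> U1) \<triangleleft> l"
    by (simp add: pdistr)
  also have "(h2 \<triangleright> S2 \<odot> \<theta> \<triangleleft> z \<odot> h1 \<triangleright> S1) \<triangleleft> k = \<theta>' \<triangleleft> (z' @ k)"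
    unfolding e by (simp add: pr_pr)
  also have "(h2 @ v2') \<triangleright> D \<odot> \<theta>' \<triangleleft> (z' @ k) \<odot> (h1 @ v1') \<triangleright> D' = \<theta>' \<triangleleft> (y @ l)"
    using conj_pr[OF assms(1,2)] assms(3) by simp
  also have "(h2 \<triangleright> U2) \<triangleleft> l \<odot> \<theta>' \<triangleleft> (y @ l) \<odot> (h1 \<triangleright> U1) \<triangleleft> l
    = (h2 \<triangleright> U2 \<odot> \<theta>' \<triangleleft> y \<odot> h1 \<triangleright> U1) \<triangleleft> l"
    by (simp add: pdistr)
  finally show ?thesis
    unfolding e by (simp add: pr_pr)
qed

text \<open>The two witnesses restrict the middle representative along \<open>z'\<close> and along
  \<open>y\<close>, and a common refinement of these is needed. Only the composites with
  \<open>w1 @ v1'\<close> are known to lie in \<open>W\<close>, so the square is completed under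
  \<open>w1 @ v1'\<close>, and this list is then stripped off.\<close>

lemma path_equiv_trans:
  assumes "path_rep A B w1 w2 f1 f2 (v1, v2, \<alpha>, \<beta>)" "path_rep A B w1 w2 f1 f2 (v1', v2', \<alpha>', \<beta>')"
    and "path_rep A B w1 w2 f1 f2 (v1'', v2'', \<alpha>'', \<beta>'')"
    and "path_equiv w1 w2 f1 f2 (v1, v2, \<alpha>, \<beta>) (v1', v2', \<alpha>', \<beta>')"
    and "path_equiv w1 w2 f1 f2 (v1', v2', \<alpha>', \<beta>') (v1'', v2'', \<alpha>'', \<beta>'')"
  shows "path_equiv w1 w2 f1 f2 (v1, v2, \<alpha>, \<beta>) (v1'', v2'', \<alpha>'', \<beta>'')"
proof -
  obtain A1 A2 A3 \<alpha>i where r: "inW w1" "phom w1 A1 A" "phom w2 A2 A" "phom f1 A1 B" "phom f2 A2 B"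
      "phom v1' A3 A1" "phom v2' A3 A2" "pinv \<alpha>' \<alpha>i (w1 @ v1') (w2 @ v2')" "parr \<beta>' (f1 @ v1') (f2 @ v2')"
      "inW (w1 @ v1')"
    using assms(2) by (auto simp: path_rep_def)
  obtain z z' S1 T1 S2 T2 where z: "z \<noteq> []" "z' \<noteq> []"
      and S: "pinv S1 T1 (v1' @ z') (v1 @ z)" "pinv S2 T2 (v2 @ z) (v2' @ z')" "inW (w1 @ v1 @ z)"
      and e: "w2 \<triangleright> S2 \<odot> \<alpha> \<triangleleft> z \<odot> w1 \<triangleright> S1 = \<alpha>' \<triangleleft> z'"
        "f2 \<triangleright> S2 \<odot> \<beta> \<triangleleft> z \<odot> f1 \<triangleright> S1 = \<beta>' \<triangleleft> z'"
    using assms(4) unfolding path_equiv_def by auto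
  obtain y y'' U1 V1 U2 V2 where y: "y \<noteq> []" "y'' \<noteq> []"
      and U: "pinv U1 V1 (v1'' @ y'') (v1' @ y)" "pinv U2 V2 (v2' @ y) (v2'' @ y'')" "inW (w1 @ v1' @ y)"
      and d: "w2 \<triangleright> U2 \<odot> \<alpha>' \<triangleleft> y \<odot> w1 \<triangleright> U1 = \<alpha>'' \<triangleleft> y''"
        "f2 \<triangleright> U2 \<odot> \<beta>' \<triangleleft> y \<odot> f1 \<triangleright> U1 = \<beta>'' \<triangleleft> y''"
    using assms(5) unfolding path_equiv_def by auto
  have v1z: "path (v1' @ z')" "path (v1 @ z)" "path (v2 @ z)" "path (v2' @ z')"
    using pinv_path[OF S(1)] pinv_path[OF S(2)] by auto
  then obtain A4 where A4: "phom z' A4 A3"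
    using r(6) z by (auto simp: phom_def path_append)
  have v1y: "path (v1' @ y)" "path (v1'' @ y'')"
    using pinv_path[OF U(1)] by auto
  then obtain A5 where A5: "phom y A5 A3"
    using r(6) y by (auto simp: phom_def path_append)
  have hz: "phom (w1 @ v1' @ z') A4 A" "phom (w1 @ v1' @ y) A5 A"
    using A4 A5 r phom_append by blast+
  have Wz: "inW (w1 @ v1' @ z')"
    using inW_iso[OF S(3) pinv_pl[OF S(1)]] hz by (simp add: phom_def)
  \<comment> \<open>BF3 is used with \<open>w1 @ v1' @ y\<close>, which is in
    \<open>W\<close>.\<close>
  obtain t t' R R' where t: "inW [t]" "path ((w1 @ v1' @ z') @ [t])" "path ((w1 @ v1' @ y) @ [t'])"
      "pinv R R' ((w1 @ v1' @ z') @ [t]) ((w1 @ v1' @ y) @ [t'])"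
    using BF3_path[OF U(3), of "w1 @ v1' @ z'"] hz unfolding phom_def by metis
  have R: "pinv R R' ((w1 @ v1') @ (z' @ [t])) ((w1 @ v1') @ (y @ [t']))"
    using t(4) by simp
  \<comment> \<open>Since \<open>w1 @ v1'\<close> is in \<open>W\<close>, BF4b turns
    \<open>R\<close>, restricted along \<open>s\<close>, into a comparison of \<open>z'\<close> and
    \<open>y\<close> themselves.\<close>
  obtain s D D' where s: "inW [s]" "path ((z' @ [t]) @ [s])" "pinv D D' ((z' @ [t]) @ [s]) ((y @ [t']) @ [s])"
    using BF4b_path[OF r(10) R] by blast
  define k where "k = [t, s]"
  define l where "l = [t', s]"
  have kl: "k \<noteq> []" "l \<noteq> []"
    by (simp_all add: k_def l_def)
  have D: "pinv D D' (z' @ k) (y @ l)"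
    using s(3) by (simp add: k_def l_def)
  have hk: "path (z' @ k)"
    using s(2) by (simp add: k_def)
  then obtain A6 where A6: "phom k A6 A4"
    using A4 kl by (auto simp: phom_def path_append)
  have h: "phom (z' @ k) A6 A3"
    using A4 A6 phom_append by blast
  then have h': "phom (y @ l) A6 A3"
    using phom_pinv[OF D] by blast
  have hl: "phom l A6 A5"
    using phom_appendD(1)[OF h' A5] kl by blast
  have PWk: "inW k"
    using inW_append[OF t(1) s(1)] A6 by (simp add: k_def phom_def)
  have P: "path (v1' @ z' @ k)" "path (v2' @ z' @ k)" "path (w1 @ v1' @ z' @ k)" "path (f1 @ v1' @ z' @ k)"
    "path (v1' @ y @ l)" "path (w1 @ v1 @ z @ k)" "path (v1 @ z @ k)" "path (v1'' @ y'' @ l)" "path (v2 @ z @ k)"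
    "path (v2' @ y @ l)"
  proof -
    have "phom (v1' @ z') A4 A1" "phom (v2' @ z') A4 A2" "phom (v1' @ y) A5 A1"
      "phom (v1' @ z' @ k) A6 A1" "phom (v2' @ z' @ k) A6 A2" "phom (v1' @ y @ l) A6 A1" "phom (v2' @ y @ l) A6 A2"
      using A4 A5 r h h' phom_append by blast+
    moreover from this have "phom (v1 @ z) A4 A1" "phom (v2 @ z) A4 A2" "phom (v1'' @ y'') A5 A1"
      using phom_pinv[OF S(1)] phom_pinv[OF S(2)] phom_pinv[OF U(1)] by blast+
    moreover from this have "phom ((v1 @ z) @ k) A6 A1" "phom ((v2 @ z) @ k) A6 A2" "phom ((v1'' @ y'') @ l) A6 A1"
      using A6 hl phom_append by blast+
    moreover from calculation have "phom (w1 @ v1' @ z' @ k) A6 A" "phom (f1 @ v1' @ z' @ k) A6 B"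
      "phom (w1 @ (v1 @ z) @ k) A6 A"
      using r phom_append by blast+
    ultimately show "path (v1' @ z' @ k)" "path (v2' @ z' @ k)" "path (w1 @ v1' @ z' @ k)"
      "path (f1 @ v1' @ z' @ k)"
      "path (v1' @ y @ l)" "path (w1 @ v1 @ z @ k)" "path (v1 @ z @ k)" "path (v1'' @ y'' @ l)"
      "path (v2 @ z @ k)" "path (v2' @ y @ l)"
      by (auto simp: phom_def)
  qed
  have i1: "pinv (U1 \<triangleleft> l) (V1 \<triangleleft> l) (v1'' @ y'' @ l) (v1' @ y @ l)"
    "pinv (v1' \<triangleright> D') (v1' \<triangleright> D) (v1' @ y @ l) (v1' @ z' @ k)"
    "pinv (S1 \<triangleleft> k) (T1 \<triangleleft> k) (v1' @ z' @ k) (v1 @ z @ k)"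
    using pinv_pr[OF U(1), of l] pinv_pl[OF pinv_sym[OF D], of v1'] pinv_pr[OF S(1), of k] P by simp_all
  have i2: "pinv (U2 \<triangleleft> l) (V2 \<triangleleft> l) (v2' @ y @ l) (v2'' @ y'' @ l)"
    "pinv (v2' \<triangleright> D) (v2' \<triangleright> D') (v2' @ z' @ k) (v2' @ y @ l)"
    "pinv (S2 \<triangleleft> k) (T2 \<triangleleft> k) (v2 @ z @ k) (v2' @ z' @ k)"
    using pinv_pr[OF U(2), of l] pinv_pl[OF D, of v2'] pinv_pr[OF S(2), of k] P by simp_all
  note j1 = pinv_pv[OF pinv_pv[OF i1(1,2)] i1(3)] and j2 = pinv_pv[OF pinv_pv[OF i2(3,2)] i2(1)]
  have "inW (w1 @ v1 @ z @ k)"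
    using inW_append[OF S(3) PWk] P by simp
  moreover note path_equiv_trans_aux[OF D pinvD(1)[OF r(8)] P(3) e(1) d(1)] path_equiv_trans_aux[OF D r(9) P(4) e(2) d(2)]
  ultimately show ?thesis
    unfolding path_equiv_def prod.case
    by (intro exI[of _ "z @ k"] exI[of _ "y'' @ l"] exI conjI)
      (use j1 j2 z y in \<open>simp_all add: pv_assoc\<close>)
qed

subsection \<open>Whiskering of equivalent representatives\<close>

lemma phom_exI: "\<lbrakk>path (p @ q); phom p B D; q \<noteq> []\<rbrakk> \<Longrightarrow> \<exists>A. phom q A B"
  by (auto simp: phom_def path_append)

text \<open>Read from the inside out: \<open>e1\<close> and \<open>e2\<close> cancel against
  \<open>E1\<close> and \<open>E2\<close>, conjugation by \<open>K\<close> passes from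
  \<open>a @ t\<close> to \<open>z @ b\<close>, the given equation replaces \<theta> by \<theta>',
  and conjugation by the inverse of \<open>L\<close> passes from \<open>z' @ b\<close> to
  \<open>a' @ t'\<close>. The cells \<open>E2'\<close> and \<open>e1'\<close> are carried along.
  With \<theta> equal to \<alpha> this concerns mu, with \<theta> equal to \<beta> the target of
  lam.\<close>

lemma transport_conj:
  assumes "pinv K K' (a @ t) (z @ b)" "pinv L L' (a' @ t') (z' @ b)"
    and "pinv E1 e1 (v1 @ a) (u1 @ x)" "pinv E2 e2 (v2 @ a) (u2 @ y)"
    and "parr \<theta> (k1 @ v1) (k2 @ v2)" "parr \<theta>' (k1 @ v1') (k2 @ v2')"
    and eq: "k2 \<triangleright> S2 \<odot> \<theta> \<triangleleft> z \<odot> k1 \<triangleright> S1 = \<theta>' \<triangleleft> z'"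
    and "path (k1 @ v1 @ a @ t)" "path (k1 @ v1' @ z' @ b)"
  shows "k2 \<triangleright> (E2' \<triangleleft> t' \<odot> v2' \<triangleright> L' \<odot> S2 \<triangleleft> b \<odot> v2 \<triangleright> K \<odot> e2 \<triangleleft> t) \<odot>
      (k2 \<triangleright> E2 \<odot> \<theta> \<triangleleft> a \<odot> k1 \<triangleright> e1) \<triangleleft> t \<odot>
      k1 \<triangleright> (E1 \<triangleleft> t \<odot> v1 \<triangleright> K' \<odot> S1 \<triangleleft> b \<odot> v1' \<triangleright> L \<odot> e1' \<triangleleft> t')
    = (k2 \<triangleright> E2' \<odot> \<theta>' \<triangleleft> a' \<odot> k1 \<triangleright> e1') \<triangleleft> t'"
proof -
  have th: "parr (\<theta> \<triangleleft> (a @ t)) (k1 @ v1 @ a @ t) (k2 @ v2 @ a @ t)"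
    using parr_pr[OF assms(5), of "a @ t"] assms(8) by simp
  have ne: "v1 @ a \<noteq> []" "v2 @ a \<noteq> []"
    using assms(3,4) pinv_path by blast+
  have M: "(k2 \<triangleright> (e2 \<odot> E2)) \<triangleleft> t \<odot> \<theta> \<triangleleft> (a @ t) \<odot> (k1 \<triangleright> (e1 \<odot> E1)) \<triangleleft> t = \<theta> \<triangleleft> (a @ t)"
    using pinvD(3)[OF assms(3)] pinvD(3)[OF assms(4)] ne th
    by (simp add: pl_pid pr_pid parr_id_left parr_id_right)
  have "k2 \<triangleright> (E2' \<triangleleft> t' \<odot> v2' \<triangleright> L' \<odot> S2 \<triangleleft> b \<odot> v2 \<triangleright> K \<odot> e2 \<triangleleft> t) \<odot>
      (k2 \<triangleright> E2 \<odot> \<theta> \<triangleleft> a \<odot> k1 \<triangleright> e1) \<triangleleft> t \<odot>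
      k1 \<triangleright> (E1 \<triangleleft> t \<odot> v1 \<triangleright> K' \<odot> S1 \<triangleleft> b \<odot> v1' \<triangleright> L \<odot> e1' \<triangleleft> t')
    = (k2 \<triangleright> E2') \<triangleleft> t' \<odot> ((k2 @ v2') \<triangleright> L' \<odot> ((k2 \<triangleright> S2) \<triangleleft> b \<odot> ((k2 @ v2) \<triangleright> K \<odot>
        ((k2 \<triangleright> (e2 \<odot> E2)) \<triangleleft> t \<odot> \<theta> \<triangleleft> (a @ t) \<odot> (k1 \<triangleright> (e1 \<odot> E1)) \<triangleleft> t)
        \<odot> (k1 @ v1) \<triangleright> K') \<odot> (k1 \<triangleright> S1) \<triangleleft> b) \<odot> (k1 @ v1') \<triangleright> L) \<odot> (k1 \<triangleright> e1') \<triangleleft> t'"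
    by (simp add: pdistr)
  also note M
  also have "(k2 @ v2) \<triangleright> K \<odot> \<theta> \<triangleleft> (a @ t) \<odot> (k1 @ v1) \<triangleright> K' = \<theta> \<triangleleft> (z @ b)"
    using conj_pr[OF assms(1,5)] assms(8) by simp
  also have "(k2 \<triangleright> S2) \<triangleleft> b \<odot> \<theta> \<triangleleft> (z @ b) \<odot> (k1 \<triangleright> S1) \<triangleleft> b = (k2 \<triangleright> S2 \<odot> \<theta> \<triangleleft> z \<odot> k1 \<triangleright> S1) \<triangleleft> b"
    by (simp add: pdistr)
  also have "\<dots> = \<theta>' \<triangleleft> (z' @ b)"
    unfolding eq by (simp add: pr_pr)
  also have "(k2 @ v2') \<triangleright> L' \<odot> \<theta>' \<triangleleft> (z' @ b) \<odot> (k1 @ v1') \<triangleright> L = \<theta>' \<triangleleft> (a' @ t')"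
    using conj_pr[OF pinv_sym[OF assms(2)] assms(6)] assms(9) by simp
  also have "(k2 \<triangleright> E2') \<triangleleft> t' \<odot> \<theta>' \<triangleleft> (a' @ t') \<odot> (k1 \<triangleright> e1') \<triangleleft> t'
    = (k2 \<triangleright> E2' \<odot> \<theta>' \<triangleleft> a' \<odot> k1 \<triangleright> e1') \<triangleleft> t'"
    by (simp add: pdistr)
  finally show ?thesis .
qed

text \<open>The central comparison of two sets of data, for equivalent representatives. The legs of
  the composite spans are the concatenations \<open>w1 @ u1\<close> and \<open>g @ h1\<close>, and
  likewise for index 2.\<close>

lemma whisker_peq:
  assumes hom: "phom w1 A1 A" "phom w2 A2 A" "phom f1 A1 B" "phom f2 A2 B" "phom u B' B" "phom g B' X"
      "phom u1 D1 A1" "phom h1 D1 B'" "phom u2 D2 A2" "phom h2 D2 B'"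
    and PWu: "inW u" "inW u1" "inW u2"
    and R: "pinv R1 r1 (f1 @ u1) (u @ h1)" "pinv R2 r2 (f2 @ u2) (u @ h2)"
    and v: "phom v1 A3 A1" "phom v2 A3 A2" "parr \<alpha> (w1 @ v1) (w2 @ v2)" "parr \<beta> (f1 @ v1) (f2 @ v2)"
    and v': "phom v1' A3' A1" "phom v2' A3' A2" "parr \<alpha>' (w1 @ v1') (w2 @ v2')" "parr \<beta>' (f1 @ v1') (f2 @ v2')"
    and eqv: "path_equiv w1 w2 f1 f2 (v1, v2, \<alpha>, \<beta>) (v1', v2', \<alpha>', \<beta>')"
    and d: "phom a D5 A3" "phom x D5 D1" "phom y D5 D2" "inW a"
      "pinv E1 e1 (v1 @ a) (u1 @ x)" "pinv E2 e2 (v2 @ a) (u2 @ y)"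
      "parr lam (h1 @ x) (h2 @ y)"
      "u \<triangleright> lam = R2 \<triangleleft> y \<odot> (f2 \<triangleright> E2 \<odot> \<beta> \<triangleleft> a \<odot> f1 \<triangleright> e1) \<odot> r1 \<triangleleft> x"
    and d': "phom a' D5' A3'" "phom x' D5' D1" "phom y' D5' D2" "inW a'"
      "pinv E1' e1' (v1' @ a') (u1 @ x')" "pinv E2' e2' (v2' @ a') (u2 @ y')"
      "parr lam' (h1 @ x') (h2 @ y')"
      "u \<triangleright> lam' = R2 \<triangleleft> y' \<odot> (f2 \<triangleright> E2' \<odot> \<beta>' \<triangleleft> a' \<odot> f1 \<triangleright> e1') \<odot> r1 \<triangleleft> x'"
  shows "path_equiv (w1 @ u1) (w2 @ u2) (g @ h1) (g @ h2)
      (x, y, w2 \<triangleright> E2 \<odot> \<alpha> \<triangleleft> a \<odot> w1 \<triangleright> e1, g \<triangleright> lam)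
      (x', y', w2 \<triangleright> E2' \<odot> \<alpha>' \<triangleleft> a' \<odot> w1 \<triangleright> e1', g \<triangleright> lam')"
proof -
  obtain z z' S1 T1 S2 T2 where z: "z \<noteq> []" "z' \<noteq> []"
      and S: "pinv S1 T1 (v1' @ z') (v1 @ z)" "pinv S2 T2 (v2 @ z) (v2' @ z')" "inW (w1 @ v1 @ z)"
      and e: "w2 \<triangleright> S2 \<odot> \<alpha> \<triangleleft> z \<odot> w1 \<triangleright> S1 = \<alpha>' \<triangleleft> z'"
        "f2 \<triangleright> S2 \<odot> \<beta> \<triangleleft> z \<odot> f1 \<triangleright> S1 = \<beta>' \<triangleleft> z'"
    using eqv unfolding path_equiv_def by auto
  obtain A4 where A4: "phom z A4 A3"
    using pinv_path(2)[OF S(1)] v(1) z by (auto simp: phom_def path_append)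
  have "phom (v1' @ z') A4 A1"
    using phom_pinv[OF S(1)] phom_append[OF A4 v(1)] by simp
  then have A4': "phom z' A4 A3'"
    using phom_appendD(1) v'(1) z by blast
  obtain p t0 Q Q' where p: "inW [p]" "path (z @ [p])" "path (a @ [t0])" "pinv Q Q' (z @ [p]) (a @ [t0])"
    using BF3_path[OF d(4), of z] A4 d(1) unfolding phom_def by metis
  have pz': "path (z' @ [p])"
    using p(2) A4 A4' by (auto simp: phom_def path_append)
  \<comment> \<open>The second square is built on \<open>z' @ [p]\<close> instead of
    \<open>z'\<close>, so that both comparisons end in the same restriction \<open>b\<close>; the
    first one is whiskered by \<open>q\<close> to match.\<close>
  obtain q t1 P P' where q: "inW [q]" "path ((z' @ [p]) @ [q])" "path (a' @ [t1])"
      "pinv P P' ((z' @ [p]) @ [q]) (a' @ [t1])"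
    using BF3_path[OF d'(4), of "z' @ [p]"] pz' A4' d'(1) unfolding phom_def
    by (metis append_is_Nil_conv hd_append2)
  define b where "b = [p, q]"
  define t where "t = [t0, q]"
  define t' where "t' = [t1]"
  have b0: "b \<noteq> []" "t \<noteq> []" "t' \<noteq> []"
    by (simp_all add: b_def t_def t'_def)
  have pb: "path (z' @ b)" "path (a' @ t')"
    using q(2,3) by (simp_all add: b_def t'_def)
  obtain A7 where A7: "phom b A7 A4"
    using pb A4' b0 by (auto simp: phom_def path_append)
  have PWb: "inW b"
    using inW_append[OF p(1) q(1)] A7 by (simp add: b_def phom_def)
  have L: "pinv P' P (a' @ t') (z' @ b)"
    using pinv_sym[OF q(4)] by (simp add: b_def t'_def)
  have zpq: "path ((z @ [p]) @ [q])"
    using phom_append[OF A7 A4] by (simp add: b_def phom_def)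
  have K: "pinv (Q' \<triangleleft> [q]) (Q \<triangleleft> [q]) (a @ t) (z @ b)"
    using pinv_sym[OF pinv_pr[OF p(4) zpq]] by (simp add: b_def t_def)
  have at: "phom (a @ t) A7 A3" "phom (a' @ t') A7 A3'"
    using phom_pinv[OF K] phom_pinv[OF L] phom_append[OF A7 A4] phom_append[OF A7 A4'] by blast+
  then have ht: "phom t A7 D5" "phom t' A7 D5'"
    using d(1) d'(1) b0 phom_appendD(1) by blast+
  \<comment> \<open>\<open>O1\<close> runs from \<open>u1 @ x' @ t'\<close> back through the second
    data, the given equivalence and the first data to \<open>u1 @ x @ t\<close>. \<open>O2\<close>
    runs the other way for index 2, as \<open>path_equiv\<close> demands. \<open>N1\<close> and
    \<open>N2\<close> are the inverses.\<close>
  define O1 where "O1 = E1 \<triangleleft> t \<odot> v1 \<triangleright> (Q \<triangleleft> [q]) \<odot> S1 \<triangleleft> b \<odot> v1' \<triangleright> P' \<odot> e1' \<triangleleft> t'"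
  define O2 where "O2 = E2' \<triangleleft> t' \<odot> v2' \<triangleright> P \<odot> S2 \<triangleleft> b \<odot> v2 \<triangleright> (Q' \<triangleleft> [q]) \<odot> e2 \<triangleleft> t"
  define N1 where "N1 = E1' \<triangleleft> t' \<odot> v1' \<triangleright> P \<odot> T1 \<triangleleft> b \<odot> v1 \<triangleright> (Q' \<triangleleft> [q]) \<odot> e1 \<triangleleft> t"
  define N2 where "N2 = E2 \<triangleleft> t \<odot> v2 \<triangleright> (Q \<triangleleft> [q]) \<odot> T2 \<triangleleft> b \<odot> v2' \<triangleright> P' \<odot> e2' \<triangleleft> t'"
  have hh: "phom (v1 @ a @ t) A7 A1" "phom (v1' @ a' @ t') A7 A1" "phom (v2 @ a @ t) A7 A2"
    "phom (v2' @ a' @ t') A7 A2" "phom (v1' @ z' @ b) A7 A1" "phom (v2' @ z' @ b) A7 A2"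
    "phom (v1 @ z @ b) A7 A1" "phom (v2 @ z @ b) A7 A2"
    "phom (u1 @ x @ t) A7 A1" "phom (u2 @ y @ t) A7 A2" "phom (u1 @ x' @ t') A7 A1" "phom (u2 @ y' @ t') A7 A2"
    using phom_append[OF at(1) v(1)] phom_append[OF at(2) v'(1)] phom_append[OF at(1) v(2)]
      phom_append[OF at(2) v'(2)] phom_append[OF phom_append[OF A7 A4'] v'(1)]
      phom_append[OF phom_append[OF A7 A4'] v'(2)] phom_append[OF phom_append[OF A7 A4] v(1)]
      phom_append[OF phom_append[OF A7 A4] v(2)]
      phom_append[OF phom_append[OF ht(1) d(2)] hom(7)] phom_append[OF phom_append[OF ht(1) d(3)] hom(9)]
      phom_append[OF phom_append[OF ht(2) d'(2)] hom(7)] phom_append[OF phom_append[OF ht(2) d'(3)] hom(9)]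
    by simp_all
  have pp: "path (v1 @ a @ t)" "path (v1' @ a' @ t')" "path (v2 @ a @ t)"
    "path (v2' @ a' @ t')" "path (v1' @ z' @ b)" "path (v2' @ z' @ b)"
    "path (v1 @ z @ b)" "path (v2 @ z @ b)"
    "path (u1 @ x @ t)" "path (u2 @ y @ t)" "path (u1 @ x' @ t')" "path (u2 @ y' @ t')"
    using hh by (simp_all add: phom_def)
  have O1: "pinv O1 N1 (u1 @ x' @ t') (u1 @ x @ t)"
  proof -
    have i: "pinv (E1 \<triangleleft> t) (e1 \<triangleleft> t) (v1 @ a @ t) (u1 @ x @ t)"
      "pinv (v1 \<triangleright> (Q \<triangleleft> [q])) (v1 \<triangleright> (Q' \<triangleleft> [q])) (v1 @ z @ b) (v1 @ a @ t)"
      "pinv (S1 \<triangleleft> b) (T1 \<triangleleft> b) (v1' @ z' @ b) (v1 @ z @ b)"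
      "pinv (v1' \<triangleright> P') (v1' \<triangleright> P) (v1' @ a' @ t') (v1' @ z' @ b)"
      "pinv (e1' \<triangleleft> t') (E1' \<triangleleft> t') (u1 @ x' @ t') (v1' @ a' @ t')"
      using pinv_pr[OF d(5), of t] pinv_pl[OF pinv_sym[OF K], of v1] pinv_pr[OF S(1), of b]
        pinv_pl[OF L, of v1'] pinv_pr[OF pinv_sym[OF d'(5)], of t'] pp by simp_all
    show ?thesis
      using pinv_pv[OF i(5) pinv_pv[OF i(4) pinv_pv[OF i(3) pinv_pv[OF i(2,1)]]]]
      by (simp add: O1_def N1_def pv_assoc)
  qed
  have O2: "pinv O2 N2 (u2 @ y @ t) (u2 @ y' @ t')"
  proof -
    have i: "pinv (E2' \<triangleleft> t') (e2' \<triangleleft> t') (v2' @ a' @ t') (u2 @ y' @ t')"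
      "pinv (v2' \<triangleright> P) (v2' \<triangleright> P') (v2' @ z' @ b) (v2' @ a' @ t')"
      "pinv (S2 \<triangleleft> b) (T2 \<triangleleft> b) (v2 @ z @ b) (v2' @ z' @ b)"
      "pinv (v2 \<triangleright> (Q' \<triangleleft> [q])) (v2 \<triangleright> (Q \<triangleleft> [q])) (v2 @ a @ t) (v2 @ z @ b)"
      "pinv (e2 \<triangleleft> t) (E2 \<triangleleft> t) (u2 @ y @ t) (v2 @ a @ t)"
      using pinv_pr[OF d'(6), of t'] pinv_pl[OF pinv_sym[OF L], of v2'] pinv_pr[OF S(2), of b]
        pinv_pl[OF K, of v2] pinv_pr[OF pinv_sym[OF d(6)], of t] pp by simp_all
    show ?thesis
      using pinv_pv[OF i(5) pinv_pv[OF i(4) pinv_pv[OF i(3) pinv_pv[OF i(2,1)]]]]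
      by (simp add: O2_def N2_def pv_assoc)
  qed
  have pk: "path (w1 @ v1 @ a @ t)" "path (w1 @ v1' @ z' @ b)" "path (f1 @ v1 @ a @ t)" "path (f1 @ v1' @ z' @ b)"
    using phom_append[OF hh(1) hom(1)] phom_append[OF hh(5) hom(1)] phom_append[OF hh(1) hom(3)]
      phom_append[OF hh(5) hom(3)] by (simp_all add: phom_def)
  define M where "M = w2 \<triangleright> E2 \<odot> \<alpha> \<triangleleft> a \<odot> w1 \<triangleright> e1"
  define M' where "M' = w2 \<triangleright> E2' \<odot> \<alpha>' \<triangleleft> a' \<odot> w1 \<triangleright> e1'"
  define F where "F = f2 \<triangleright> E2 \<odot> \<beta> \<triangleleft> a \<odot> f1 \<triangleright> e1"
  define F' where "F' = f2 \<triangleright> E2' \<odot> \<beta>' \<triangleleft> a' \<odot> f1 \<triangleright> e1'"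
  have eM: "w2 \<triangleright> O2 \<odot> M \<triangleleft> t \<odot> w1 \<triangleright> O1 = M' \<triangleleft> t'"
    unfolding O1_def O2_def M_def M'_def
    by (rule transport_conj[OF K L d(5,6) v(3) v'(3) e(1) pk(1,2)])
  have eF: "f2 \<triangleright> O2 \<odot> F \<triangleleft> t \<odot> f1 \<triangleright> O1 = F' \<triangleleft> t'"
    unfolding O1_def O2_def F_def F'_def
    by (rule transport_conj[OF K L d(5,6) v(4) v'(4) e(2) pk(3,4)])
  have xt: "phom (x @ t) A7 D1" "phom (x' @ t') A7 D1" "phom (y @ t) A7 D2" "phom (y' @ t') A7 D2"
    using phom_append[OF ht(1) d(2)] phom_append[OF ht(2) d'(2)] phom_append[OF ht(1) d(3)]
      phom_append[OF ht(2) d'(3)] by simp_all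
  then have xt0: "x @ t \<noteq> []" "x' @ t' \<noteq> []"
    by (simp_all add: phom_def)
  \<comment> \<open>Since \<open>u1\<close> is in \<open>W\<close>, BF4b writes a restriction of
    \<open>O1\<close> as a whiskering by \<open>u1\<close>.\<close>
  obtain s1 V V' where s1: "inW [s1]" "path ((x' @ t') @ [s1])" "pinv V V' ((x' @ t') @ [s1]) ((x @ t) @ [s1])"
      "O1 \<triangleleft> [s1] = u1 \<triangleright> V"
    using BF4b_path[OF PWu(2) O1 xt0(2,1)] by blast
  obtain A8 where A8: "phom [s1] A8 A7"
    using phom_exI[OF s1(2) xt(2)] by blast
  have "path ((u2 @ y @ t) @ [s1])"
    using phom_append[OF A8 hh(10)] by (simp add: phom_def)
  then have "pinv (O2 \<triangleleft> [s1]) (N2 \<triangleleft> [s1]) (u2 @ y @ t @ [s1]) (u2 @ y' @ t' @ [s1])"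
    using pinv_pr[OF O2, of "[s1]"] by simp
  \<comment> \<open>BF4b for \<open>u2\<close> is applied after the restriction along
    \<open>s1\<close>, so that one restriction \<open>s\<close> serves both cells; \<open>V\<close>
    is later restricted further along \<open>s2\<close>.\<close>
  then obtain s2 Y Y' where s2: "inW [s2]" "path ((y @ t @ [s1]) @ [s2])"
      "pinv Y Y' ((y @ t @ [s1]) @ [s2]) ((y' @ t' @ [s1]) @ [s2])" "(O2 \<triangleleft> [s1]) \<triangleleft> [s2] = u2 \<triangleright> Y"
    using BF4b_path[OF PWu(3), of "O2 \<triangleleft> [s1]" "N2 \<triangleleft> [s1]" "y @ t @ [s1]" "y' @ t' @ [s1]"] by auto
  define s where "s = [s1, s2]"
  have "path ((y @ t) @ s)"
    using s2(2) by (simp add: s_def)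
  then obtain A9 where A9: "phom s A9 A7"
    using phom_exI[of "y @ t" s, OF _ xt(3)] by (auto simp: s_def)
  have PWs: "inW s"
    using inW_append[OF s1(1) s2(1)] A9 by (simp add: s_def phom_def)
  have xts: "phom (x @ t @ s) A9 D1" "phom (x' @ t' @ s) A9 D1" "phom (y @ t @ s) A9 D2" "phom (y' @ t' @ s) A9 D2"
    using phom_append[OF A9 xt(1)] phom_append[OF A9 xt(2)] phom_append[OF A9 xt(3)] phom_append[OF A9 xt(4)]
    by simp_all
  define U where "U = V \<triangleleft> [s2]"
  have U: "pinv U (V' \<triangleleft> [s2]) (x' @ t' @ s) (x @ t @ s)" "O1 \<triangleleft> s = u1 \<triangleright> U"
  proof -
    show "pinv U (V' \<triangleleft> [s2]) (x' @ t' @ s) (x @ t @ s)"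
      using pinv_pr[OF s1(3), of "[s2]"] xts by (simp add: U_def s_def phom_def)
    have "O1 \<triangleleft> s = (O1 \<triangleleft> [s1]) \<triangleleft> [s2]"
      by (simp add: pr_pr s_def)
    then show "O1 \<triangleleft> s = u1 \<triangleright> U"
      by (simp add: s1(4) U_def pl_pr)
  qed
  have Y: "pinv Y Y' (y @ t @ s) (y' @ t' @ s)" "O2 \<triangleleft> s = u2 \<triangleright> Y"
    using s2(3,4) by (simp_all add: s_def pr_pr)
  \<comment> \<open>Restricted along \<open>s\<close>, the comparison cells have become
    \<open>u1 \<triangleright> U\<close> and \<open>u2 \<triangleright> Y\<close>. For mu this is
    already the required equation, up to one more restriction.\<close>
  have lift: "k2 \<triangleright> (u2 \<triangleright> Y) \<odot> Z \<triangleleft> (t @ s) \<odot> k1 \<triangleright> (u1 \<triangleright> U) = Z' \<triangleleft> (t' @ s)"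
    if "k2 \<triangleright> O2 \<odot> Z \<triangleleft> t \<odot> k1 \<triangleright> O1 = Z' \<triangleleft> t'" for k1 k2 Z Z'
    using arg_cong[OF that, of "\<lambda>Z. Z \<triangleleft> s"] by (simp add: pr_pv pl_pr pr_pr U(2) Y(2))
  \<comment> \<open>\<open>G\<close> and \<open>G'\<close> are the two sides of the equation for lam
    before whiskering with \<open>g\<close>.\<close>
  define G where "G = h2 \<triangleright> Y \<odot> lam \<triangleleft> (t @ s) \<odot> h1 \<triangleright> U"
  define G' where "G' = lam' \<triangleleft> (t' @ s)"
  have hts: "phom (h1 @ x @ t @ s) A9 B'" "phom (h1 @ x' @ t' @ s) A9 B'" "phom (h2 @ y @ t @ s) A9 B'"
    "phom (h2 @ y' @ t' @ s) A9 B'"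
    using phom_append[OF xts(1) hom(8)] phom_append[OF xts(2) hom(8)] phom_append[OF xts(3) hom(10)]
      phom_append[OF xts(4) hom(10)] by simp_all
  have pts: "path (h1 @ x @ t @ s)" "path (h1 @ x' @ t' @ s)" "path (h2 @ y @ t @ s)" "path (h2 @ y' @ t' @ s)"
    using hts by (simp_all add: phom_def)
  have puts: "path (u @ h1 @ x' @ t' @ s)" "path (f1 @ u1 @ x' @ t' @ s)" "path (f2 @ u2 @ y @ t @ s)"
    "path (u @ h1 @ x @ t @ s)" "path (w1 @ u1 @ x @ t @ s)" "path (w1 @ u1 @ x @ t)"
    using phom_append[OF hts(2) hom(5)] phom_append[OF phom_append[OF xts(2) hom(7)] hom(3)]
      phom_append[OF phom_append[OF xts(3) hom(9)] hom(4)] phom_append[OF hts(1) hom(5)]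
      phom_append[OF phom_append[OF xts(1) hom(7)] hom(1)] phom_append[OF phom_append[OF xt(1) hom(7)] hom(1)]
    by (simp_all add: phom_def)
  have G: "parr G (h1 @ x' @ t' @ s) (h2 @ y' @ t' @ s)"
    unfolding G_def
    using parr_pl[OF pinvD(1)[OF Y(1)], of h2] parr_pl[OF pinvD(1)[OF U(1)], of h1]
      parr_pr[OF d(7), of "t @ s"] pts by (auto intro: parr_pv)
  have G': "parr G' (h1 @ x' @ t' @ s) (h2 @ y' @ t' @ s)"
    unfolding G'_def using parr_pr[OF d'(7), of "t' @ s"] pts by simp
  \<comment> \<open>Expanding \<open>u \<triangleright> lam\<close> brings in \<open>R2\<close> and
    \<open>r1\<close>. Exchange moves them outwards past \<open>Y\<close> and \<open>U\<close>,
    which turns the whiskerings by \<open>u @ h2\<close> and \<open>u @ h1\<close> into whiskerings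
    by \<open>f2 @ u2\<close> and \<open>f1 @ u1\<close>; there \<open>lift[OF eF]\<close>
    applies.\<close>
  have uG: "u \<triangleright> G = u \<triangleright> G'"
  proof -
    have "u \<triangleright> G = ((u @ h2) \<triangleright> Y) \<odot> ((u \<triangleright> lam) \<triangleleft> (t @ s)) \<odot> ((u @ h1) \<triangleright> U)"
      by (simp add: G_def pdistr)
    also have "\<dots> = ((u @ h2) \<triangleright> Y \<odot> R2 \<triangleleft> (y @ t @ s)) \<odot> F \<triangleleft> (t @ s) \<odot> (r1 \<triangleleft> (x @ t @ s) \<odot> (u @ h1) \<triangleright> U)"
      unfolding d(8) F_def[symmetric] by (simp add: pr_pv pr_pr pv_assoc)
    also have "(u @ h2) \<triangleright> Y \<odot> R2 \<triangleleft> (y @ t @ s) = R2 \<triangleleft> (y' @ t' @ s) \<odot> (f2 @ u2) \<triangleright> Y"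
      using parr_exchange[OF pinvD(1)[OF R(2)] pinvD(1)[OF Y(1)]] puts by simp
    also have "r1 \<triangleleft> (x @ t @ s) \<odot> (u @ h1) \<triangleright> U = (f1 @ u1) \<triangleright> U \<odot> r1 \<triangleleft> (x' @ t' @ s)"
      using parr_exchange[OF pinvD(2)[OF R(1)] pinvD(1)[OF U(1)]] puts by simp
    also have "(R2 \<triangleleft> (y' @ t' @ s) \<odot> (f2 @ u2) \<triangleright> Y) \<odot> F \<triangleleft> (t @ s) \<odot> (f1 @ u1) \<triangleright> U \<odot> r1 \<triangleleft> (x' @ t' @ s)
      = R2 \<triangleleft> (y' @ t' @ s) \<odot> (f2 \<triangleright> (u2 \<triangleright> Y) \<odot> F \<triangleleft> (t @ s) \<odot> f1 \<triangleright> (u1 \<triangleright> U)) \<odot> r1 \<triangleleft> (x' @ t' @ s)"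
      by (simp add: pv_assoc pl_pl)
    also have "\<dots> = (u \<triangleright> lam') \<triangleleft> (t' @ s)"
      unfolding lift[OF eF] d'(8) F'_def[symmetric] by (simp add: pr_pv pr_pr pv_assoc)
    finally show ?thesis
      by (simp add: G'_def pl_pr)
  qed
  \<comment> \<open>Here \<open>u\<close> is removed, at the price of a last restriction along
    \<open>c\<close>.\<close>
  obtain c where c: "inW [c]" "path ((h1 @ x' @ t' @ s) @ [c])" "G \<triangleleft> [c] = G' \<triangleleft> [c]"
    using restrict_eq[OF PWu(1) G G' puts(1) uG] by blast
  obtain A10 where A10: "phom [c] A10 A9"
    using phom_exI[OF c(2) hts(2)] by blast
  define k where "k = t @ s @ [c]"
  define k' where "k' = t' @ s @ [c]"
  have kk: "k \<noteq> []" "k' \<noteq> []"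
    by (simp_all add: k_def k'_def)
  have pc: "path ((x' @ t' @ s) @ [c])" "path ((y @ t @ s) @ [c])" "path ((w1 @ u1 @ x @ t @ s) @ [c])"
    using phom_append[OF A10 xts(2)] phom_append[OF A10 xts(3)]
      phom_append[OF A10 phom_append[OF phom_append[OF xts(1) hom(7)] hom(1)]]
    by (simp_all add: phom_def)
  have 1: "pinv (U \<triangleleft> [c]) ((V' \<triangleleft> [s2]) \<triangleleft> [c]) (x' @ k') (x @ k)"
    using pinv_pr[OF U(1) pc(1)] by (simp add: k_def k'_def)
  have 2: "pinv (Y \<triangleleft> [c]) (Y' \<triangleleft> [c]) (y @ k) (y' @ k')"
    using pinv_pr[OF Y(1) pc(2)] by (simp add: k_def k'_def)
  \<comment> \<open>Membership passes from \<open>w1 @ v1 @ z\<close> to its restriction along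
    \<open>b\<close>, through \<open>K\<close> and \<open>E1\<close> to
    \<open>w1 @ u1 @ x @ t\<close>, and on to the restrictions along \<open>s\<close> and
    \<open>c\<close>; \<open>b\<close>, \<open>s\<close> and \<open>[c]\<close> are all in
    \<open>W\<close>.\<close>
  have 3: "inW ((w1 @ u1) @ x @ k)"
  proof -
    have a: "path (w1 @ v1 @ z @ b)" "path (w1 @ v1 @ a @ t)"
      using phom_append[OF hh(7) hom(1)] phom_append[OF hh(1) hom(1)] by (simp_all add: phom_def)
    then have "inW (w1 @ v1 @ z @ b)"
      using inW_append[OF S(3) PWb] by simp
    then have "inW (w1 @ v1 @ a @ t)"
      using inW_iso[OF _ pinv_pl[OF K, of "w1 @ v1"]] a by simp
    moreover have "pinv (w1 \<triangleright> (e1 \<triangleleft> t)) (w1 \<triangleright> (E1 \<triangleleft> t)) (w1 @ u1 @ x @ t) (w1 @ v1 @ a @ t)"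
      using pinv_pl[OF pinv_pr[OF pinv_sym[OF d(5)], of t], of w1] puts pp by simp
    ultimately have "inW (w1 @ u1 @ x @ t)"
      using inW_iso by blast
    then have "inW (w1 @ u1 @ x @ t @ s)"
      using inW_append[OF _ PWs] puts by fastforce
    then show ?thesis
      using inW_append[OF _ c(1) pc(3)] by (simp add: k_def)
  qed
  have 4: "(w2 @ u2) \<triangleright> (Y \<triangleleft> [c]) \<odot> M \<triangleleft> k \<odot> (w1 @ u1) \<triangleright> (U \<triangleleft> [c]) = M' \<triangleleft> k'"
    using arg_cong[OF lift[OF eM], of "\<lambda>Z. Z \<triangleleft> [c]"] by (simp add: pr_pv pl_pr pr_pr pl_pl k_def k'_def)
  \<comment> \<open>The equation between \<open>G\<close> and \<open>G'\<close> is now free of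
    \<open>u\<close>, so it may be whiskered by \<open>g\<close>.\<close>
  have 5: "(g @ h2) \<triangleright> (Y \<triangleleft> [c]) \<odot> (g \<triangleright> lam) \<triangleleft> k \<odot> (g @ h1) \<triangleright> (U \<triangleleft> [c]) = (g \<triangleright> lam') \<triangleleft> k'"
    using arg_cong[OF c(3), of "\<lambda>Z. g \<triangleright> Z"]
    by (simp add: G_def G'_def pdistr k_def k'_def)
  show ?thesis
    unfolding path_equiv_def prod.case M_def[symmetric] M'_def[symmetric]
    using 1 2 3 4 5 kk by blast
qed

subsection \<open>Comparison with the quintuples\<close>

text \<open>The inner pairs \<open>I1\<close>, \<open>i1\<close> and \<open>I2\<close>,
  \<open>i2\<close> cancel, and exchange moves \<open>S1\<close> and \<open>S2\<close> past
  \<open>J1\<close> and \<open>j2\<close>, which leaves the given equation surrounded by the primed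
  isomorphisms.\<close>

lemma path_equiv_conj_aux:
  assumes "pinv J1 j1 K1 k1" "pinv J2 j2 K2 k2" "pinv I1 i1 V1 v1" "pinv I2 i2 V2 v2"
    and "pinv S1 T1 (v1' @ z') (v1 @ z)" "pinv S2 T2 (v2 @ z) (v2' @ z')"
    and "parr \<theta> (k1 @ v1) (k2 @ v2)"
    and paths: "path (k1 @ v1 @ z)" "path (k1 @ v1' @ z')" "path (k2 @ v2 @ z)"
    and eq: "k2 \<triangleright> S2 \<odot> \<theta> \<triangleleft> z \<odot> k1 \<triangleright> S1 = \<theta>' \<triangleleft> z'"
  shows "K2 \<triangleright> (i2' \<triangleleft> z' \<odot> S2 \<odot> I2 \<triangleleft> z) \<odot> (K2 \<triangleright> i2 \<odot> j2 \<triangleleft> v2 \<odot> \<theta> \<odot> J1 \<triangleleft> v1 \<odot> K1 \<triangleright> I1) \<triangleleft> z \<odot>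
      K1 \<triangleright> (i1 \<triangleleft> z \<odot> S1 \<odot> I1' \<triangleleft> z')
    = (K2 \<triangleright> i2' \<odot> j2 \<triangleleft> v2' \<odot> \<theta>' \<odot> J1 \<triangleleft> v1' \<odot> K1 \<triangleright> I1') \<triangleleft> z'"
proof -
  note ne = pinv_path(3,4)[OF assms(1)] pinv_path(3,4)[OF assms(2)] pinv_path(3,4)[OF assms(3)]
    pinv_path(3,4)[OF assms(4)]
  have p1: "path (K1 @ v1 @ z)" "path (K1 @ v1' @ z')" "path (K2 @ v2 @ z)"
    using paths parrD(6)[OF pinvD(1)[OF assms(1)]] parrD(6)[OF pinvD(1)[OF assms(2)]] by simp_all
  have J: "parr (J1 \<triangleleft> (v1 @ z)) (K1 @ v1 @ z) (k1 @ v1 @ z)"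
    using parr_pr[OF pinvD(1)[OF assms(1)], of "v1 @ z"] p1 by simp
  have j: "parr (j2 \<triangleleft> (v2 @ z)) (k2 @ v2 @ z) (K2 @ v2 @ z)"
    using parr_pr[OF pinvD(2)[OF assms(2)], of "v2 @ z"] paths by simp
  have "K2 \<triangleright> (i2' \<triangleleft> z' \<odot> S2 \<odot> I2 \<triangleleft> z) \<odot> (K2 \<triangleright> i2 \<odot> j2 \<triangleleft> v2 \<odot> \<theta> \<odot> J1 \<triangleleft> v1 \<odot> K1 \<triangleright> I1) \<triangleleft> z \<odot>
      K1 \<triangleright> (i1 \<triangleleft> z \<odot> S1 \<odot> I1' \<triangleleft> z')
    = K2 \<triangleright> (i2' \<triangleleft> z') \<odot> K2 \<triangleright> S2 \<odot> ((K2 \<triangleright> (I2 \<odot> i2)) \<triangleleft> z \<odot> j2 \<triangleleft> (v2 @ z)) \<odot> \<theta> \<triangleleft> z \<odot>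
      (J1 \<triangleleft> (v1 @ z) \<odot> (K1 \<triangleright> (I1 \<odot> i1)) \<triangleleft> z) \<odot> K1 \<triangleright> S1 \<odot> K1 \<triangleright> (I1' \<triangleleft> z')"
    by (simp add: pdistr)
  also have "(K2 \<triangleright> (I2 \<odot> i2)) \<triangleleft> z \<odot> j2 \<triangleleft> (v2 @ z) = j2 \<triangleleft> (v2 @ z)"
    using pinvD(4)[OF assms(4)] ne j by (simp add: pl_pid pr_pid parr_id_left)
  also have "J1 \<triangleleft> (v1 @ z) \<odot> (K1 \<triangleright> (I1 \<odot> i1)) \<triangleleft> z = J1 \<triangleleft> (v1 @ z)"
    using pinvD(4)[OF assms(3)] ne J by (simp add: pl_pid pr_pid parr_id_right)
  also have "K2 \<triangleright> (i2' \<triangleleft> z') \<odot> K2 \<triangleright> S2 \<odot> j2 \<triangleleft> (v2 @ z) \<odot> \<theta> \<triangleleft> z \<odot>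
      J1 \<triangleleft> (v1 @ z) \<odot> K1 \<triangleright> S1 \<odot> K1 \<triangleright> (I1' \<triangleleft> z')
    = K2 \<triangleright> (i2' \<triangleleft> z') \<odot> (K2 \<triangleright> S2 \<odot> j2 \<triangleleft> (v2 @ z)) \<odot> \<theta> \<triangleleft> z \<odot>
      (J1 \<triangleleft> (v1 @ z) \<odot> K1 \<triangleright> S1) \<odot> K1 \<triangleright> (I1' \<triangleleft> z')"
    by (simp add: pv_assoc)
  also have "K2 \<triangleright> S2 \<odot> j2 \<triangleleft> (v2 @ z) = j2 \<triangleleft> (v2' @ z') \<odot> k2 \<triangleright> S2"
    using parr_exchange[OF pinvD(2)[OF assms(2)] pinvD(1)[OF assms(6)]] paths by simp
  also have "J1 \<triangleleft> (v1 @ z) \<odot> K1 \<triangleright> S1 = k1 \<triangleright> S1 \<odot> J1 \<triangleleft> (v1' @ z')"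
    using parr_exchange[OF pinvD(1)[OF assms(1)] pinvD(1)[OF assms(5)]] p1 by simp
  also have "K2 \<triangleright> (i2' \<triangleleft> z') \<odot> (j2 \<triangleleft> (v2' @ z') \<odot> k2 \<triangleright> S2) \<odot> \<theta> \<triangleleft> z \<odot>
      (k1 \<triangleright> S1 \<odot> J1 \<triangleleft> (v1' @ z')) \<odot> K1 \<triangleright> (I1' \<triangleleft> z')
    = K2 \<triangleright> (i2' \<triangleleft> z') \<odot> j2 \<triangleleft> (v2' @ z') \<odot> (k2 \<triangleright> S2 \<odot> \<theta> \<triangleleft> z \<odot>
      k1 \<triangleright> S1) \<odot> J1 \<triangleleft> (v1' @ z') \<odot> K1 \<triangleright> (I1' \<triangleleft> z')"
    by (simp add: pv_assoc)
  also note eq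
  finally show ?thesis
    by (simp add: pdistr)
qed

text \<open>Equivalence is invariant under replacing the legs of the spans and of the
  representatives by isomorphic lists. With flattenings for these isomorphisms it passes from
  concatenated legs to the composite 1-morphisms of the fractions.\<close>

lemma path_equiv_conj:
  assumes hom: "phom w1 A1 A" "phom w2 A2 A" "phom f1 A1 B" "phom f2 A2 B"
      "phom v1 A3 A1" "phom v2 A3 A2" "phom v1' A3' A1" "phom v2' A3' A2"
    and J: "pinv J1 j1 W1 w1" "pinv J2 j2 W2 w2" "pinv H1 i1 F1 f1" "pinv H2 i2 F2 f2"
    and I: "pinv I1 l1 V1 v1" "pinv I2 l2 V2 v2" "pinv I1' l1' V1' v1'" "pinv I2' l2' V2' v2'"
    and p: "parr \<alpha> (w1 @ v1) (w2 @ v2)" "parr \<beta> (f1 @ v1) (f2 @ v2)"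
    and e: "path_equiv w1 w2 f1 f2 (v1, v2, \<alpha>, \<beta>) (v1', v2', \<alpha>', \<beta>')"
  shows "path_equiv W1 W2 F1 F2
    (V1, V2, W2 \<triangleright> l2 \<odot> j2 \<triangleleft> v2 \<odot> \<alpha> \<odot> J1 \<triangleleft> v1 \<odot> W1 \<triangleright> I1, F2 \<triangleright> l2 \<odot> i2 \<triangleleft> v2 \<odot> \<beta> \<odot> H1 \<triangleleft> v1 \<odot> F1 \<triangleright> I1)
    (V1', V2', W2 \<triangleright> l2' \<odot> j2 \<triangleleft> v2' \<odot> \<alpha>' \<odot> J1 \<triangleleft> v1' \<odot> W1 \<triangleright> I1',
      F2 \<triangleright> l2' \<odot> i2 \<triangleleft> v2' \<odot> \<beta>' \<odot> H1 \<triangleleft> v1' \<odot> F1 \<triangleright> I1')"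
proof -
  obtain z z' S1 T1 S2 T2 where z: "z \<noteq> []" "z' \<noteq> []"
      and S: "pinv S1 T1 (v1' @ z') (v1 @ z)" "pinv S2 T2 (v2 @ z) (v2' @ z')" "inW (w1 @ v1 @ z)"
      and e: "w2 \<triangleright> S2 \<odot> \<alpha> \<triangleleft> z \<odot> w1 \<triangleright> S1 = \<alpha>' \<triangleleft> z'"
        "f2 \<triangleright> S2 \<odot> \<beta> \<triangleleft> z \<odot> f1 \<triangleright> S1 = \<beta>' \<triangleleft> z'"
    using e unfolding path_equiv_def by auto
  obtain A4 where A4: "phom z A4 A3"
    using phom_exI[OF pinv_path(2)[OF S(1)] hom(5) z(1)] by blast
  have vz: "phom (v1 @ z) A4 A1" "phom (v2 @ z) A4 A2"
    using phom_append[OF A4] hom by blast+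
  have vz': "phom (v1' @ z') A4 A1" "phom (v2' @ z') A4 A2"
    using vz phom_pinv[OF S(1)] phom_pinv[OF S(2)] by blast+
  have VZ: "phom (V1 @ z) A4 A1" "phom (V2 @ z) A4 A2"
    using phom_append[OF A4] hom phom_pinv[OF I(1)] phom_pinv[OF I(2)] by blast+
  have A4': "phom z' A4 A3'"
    using phom_appendD(1)[OF vz'(1) hom(7)] z by blast
  have VZ': "phom (V1' @ z') A4 A1" "phom (V2' @ z') A4 A2"
    using phom_append[OF A4'] hom phom_pinv[OF I(3)] phom_pinv[OF I(4)] by blast+
  note paths = vz vz' VZ VZ' phom_append[OF vz(1) hom(1)] phom_append[OF vz'(1) hom(1)]
    phom_append[OF vz(2) hom(2)] phom_append[OF vz(1) hom(3)] phom_append[OF vz'(1) hom(3)]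
    phom_append[OF vz(2) hom(4)] phom_append[OF VZ(1) hom(1)]
  have P: "path (V1' @ z')" "path (V1 @ z)" "path (V2 @ z)" "path (V2' @ z')" "path (w1 @ v1 @ z)"
    "path (w1 @ v1' @ z')" "path (w2 @ v2 @ z)" "path (f1 @ v1 @ z)" "path (f1 @ v1' @ z')" "path (f2 @ v2 @ z)"
    "path (W1 @ V1 @ z)" "path (v1 @ z)" "path (v2' @ z')" "path (w1 @ V1 @ z)"
    using paths parrD(6)[OF pinvD(1)[OF J(1)], of "V1 @ z"] by (simp_all add: phom_def)
  have 1: "pinv (l1 \<triangleleft> z \<odot> S1 \<odot> I1' \<triangleleft> z') (l1' \<triangleleft> z' \<odot> T1 \<odot> I1 \<triangleleft> z) (V1' @ z') (V1 @ z)"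
    using pinv_pv[OF pinv_pv[OF pinv_pr[OF I(3) P(1)] S(1)] pinv_sym[OF pinv_pr[OF I(1) P(2)]]]
    by (simp add: pv_assoc)
  have 2: "pinv (l2' \<triangleleft> z' \<odot> S2 \<odot> I2 \<triangleleft> z) (l2 \<triangleleft> z \<odot> T2 \<odot> I2' \<triangleleft> z') (V2 @ z) (V2' @ z')"
    using pinv_pv[OF pinv_pv[OF pinv_pr[OF I(2) P(3)] S(2)] pinv_sym[OF pinv_pr[OF I(4) P(4)]]]
    by (simp add: pv_assoc)
  have "inW (w1 @ V1 @ z)"
    using inW_iso[OF S(3) pinv_pl[OF pinv_pr[OF I(1) P(2)] P(14)]] .
  then have 3: "inW (W1 @ V1 @ z)"
    using inW_iso[OF _ pinv_pr[OF J(1), of "V1 @ z"]] P by simp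
  show ?thesis
    unfolding path_equiv_def prod.case
    by (intro exI conjI)
      (rule z 1 2 3 path_equiv_conj_aux[OF J(1,2) I(1,2) S(1,2) p(1) P(5-7) e(1)]
        path_equiv_conj_aux[OF J(3,4) I(1,2) S(1,2) p(2) P(8-10) e(2)])+
qed

section \<open>Passage between \<open>frac_equiv\<close> and \<open>path_equiv\<close>\<close>

definition rep_path where
  "rep_path w1 w2 f1 f2 = (\<lambda>(A3, v1, v2, \<alpha>, \<beta>).
    ([v1], [v2], ([w1, v1], \<alpha>, [w2, v2]), ([f1, v1], \<beta>, [f2, v2])))"

lemma phom_single: "phom [f] A B \<longleftrightarrow> f \<in> Hom C A B"
  by (auto simp: phom_def Hom_def)

lemma path_rep_rep_path:
  assumes "(A1, w1, f1) \<in> frac_Hom C W A B" "(A2, w2, f2) \<in> frac_Hom C W A B"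
    and "(A3, v1, v2, \<alpha>, \<beta>) \<in> frac_reps C W (A1, w1, f1) (A2, w2, f2)"
  shows "path_rep A B [w1] [w2] [f1] [f2] (rep_path w1 w2 f1 f2 (A3, v1, v2, \<alpha>, \<beta>))"
proof -
  have h: "w1 \<in> W" "w2 \<in> W" "phom [w1] A1 A" "phom [w2] A2 A" "phom [f1] A1 B" "phom [f2] A2 B"
    "phom [v1] A3 A1" "phom [v2] A3 A2" "w1 \<cdot> v1 \<in> W" "\<alpha> \<in> Isos C (w1 \<cdot> v1) (w2 \<cdot> v2)"
    "\<beta> \<in> Cells C (f1 \<cdot> v1) (f2 \<cdot> v2)"
    using assms by (auto simp: frac_Hom_def frac_reps_def phom_single)
  then have p: "path [w1, v1]" "path [w2, v2]" "path [f1, v1]" "path [f2, v2]"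
    by (auto simp: phom_def)
  have "pinv ([w1, v1], \<alpha>, [w2, v2]) ([w2, v2], inv2 C \<alpha>, [w1, v1]) [w1, v1] [w2, v2]"
    using h p by (intro pinv_triple) auto
  moreover have "parr ([f1, v1], \<beta>, [f2, v2]) [f1, v1] [f2, v2]"
    using h p by (auto simp: parr_triple)
  ultimately show ?thesis
    unfolding rep_path_def path_rep_def prod.case using h p
    by (intro exI[of _ A1] exI[of _ A2] exI[of _ A3] exI conjI) (auto simp: inW_def phom_def)
qed

text \<open>Identifies the left-hand sides of the two equations in \<open>frac_equiv\<close> with
  list pastings; \<theta> stands for \<alpha> or \<beta>.\<close>

lemma whisker_triple:
  assumes "parr ([k1, v1], \<theta>, [k2, v2]) [k1, v1] [k2, v2]"
    and "parr ([v1', z'], \<sigma>1, [v1, z]) [v1', z'] [v1, z]" "parr ([v2, z], \<sigma>2, [v2', z']) [v2, z] [v2', z']"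
    and "path [k1, v1, z]" "path [k1, v1', z']"
  shows "[k2] \<triangleright> ([v2, z], \<sigma>2, [v2', z']) \<odot> ([k1, v1], \<theta>, [k2, v2]) \<triangleleft> [z] \<odot> [k1] \<triangleright> ([v1', z'], \<sigma>1, [v1, z])
    = ([k1, v1', z'], (k2 \<rhd> \<sigma>2) \<bullet> rw C k1 v1 k2 v2 \<theta> z \<bullet> (k1 \<rhd> \<sigma>1), [k2, v2', z'])"
proof -
  have t: "parr (([k1, v1], \<theta>, [k2, v2]) \<triangleleft> [z]) [k1, v1, z] [k2, v2, z]"
    "parr ([k1] \<triangleright> ([v1', z'], \<sigma>1, [v1, z])) [k1, v1', z'] [k1, v1, z]"
    using parr_pr[OF assms(1), of "[z]"] parr_pl[OF assms(2), of "[k1]"] assms(4,5) by simp_all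
  have p2: "path [k2, v2, z]"
    using parrD(2)[OF t(1)] .
  then have t3: "parr ([k2] \<triangleright> ([v2, z], \<sigma>2, [v2', z'])) [k2, v2, z] [k2, v2', z']"
    using parr_pl[OF assms(3), of "[k2]"] by simp
  have e: "([k1, v1], \<theta>, [k2, v2]) \<triangleleft> [z] = ([k1, v1, z], rw C k1 v1 k2 v2 \<theta> z, [k2, v2, z])"
    "[k1] \<triangleright> ([v1', z'], \<sigma>1, [v1, z]) = ([k1, v1', z'], k1 \<rhd> \<sigma>1, [k1, v1, z])"
    "[k2] \<triangleright> ([v2, z], \<sigma>2, [v2', z']) = ([k2, v2, z], k2 \<rhd> \<sigma>2, [k2, v2', z'])"
    using pr_triple[OF assms(1), of "[z]"] pl_triple[OF assms(2)] pl_triple[OF assms(3)] assms(4,5) p2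
    by simp_all
  have a: "parr (([k1, v1, z], rw C k1 v1 k2 v2 \<theta> z, [k2, v2, z]) \<odot> ([k1, v1', z'], k1 \<rhd> \<sigma>1, [k1, v1, z]))
      [k1, v1', z'] [k2, v2, z]"
    using parr_pv t unfolding e by blast
  show ?thesis
    using a t t3 unfolding e by (simp add: pv_triple)
qed

text \<open>The restrictions in \<open>path_equiv\<close> may be longer lists, while
  \<open>frac_equiv\<close> asks for single 1-morphisms. They are replaced by their composites, and
  \<open>S1\<close>, \<open>S2\<close> are conjugated by flattenings accordingly.\<close>

lemma frac_equivI:
  assumes F: "(A1, w1, f1) \<in> frac_Hom C W A B" "(A2, w2, f2) \<in> frac_Hom C W A B"
    and r: "(A3, v1, v2, \<alpha>, \<beta>) \<in> frac_reps C W (A1, w1, f1) (A2, w2, f2)"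
    and r': "(A3', v1', v2', \<alpha>', \<beta>') \<in> frac_reps C W (A1, w1, f1) (A2, w2, f2)"
    and e: "path_equiv [w1] [w2] [f1] [f2] (rep_path w1 w2 f1 f2 (A3, v1, v2, \<alpha>, \<beta>))
      (rep_path w1 w2 f1 f2 (A3', v1', v2', \<alpha>', \<beta>'))"
  shows "((A3, v1, v2, \<alpha>, \<beta>), (A3', v1', v2', \<alpha>', \<beta>')) \<in> frac_equiv C W (A1, w1, f1) (A2, w2, f2)"
proof -
  let ?\<alpha> = "([w1, v1], \<alpha>, [w2, v2])" and ?\<beta> = "([f1, v1], \<beta>, [f2, v2])"
  let ?\<alpha>' = "([w1, v1'], \<alpha>', [w2, v2'])" and ?\<beta>' = "([f1, v1'], \<beta>', [f2, v2'])"
  have h: "phom [w1] A1 A" "phom [w2] A2 A" "phom [f1] A1 B" "phom [f2] A2 B"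
    "phom [v1] A3 A1" "phom [v2] A3 A2" "phom [v1'] A3' A1" "phom [v2'] A3' A2"
    using F r r' by (auto simp: frac_Hom_def frac_reps_def phom_single)
  have t: "parr ?\<alpha> ([w1] @ [v1]) ([w2] @ [v2])" "parr ?\<beta> ([f1] @ [v1]) ([f2] @ [v2])"
    "parr ?\<alpha>' ([w1] @ [v1']) ([w2] @ [v2'])" "parr ?\<beta>' ([f1] @ [v1']) ([f2] @ [v2'])"
    using path_rep_rep_path[OF F r] path_rep_rep_path[OF F r'] by (auto simp: path_rep_def rep_path_def pinv_def)
  obtain z z' S1 T1 S2 T2 where z: "z \<noteq> []" "z' \<noteq> []"
      and S: "pinv S1 T1 ([v1'] @ z') ([v1] @ z)" "pinv S2 T2 ([v2] @ z) ([v2'] @ z')" "inW ([w1] @ [v1] @ z)"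
      and e: "[w2] \<triangleright> S2 \<odot> ?\<alpha> \<triangleleft> z \<odot> [w1] \<triangleright> S1 = ?\<alpha>' \<triangleleft> z'"
        "[f2] \<triangleright> S2 \<odot> ?\<beta> \<triangleleft> z \<odot> [f1] \<triangleright> S1 = ?\<beta>' \<triangleleft> z'"
    using e unfolding path_equiv_def rep_path_def prod.case by blast
  obtain A4 where A4: "phom z A4 A3"
    using phom_exI[OF pinv_path(2)[OF S(1)] h(5) z(1)] by blast
  have A4': "phom z' A4 A3'"
    using phom_append[OF A4 h(5)] phom_pinv[OF S(1)] phom_appendD(1)[OF _ h(7) z(2)] by blast
  have cz: "phom [rcomp z] A4 A3" "phom [rcomp z'] A4 A3'"
    using A4 A4' by (auto simp: phom_def)
  have zz: "path z" "path z'"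
    using A4 A4' by (auto simp: phom_def)
  note fz = pinv_flat[OF zz(1) z(1)] and fz' = pinv_flat[OF zz(2) z(2)]
  have P: "path ([v1] @ z)" "path ([v2] @ z)" "path ([v1'] @ z')" "path ([v2'] @ z')"
    "path ([v1] @ [rcomp z])" "path ([v2] @ [rcomp z])" "path ([v1'] @ [rcomp z'])" "path ([v2'] @ [rcomp z'])"
    "path (([w1] @ [v1]) @ z)" "path (([f1] @ [v1]) @ z)" "path (([w1] @ [v1']) @ z')" "path (([f1] @ [v1']) @ z')"
    "path [w1, v1, rcomp z]" "path [f1, v1, rcomp z]" "path [w1, v1', rcomp z']" "path [f1, v1', rcomp z']"
    using h A4 A4' cz unfolding phom_def by (simp_all add: path_append path_Cons)
  define s1 where "s1 = [v1] \<triangleright> unflat z \<odot> S1 \<odot> [v1'] \<triangleright> flat z'"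
  define s2 where "s2 = [v2'] \<triangleright> unflat z' \<odot> S2 \<odot> [v2] \<triangleright> flat z"
  have s1: "pinv s1 ([v1'] \<triangleright> unflat z' \<odot> T1 \<odot> [v1] \<triangleright> flat z) [v1', rcomp z'] [v1, rcomp z]"
    using pinv_pv[OF pinv_pv[OF pinv_pl[OF fz', of "[v1']"] S(1)] pinv_sym[OF pinv_pl[OF fz, of "[v1]"]]] P
    by (simp add: s1_def pv_assoc)
  have s2: "pinv s2 ([v2] \<triangleright> unflat z \<odot> T2 \<odot> [v2'] \<triangleright> flat z') [v2, rcomp z] [v2', rcomp z']"
    using pinv_pv[OF pinv_pv[OF pinv_pl[OF fz, of "[v2]"] S(2)] pinv_sym[OF pinv_pl[OF fz', of "[v2']"]]] P
    by (simp add: s2_def pv_assoc)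
  have t12: "s1 = ([v1', rcomp z'], pval s1, [v1, rcomp z])" "s2 = ([v2, rcomp z], pval s2, [v2', rcomp z'])"
    using parrD(7-9)[OF pinvD(1)[OF s1]] parrD(7-9)[OF pinvD(1)[OF s2]] by (auto intro!: path_cell_eqI)
  \<comment> \<open>One statement for both equations, used with \<alpha> and with \<beta>. The
    flattenings of \<open>z\<close> inside \<open>s1\<close> and \<open>s2\<close> act on \<theta>
    by \<open>conj_pr\<close>, and those of \<open>z'\<close> act on \<theta>'.\<close>
  have key: "(k2 \<rhd> pval s2) \<bullet> rw C k1 v1 k2 v2 \<theta> (rcomp z) \<bullet> (k1 \<rhd> pval s1) = rw C k1 v1' k2 v2' \<theta>' (rcomp z')"
    if th: "parr ([k1, v1], \<theta>, [k2, v2]) ([k1] @ [v1]) ([k2] @ [v2])"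
      "parr ([k1, v1'], \<theta>', [k2, v2']) ([k1] @ [v1']) ([k2] @ [v2'])"
      and pk: "path (([k1] @ [v1]) @ z)" "path (([k1] @ [v1']) @ z')" "path [k1, v1, rcomp z]" "path [k1, v1', rcomp z']"
      and eq: "[k2] \<triangleright> S2 \<odot> ([k1, v1], \<theta>, [k2, v2]) \<triangleleft> z \<odot> [k1] \<triangleright> S1 = ([k1, v1'], \<theta>', [k2, v2']) \<triangleleft> z'"
    for k1 k2 \<theta> \<theta>'
  proof -
    let ?t = "([k1, v1], \<theta>, [k2, v2])" and ?t' = "([k1, v1'], \<theta>', [k2, v2'])"
    have "([k2] @ [v2]) \<triangleright> flat z \<odot> ?t \<triangleleft> [rcomp z] \<odot> ([k1] @ [v1]) \<triangleright> unflat z = ?t \<triangleleft> z"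
      using conj_pr[OF fz th(1)] pk by simp
    moreover have "([k2] @ [v2']) \<triangleright> unflat z' \<odot> ?t' \<triangleleft> z' \<odot> ([k1] @ [v1']) \<triangleright> flat z' = ?t' \<triangleleft> [rcomp z']"
      using conj_pr[OF pinv_sym[OF fz'] th(2)] pk by simp
    moreover have "[k2] \<triangleright> s2 \<odot> ?t \<triangleleft> [rcomp z] \<odot> [k1] \<triangleright> s1
      = ([k2] @ [v2']) \<triangleright> unflat z' \<odot> ([k2] \<triangleright> S2 \<odot> (([k2] @ [v2]) \<triangleright> flat z \<odot> ?t \<triangleleft> [rcomp z] \<odot>
          ([k1] @ [v1]) \<triangleright> unflat z) \<odot> [k1] \<triangleright> S1) \<odot> ([k1] @ [v1']) \<triangleright> flat z'"
      by (simp add: s1_def s2_def pdistr)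
    ultimately have "[k2] \<triangleright> s2 \<odot> ?t \<triangleleft> [rcomp z] \<odot> [k1] \<triangleright> s1 = ?t' \<triangleleft> [rcomp z']"
      using eq by simp
    moreover have "[k2] \<triangleright> s2 \<odot> ?t \<triangleleft> [rcomp z] \<odot> [k1] \<triangleright> s1
      = ([k1, v1', rcomp z'], (k2 \<rhd> pval s2) \<bullet> rw C k1 v1 k2 v2 \<theta> (rcomp z) \<bullet> (k1 \<rhd> pval s1), [k2, v2', rcomp z'])"
      using whisker_triple[of k1 v1 \<theta> k2 v2 v1' "rcomp z'" "pval s1" "rcomp z" "pval s2" v2']
        th(1) pk pinvD(1)[OF s1] pinvD(1)[OF s2] unfolding t12[symmetric] by simp
    moreover have "?t' \<triangleleft> [rcomp z'] = ([k1, v1', rcomp z'], rw C k1 v1' k2 v2' \<theta>' (rcomp z'), [k2, v2', rcomp z'])"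
      using pr_triple[of k1 v1' \<theta>' k2 v2' "[rcomp z']"] th(2) pk by simp
    ultimately show ?thesis
      by simp
  qed
  have "w1 \<cdot> (v1 \<cdot> rcomp z) \<in> W"
    using S(3) z by (simp add: inW_def rcomp_Cons)
  moreover have "pval s1 \<in> Isos C (v1' \<cdot> rcomp z') (v1 \<cdot> rcomp z)" "pval s2 \<in> Isos C (v2 \<cdot> rcomp z) (v2' \<cdot> rcomp z')"
    using pinv_Isos(1)[OF s1] pinv_Isos(1)[OF s2] by simp_all
  moreover have "rcomp z \<in> Hom C A4 A3" "rcomp z' \<in> Hom C A4 A3'"
    using cz by (simp_all add: phom_single)
  moreover note key[OF t(1,3) P(9,11,13,15) e(1)] key[OF t(2,4) P(10,12,14,16) e(2)]
  ultimately show ?thesis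
    unfolding frac_equiv_def using r r' by simp blast
qed

lemma frac_equivD:
  assumes F: "(A1, w1, f1) \<in> frac_Hom C W A B" "(A2, w2, f2) \<in> frac_Hom C W A B"
    and e: "((A3, v1, v2, \<alpha>, \<beta>), (A3', v1', v2', \<alpha>', \<beta>')) \<in> frac_equiv C W (A1, w1, f1) (A2, w2, f2)"
  shows "(A3, v1, v2, \<alpha>, \<beta>) \<in> frac_reps C W (A1, w1, f1) (A2, w2, f2)"
    "(A3', v1', v2', \<alpha>', \<beta>') \<in> frac_reps C W (A1, w1, f1) (A2, w2, f2)"
    "path_equiv [w1] [w2] [f1] [f2] (rep_path w1 w2 f1 f2 (A3, v1, v2, \<alpha>, \<beta>))
      (rep_path w1 w2 f1 f2 (A3', v1', v2', \<alpha>', \<beta>'))"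
proof -
  show r: "(A3, v1, v2, \<alpha>, \<beta>) \<in> frac_reps C W (A1, w1, f1) (A2, w2, f2)"
    "(A3', v1', v2', \<alpha>', \<beta>') \<in> frac_reps C W (A1, w1, f1) (A2, w2, f2)"
    using e by (auto simp: frac_equiv_def)
  obtain A4 z z' \<sigma>1 \<sigma>2 where z: "z \<in> Hom C A4 A3" "z' \<in> Hom C A4 A3'"
      "\<sigma>1 \<in> Isos C (v1' \<cdot> z') (v1 \<cdot> z)" "\<sigma>2 \<in> Isos C (v2 \<cdot> z) (v2' \<cdot> z')" "w1 \<cdot> (v1 \<cdot> z) \<in> W"
      "(w2 \<rhd> \<sigma>2) \<bullet> rw C w1 v1 w2 v2 \<alpha> z \<bullet> (w1 \<rhd> \<sigma>1) = rw C w1 v1' w2 v2' \<alpha>' z'"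
      "(f2 \<rhd> \<sigma>2) \<bullet> rw C f1 v1 f2 v2 \<beta> z \<bullet> (f1 \<rhd> \<sigma>1) = rw C f1 v1' f2 v2' \<beta>' z'"
    using e by (auto simp: frac_equiv_def)
  let ?\<alpha> = "([w1, v1], \<alpha>, [w2, v2])" and ?\<beta> = "([f1, v1], \<beta>, [f2, v2])"
  let ?\<alpha>' = "([w1, v1'], \<alpha>', [w2, v2'])" and ?\<beta>' = "([f1, v1'], \<beta>', [f2, v2'])"
  have t: "parr ?\<alpha> [w1, v1] [w2, v2]" "parr ?\<beta> [f1, v1] [f2, v2]"
    "parr ?\<alpha>' [w1, v1'] [w2, v2']" "parr ?\<beta>' [f1, v1'] [f2, v2']"
    using path_rep_rep_path[OF F r(1)] path_rep_rep_path[OF F r(2)] by (auto simp: path_rep_def rep_path_def pinv_def)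
  have P: "path [v1, z]" "path [v2, z]" "path [v1', z']" "path [v2', z']" "path [w1, v1, z]" "path [w1, v1', z']"
    "path [f1, v1, z]" "path [f1, v1', z']"
    using F r z by (auto simp: frac_Hom_def frac_reps_def Hom_def)
  let ?S1 = "([v1', z'], \<sigma>1, [v1, z])" and ?S2 = "([v2, z], \<sigma>2, [v2', z'])"
  have S: "pinv ?S1 ([v1, z], inv2 C \<sigma>1, [v1', z']) [v1', z'] [v1, z]"
    "pinv ?S2 ([v2', z'], inv2 C \<sigma>2, [v2, z]) [v2, z] [v2', z']"
    using z P by (auto intro!: pinv_triple)
  have "[w2] \<triangleright> ?S2 \<odot> ?\<alpha> \<triangleleft> [z] \<odot> [w1] \<triangleright> ?S1 = ?\<alpha>' \<triangleleft> [z']"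
    using whisker_triple[OF t(1) pinvD(1)[OF S(1)] pinvD(1)[OF S(2)]] pr_triple[OF t(3), of "[z']"] P z(6)
    by simp
  moreover have "[f2] \<triangleright> ?S2 \<odot> ?\<beta> \<triangleleft> [z] \<odot> [f1] \<triangleright> ?S1 = ?\<beta>' \<triangleleft> [z']"
    using whisker_triple[OF t(2) pinvD(1)[OF S(1)] pinvD(1)[OF S(2)]] pr_triple[OF t(4), of "[z']"] P z(7)
    by simp
  moreover have "inW ([w1] @ [v1] @ [z])"
    using z(5) P by (simp add: inW_def)
  ultimately show "path_equiv [w1] [w2] [f1] [f2] (rep_path w1 w2 f1 f2 (A3, v1, v2, \<alpha>, \<beta>))
      (rep_path w1 w2 f1 f2 (A3', v1', v2', \<alpha>', \<beta>'))"
    unfolding path_equiv_def rep_path_def prod.case using S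
    by (intro exI[of _ "[z]"] exI[of _ "[z']"] exI conjI) auto
qed

lemma frac_equiv_sym:
  assumes "(A1, w1, f1) \<in> frac_Hom C W A B" "(A2, w2, f2) \<in> frac_Hom C W A B"
    and "(r, r') \<in> frac_equiv C W (A1, w1, f1) (A2, w2, f2)"
  shows "(r', r) \<in> frac_equiv C W (A1, w1, f1) (A2, w2, f2)"
proof -
  obtain A3 v1 v2 \<alpha> \<beta> where r: "r = (A3, v1, v2, \<alpha>, \<beta>)"
    by (cases r)
  obtain A3' v1' v2' \<alpha>' \<beta>' where r': "r' = (A3', v1', v2', \<alpha>', \<beta>')"
    by (cases r')
  note d = frac_equivD[OF assms(1,2) assms(3)[unfolded r r']]
  show ?thesis
    unfolding r r'
    using frac_equivI[OF assms(1,2) d(2,1)] d(3) path_equiv_sym path_rep_rep_path[OF assms(1,2) d(1)]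
      path_rep_rep_path[OF assms(1,2) d(2)] unfolding rep_path_def by auto
qed

lemma frac_equiv_trans:
  assumes "(A1, w1, f1) \<in> frac_Hom C W A B" "(A2, w2, f2) \<in> frac_Hom C W A B"
    and "(r, r') \<in> frac_equiv C W (A1, w1, f1) (A2, w2, f2)"
    and "(r', r'') \<in> frac_equiv C W (A1, w1, f1) (A2, w2, f2)"
  shows "(r, r'') \<in> frac_equiv C W (A1, w1, f1) (A2, w2, f2)"
proof -
  obtain A3 v1 v2 \<alpha> \<beta> where r: "r = (A3, v1, v2, \<alpha>, \<beta>)"
    by (cases r)
  obtain A3' v1' v2' \<alpha>' \<beta>' where r': "r' = (A3', v1', v2', \<alpha>', \<beta>')"
    by (cases r')
  obtain A3'' v1'' v2'' \<alpha>'' \<beta>'' where r'': "r'' = (A3'', v1'', v2'', \<alpha>'', \<beta>'')"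
    by (cases r'')
  note d = frac_equivD[OF assms(1,2) assms(3)[unfolded r r']]
    frac_equivD[OF assms(1,2) assms(4)[unfolded r' r'']]
  note p = path_rep_rep_path[OF assms(1,2) d(1)] path_rep_rep_path[OF assms(1,2) d(2)]
    path_rep_rep_path[OF assms(1,2) d(5)]
  show ?thesis
    unfolding r r''
    using frac_equivI[OF assms(1,2) d(1,5)] path_equiv_trans p d(3,6) unfolding rep_path_def prod.case by blast
qed

section \<open>Associators as flattenings, and the pastings of (F8)-(F10) for lists\<close>

lemma flat2:
  assumes "path [f, g, h, k]"
  shows "flat [f, g] \<triangleleft> [h, k] \<odot> [f \<cdot> g] \<triangleright> flat [h, k] = ([f \<cdot> g, h \<cdot> k], assoc C f g (h \<cdot> k), [f, g, h, k])"
    and "[f \<cdot> g] \<triangleright> unflat [h, k] \<odot> unflat [f, g] \<triangleleft> [h, k]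
      = ([f, g, h, k], inv2 C (assoc C f g (h \<cdot> k)), [f \<cdot> g, h \<cdot> k])"
proof -
  have m: "f \<in> Mor C" "g \<in> Mor C" "h \<in> Mor C" "k \<in> Mor C" "src C f = trg C g" "src C g = trg C h"
    "src C h = trg C k"
    using assms by auto
  show "flat [f, g] \<triangleleft> [h, k] \<odot> [f \<cdot> g] \<triangleright> flat [h, k]
      = ([f \<cdot> g, h \<cdot> k], assoc C f g (h \<cdot> k), [f, g, h, k])"
    using m by (intro path_cell_eqI) (simp_all add: flat_def pv_type pl_type pr_type)
  show "[f \<cdot> g] \<triangleright> unflat [h, k] \<odot> unflat [f, g] \<triangleleft> [h, k]
      = ([f, g, h, k], inv2 C (assoc C f g (h \<cdot> k)), [f \<cdot> g, h \<cdot> k])"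
    using m by (intro path_cell_eqI) (simp_all add: unflat_def pv_type pl_type pr_type)
qed

text \<open>These are the composites of associators around \<kappa> in
  \<open>chosen_whisker_rep\<close>; they exhibit its last argument as a conjugate of
  \<kappa>.\<close>

lemma flat3:
  assumes "path [f, g, h, k]"
  shows "flat [f, g, h] \<triangleleft> [k] = ([f \<cdot> (g \<cdot> h), k], (f \<rhd> assoc C g h k) \<bullet> assoc C f (g \<cdot> h) k, [f, g, h, k])"
    and "unflat [f, g, h] \<triangleleft> [k] = ([f, g, h, k],
      inv2 C (assoc C f (g \<cdot> h) k) \<bullet> (f \<rhd> inv2 C (assoc C g h k)), [f \<cdot> (g \<cdot> h), k])"
proof -
  have m: "f \<in> Mor C" "g \<in> Mor C" "h \<in> Mor C" "k \<in> Mor C" "src C f = trg C g" "src C g = trg C h"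
    "src C h = trg C k"
    using assms by auto
  show "flat [f, g, h] \<triangleleft> [k] = ([f \<cdot> (g \<cdot> h), k], (f \<rhd> assoc C g h k) \<bullet> assoc C f (g \<cdot> h) k, [f, g, h, k])"
    using m by (intro path_cell_eqI) (simp_all add: flat_def pr_type)
  show "unflat [f, g, h] \<triangleleft> [k] = ([f, g, h, k],
      inv2 C (assoc C f (g \<cdot> h) k) \<bullet> (f \<rhd> inv2 C (assoc C g h k)), [f \<cdot> (g \<cdot> h), k])"
    using m by (intro path_cell_eqI) (simp_all add: unflat_def pr_type)
qed

text \<open>Value and type are delivered together, so that a long pasting can be evaluated factor by
  factor in a chain of facts.\<close>

lemma pv_parr_triple:
  assumes "B = (q, b, r)" "A = (p, a, q)" "parr A p q" "parr B q r"
  shows "B \<odot> A = (p, b \<bullet> a, r)" "parr (B \<odot> A) p r"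
  using assms pv_triple[of p a q b r] parr_pv[of A p q B r] by auto

lemma pl_parr_triple:
  assumes "A = (p, a, q)" "parr A p q" "path (k # p)"
  shows "[k] \<triangleright> A = (k # p, k \<rhd> a, k # q)" "parr ([k] \<triangleright> A) (k # p) (k # q)"
  using assms pl_triple[of p a q k] parr_pl[of A p q "[k]"] by auto

lemma pr_parr_triple:
  assumes "A = ([f, v], a, [f', v'])" "parr A [f, v] [f', v']" "r \<noteq> []" "path (f # v # r)"
  shows "A \<triangleleft> r = (f # v # r, rw C f v f' v' a (rcomp r), f' # v' # r)"
    "parr (A \<triangleleft> r) (f # v # r) (f' # v' # r)"
  using assms pr_triple[of f v a f' v' r] parr_pr[of A "[f, v]" "[f', v']" r] by auto

text \<open>The third square has lists \<open>p\<close> and \<open>q\<close> in place of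
  \<open>u7\<close> and \<open>u8\<close>, and their composites are inserted in
  \<open>transport\<close>. This covers a square given by single 1-morphisms and also the selected
  one, whose legs are the composites \<open>u7 \<cdot> p\<close> and
  \<open>u8 \<cdot> p\<close>.\<close>

lemma transport_path:
  fixes D3 D4 D5 :: 'o
  assumes th: "parr ([k1, v1], \<theta>, [k2, v2]) [k1, v1] [k2, v2]"
    and h1: "parr ([u1, u4], inv2 C \<eta>1, [v1, u3]) [u1, u4] [v1, u3]"
    and h2: "parr ([v2, u5], \<eta>2, [u2, u6]) [v2, u5] [u2, u6]"
    and h3: "parr (u3 # p, \<eta>3, u5 # q) (u3 # p) (u5 # q)"
    and pq: "p \<noteq> []" "q \<noteq> []"
    and paths: "path (k1 # u1 # u4 # p)" "path (k1 # v1 # u3 # p)" "path (k2 # v2 # u3 # p)"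
  defines "T \<equiv> transport C k1 v1 k2 v2 \<theta> u1 u2 (D3, u3, u4, \<eta>1) (D4, u5, u6, \<eta>2) (D5, rcomp p, rcomp q, \<eta>3)"
  shows "([k1, u1, u4] @ p, T, [k2, u2, u6] @ q)
    = [k2] \<triangleright> (([v2, u5], \<eta>2, [u2, u6]) \<triangleleft> q \<odot> [v2] \<triangleright> (u3 # p, \<eta>3, u5 # q)) \<odot>
      ([k1, v1], \<theta>, [k2, v2]) \<triangleleft> (u3 # p) \<odot> [k1] \<triangleright> (([u1, u4], inv2 C \<eta>1, [v1, u3]) \<triangleleft> p)"
    "parr ([k1, u1, u4] @ p, T, [k2, u2, u6] @ q) ([k1, u1, u4] @ p) ([k2, u2, u6] @ q)"
proof -
  let ?h1 = "([u1, u4], inv2 C \<eta>1, [v1, u3])" and ?h2 = "([v2, u5], \<eta>2, [u2, u6])"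
  let ?h3 = "(u3 # p, \<eta>3, u5 # q)" and ?t = "([k1, v1], \<theta>, [k2, v2])"
  have "path (k2 # v2 # u5 # q)"
    using parrD(5)[OF h3, of "[k2, v2]"] paths by simp
  then have P: "path (u1 # u4 # p)" "path (v2 # u3 # p)" "path (v2 # u5 # q)" "path (k2 # v2 # u5 # q)"
    using paths by auto
  note a = pr_parr_triple[OF refl h1 pq(1) P(1)]
  note b = pl_parr_triple[OF a paths(1)]
  note c = pr_parr_triple[OF refl th, of "u3 # p", OF _ paths(2)]
  note d = pl_parr_triple[OF refl h3 P(2)]
  note e = pl_parr_triple[OF d paths(3)]
  note f = pr_parr_triple[OF refl h2 pq(2) P(3)]
  note g = pl_parr_triple[OF f P(4)]
  have cc: "?t \<triangleleft> (u3 # p) = (k1 # v1 # u3 # p, rw C k1 v1 k2 v2 \<theta> (u3 \<cdot> rcomp p), k2 # v2 # u3 # p)"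
    "parr (?t \<triangleleft> (u3 # p)) (k1 # v1 # u3 # p) (k2 # v2 # u3 # p)"
    using c by (simp_all add: rcomp_Cons pq)
  note m = pv_parr_triple[OF cc(1) b(1,2) cc(2)]
  note n = pv_parr_triple[OF e(1) m(1,2) e(2)]
  note o = pv_parr_triple[OF g(1) n(1,2) g(2)]
  have T: "T = (k2 \<rhd> rw C v2 u5 u2 u6 \<eta>2 (rcomp q)) \<bullet> (k2 \<rhd> (v2 \<rhd> \<eta>3)) \<bullet>
      rw C k1 v1 k2 v2 \<theta> (u3 \<cdot> rcomp p) \<bullet> (k1 \<rhd> rw C u1 u4 v1 u3 (inv2 C \<eta>1) (rcomp p))"
    by (simp add: T_def transport_def)
  show "([k1, u1, u4] @ p, T, [k2, u2, u6] @ q)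
    = [k2] \<triangleright> (?h2 \<triangleleft> q \<odot> [v2] \<triangleright> ?h3) \<odot> ?t \<triangleleft> (u3 # p) \<odot> [k1] \<triangleright> (?h1 \<triangleleft> p)"
    using o(1) by (simp add: T pl_pv pv_assoc)
  then show "parr ([k1, u1, u4] @ p, T, [k2, u2, u6] @ q) ([k1, u1, u4] @ p) ([k2, u2, u6] @ q)"
    using o(2) by (simp add: pl_pv pv_assoc)
qed

text \<open>The pasting in (F10), grouped as \<open>whisker_peq\<close> expects it: the bracket in
  the middle is the transport of \<beta>, with \<eta>2 and \<eta>3 merged into one comparison
  cell.\<close>

lemma whisker_target_path:
  fixes A3 D1 D2 D3 D4 D5 :: 'o and \<alpha> :: 'c
  assumes th: "parr ([f1, v1], \<beta>, [f2, v2]) [f1, v1] [f2, v2]"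
    and h1: "parr ([u1, u4], inv2 C \<eta>1, [v1, u3]) [u1, u4] [v1, u3]"
    and h2: "parr ([v2, u5], \<eta>2, [u2, u6]) [v2, u5] [u2, u6]"
    and h3: "parr (u3 # p, \<eta>3, u5 # q) (u3 # p) (u5 # q)"
    and pq: "p \<noteq> []" "q \<noteq> []"
    and paths: "path (f1 # u1 # u4 # p)" "path (f1 # v1 # u3 # p)" "path (f2 # v2 # u3 # p)" "path (u # h1 # u4 # p)"
    and r1: "parr ([u, h1], inv2 C \<rho>1, [f1, u1]) [u, h1] [f1, u1]"
    and r2: "parr ([f2, u2], \<rho>2, [u, h2]) [f2, u2] [u, h2]"
  defines "T \<equiv> whisker_target C u f1 f2 (D1, u1, h1, \<rho>1) (D2, u2, h2, \<rho>2) (A3, v1, v2, \<alpha>, \<beta>)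
    (D3, u3, u4, \<eta>1) (D4, u5, u6, \<eta>2) (D5, rcomp p, rcomp q, \<eta>3)"
  shows "([u, h1, u4] @ p, T, [u, h2, u6] @ q)
    = ([f2, u2], \<rho>2, [u, h2]) \<triangleleft> (u6 # q) \<odot>
      ([f2] \<triangleright> (([v2, u5], \<eta>2, [u2, u6]) \<triangleleft> q \<odot> [v2] \<triangleright> (u3 # p, \<eta>3, u5 # q)) \<odot>
      ([f1, v1], \<beta>, [f2, v2]) \<triangleleft> (u3 # p) \<odot> [f1] \<triangleright> (([u1, u4], inv2 C \<eta>1, [v1, u3]) \<triangleleft> p)) \<odot>
      ([u, h1], inv2 C \<rho>1, [f1, u1]) \<triangleleft> (u4 # p)"
    "parr ([u, h1, u4] @ p, T, [u, h2, u6] @ q) ([u, h1, u4] @ p) ([u, h2, u6] @ q)"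
proof -
  define X where "X = transport C f1 v1 f2 v2 \<beta> u1 u2 (D3, u3, u4, \<eta>1) (D4, u5, u6, \<eta>2) (D5, rcomp p, rcomp q, \<eta>3)"
  note t = transport_path[OF th h1 h2 h3 pq paths(1-3), of D3 D4 D5, folded X_def]
  have tt: "parr (f1 # u1 # u4 # p, X, f2 # u2 # u6 # q) (f1 # u1 # u4 # p) (f2 # u2 # u6 # q)"
    using t(2) by simp
  note a = pr_parr_triple[OF refl r1, of "u4 # p", OF _ paths(4)]
  note b = pr_parr_triple[OF refl r2, of "u6 # q", OF _ parrD(2)[OF tt]]
  have a': "([u, h1], inv2 C \<rho>1, [f1, u1]) \<triangleleft> (u4 # p)
      = (u # h1 # u4 # p, rw C u h1 f1 u1 (inv2 C \<rho>1) (u4 \<cdot> rcomp p), f1 # u1 # u4 # p)"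
    "parr (([u, h1], inv2 C \<rho>1, [f1, u1]) \<triangleleft> (u4 # p)) (u # h1 # u4 # p) (f1 # u1 # u4 # p)"
    using a by (simp_all add: rcomp_Cons pq)
  have b': "([f2, u2], \<rho>2, [u, h2]) \<triangleleft> (u6 # q)
      = (f2 # u2 # u6 # q, rw C f2 u2 u h2 \<rho>2 (u6 \<cdot> rcomp q), u # h2 # u6 # q)"
    "parr (([f2, u2], \<rho>2, [u, h2]) \<triangleleft> (u6 # q)) (f2 # u2 # u6 # q) (u # h2 # u6 # q)"
    using b by (simp_all add: rcomp_Cons pq)
  note m = pv_parr_triple[OF refl a'(1,2) tt]
  note n = pv_parr_triple[OF b'(1) m(1,2) b'(2)]
  have T: "T = rw C f2 u2 u h2 \<rho>2 (u6 \<cdot> rcomp q) \<bullet> X \<bullet> rw C u h1 f1 u1 (inv2 C \<rho>1) (u4 \<cdot> rcomp p)"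
    by (simp add: T_def X_def whisker_target_def)
  have *: "([u, h1, u4] @ p, T, [u, h2, u6] @ q) = ([f2, u2], \<rho>2, [u, h2]) \<triangleleft> (u6 # q) \<odot>
      (f1 # u1 # u4 # p, X, f2 # u2 # u6 # q) \<odot> ([u, h1], inv2 C \<rho>1, [f1, u1]) \<triangleleft> (u4 # p)"
    using n(1) by (simp add: T)
  show "([u, h1, u4] @ p, T, [u, h2, u6] @ q)
    = ([f2, u2], \<rho>2, [u, h2]) \<triangleleft> (u6 # q) \<odot>
      ([f2] \<triangleright> (([v2, u5], \<eta>2, [u2, u6]) \<triangleleft> q \<odot> [v2] \<triangleright> (u3 # p, \<eta>3, u5 # q)) \<odot>
      ([f1, v1], \<beta>, [f2, v2]) \<triangleleft> (u3 # p) \<odot> [f1] \<triangleright> (([u1, u4], inv2 C \<eta>1, [v1, u3]) \<triangleleft> p)) \<odot>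
      ([u, h1], inv2 C \<rho>1, [f1, u1]) \<triangleleft> (u4 # p)"
    unfolding * t(1)[symmetric] by simp
  show "parr ([u, h1, u4] @ p, T, [u, h2, u6] @ q) ([u, h1, u4] @ p) ([u, h2, u6] @ q)"
    using n(2) unfolding * by simp
qed

lemma filled_square_path:
  assumes "filled_square C W f v (D, v', f', \<rho>)" "f \<in> Mor C" "v \<in> Mor C" "trg C f = trg C v"
  shows "inW [v']" "phom [v'] D (src C f)" "phom [f'] D (src C v)"
    "pinv ([f, v'], \<rho>, [v, f']) ([v, f'], inv2 C \<rho>, [f, v']) [f, v'] [v, f']"
proof -
  have 1: "v' \<in> W" "v' \<in> Hom C D (src C f)" "f' \<in> Hom C D (src C v)" "\<rho> \<in> Isos C (f \<cdot> v') (v \<cdot> f')"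
    using assms by (auto simp: filled_square_def)
  then have "path [f, v']" "path [v, f']"
    using assms by (auto simp: Hom_def)
  then show "inW [v']" "phom [v'] D (src C f)" "phom [f'] D (src C v)"
    "pinv ([f, v'], \<rho>, [v, f']) ([v, f'], inv2 C \<rho>, [f, v']) [f, v'] [v, f']"
    using 1 by (auto simp: inW_single phom_single intro!: pinv_triple)
qed

lemma filled_squareI:
  assumes "inW [v']" "phom [v'] D (src C f)" "phom [f'] D (src C v)" "\<rho> \<in> Isos C (f \<cdot> v') (v \<cdot> f')"
  shows "filled_square C W f v (D, v', f', \<rho>)"
  using assms by (auto simp: filled_square_def inW_single phom_single)

text \<open>
  The outer associators of \<^const>\<open>whisker_rep\<close> are conjugation by \<open>flat\<close>.
\<close>

lemma flat_conj:
  assumes T: "parr ([k1, u1, x1, y1], T, [k2, u2, x2, y2]) [k1, u1, x1, y1] [k2, u2, x2, y2]"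
  defines "X \<equiv> [k2 \<cdot> u2] \<triangleright> unflat [x2, y2] \<odot> unflat [k2, u2] \<triangleleft> [x2, y2] \<odot> ([k1, u1, x1, y1], T, [k2, u2, x2, y2])
      \<odot> flat [k1, u1] \<triangleleft> [x1, y1] \<odot> [k1 \<cdot> u1] \<triangleright> flat [x1, y1]"
  shows "X = ([k1 \<cdot> u1, x1 \<cdot> y1], inv2 C (assoc C k2 u2 (x2 \<cdot> y2)) \<bullet> T \<bullet> assoc C k1 u1 (x1 \<cdot> y1), [k2 \<cdot> u2, x2 \<cdot> y2])"
    "parr X [k1 \<cdot> u1, x1 \<cdot> y1] [k2 \<cdot> u2, x2 \<cdot> y2]"
    "pinv ([k1, u1, x1, y1], T, [k2, u2, x2, y2]) T' [k1, u1, x1, y1] [k2, u2, x2, y2] \<Longrightarrow>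
      \<exists>X'. pinv X X' [k1 \<cdot> u1, x1 \<cdot> y1] [k2 \<cdot> u2, x2 \<cdot> y2]"
proof -
  have P: "path [k1, u1, x1, y1]" "path [k2, u2, x2, y2]"
    using parrD(1,2)[OF T] .
  have P': "path ([k1, u1] @ [x1, y1])" "path ([k2, u2] @ [x2, y2])"
    using P by simp_all
  note f1 = flat2[OF P(1)] and f2 = flat2[OF P(2)]
  note i1 = pinv_flat2[OF P'(1), simplified] and i2 = pinv_flat2[OF P'(2), simplified]
  note a = pv_parr_triple[OF refl f1(1) pinvD(1)[OF i1] T]
  note b = pv_parr_triple[OF f2(2) a pinvD(2)[OF i2]]
  have X: "X = ([k2 \<cdot> u2] \<triangleright> unflat [x2, y2] \<odot> unflat [k2, u2] \<triangleleft> [x2, y2]) \<odot> ([k1, u1, x1, y1], T, [k2, u2, x2, y2])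
      \<odot> (flat [k1, u1] \<triangleleft> [x1, y1] \<odot> [k1 \<cdot> u1] \<triangleright> flat [x1, y1])"
    by (simp add: X_def pv_assoc)
  show "X = ([k1 \<cdot> u1, x1 \<cdot> y1], inv2 C (assoc C k2 u2 (x2 \<cdot> y2)) \<bullet> T \<bullet> assoc C k1 u1 (x1 \<cdot> y1), [k2 \<cdot> u2, x2 \<cdot> y2])"
    "parr X [k1 \<cdot> u1, x1 \<cdot> y1] [k2 \<cdot> u2, x2 \<cdot> y2]"
    using b unfolding X by simp_all
  show "\<exists>X'. pinv X X' [k1 \<cdot> u1, x1 \<cdot> y1] [k2 \<cdot> u2, x2 \<cdot> y2]"
    if "pinv ([k1, u1, x1, y1], T, [k2, u2, x2, y2]) T' [k1, u1, x1, y1] [k2, u2, x2, y2]"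
    using pinv_pv[OF pinv_pv[OF i1 that] pinv_sym[OF i2]] unfolding X by blast
qed

lemma frac_equivI':
  assumes "(A1, w1, f1) \<in> frac_Hom C W A B" "(A2, w2, f2) \<in> frac_Hom C W A B"
    and "r \<in> frac_reps C W (A1, w1, f1) (A2, w2, f2)" "r' \<in> frac_reps C W (A1, w1, f1) (A2, w2, f2)"
    and "path_equiv [w1] [w2] [f1] [f2] (rep_path w1 w2 f1 f2 r) (rep_path w1 w2 f1 f2 r')"
  shows "(r, r') \<in> frac_equiv C W (A1, w1, f1) (A2, w2, f2)"
proof (cases r; cases r')
  fix A3 v1 v2 \<alpha> \<beta> A3' v1' v2' \<alpha>' \<beta>'
  assume "r = (A3, v1, v2, \<alpha>, \<beta>)" "r' = (A3', v1', v2', \<alpha>', \<beta>')"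
  then show ?thesis
    using assms(3-5) frac_equivI[OF assms(1,2)] by simp
qed

end

section \<open>Whiskering in the bicategory of fractions\<close>

text \<open>The squares on \<open>(f1, u)\<close> and \<open>(f2, u)\<close> are arbitrary filled
  squares; inside the locale the choice functions appear only in
  \<open>chosen_whisker_data\<close>.\<close>

locale whisker_setting = BF C W for C :: "('o, 'm, 'c, 'x) bicat_scheme" (structure) and W +
  fixes A B X B' A1 A2 D1 D2 :: 'o and u g w1 f1 w2 f2 u1 h1 u2 h2 :: 'm and \<rho>1 \<rho>2 :: 'c
  assumes G: "(B', u, g) \<in> frac_Hom C W B X"
    and F1: "(A1, w1, f1) \<in> frac_Hom C W A B"
    and F2: "(A2, w2, f2) \<in> frac_Hom C W A B"
    and Q1: "filled_square C W f1 u (D1, u1, h1, \<rho>1)"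
    and Q2: "filled_square C W f2 u (D2, u2, h2, \<rho>2)"
begin

abbreviation "R1 \<equiv> ([f1, u1], \<rho>1, [u, h1])"
abbreviation "r1 \<equiv> ([u, h1], inv2 C \<rho>1, [f1, u1])"
abbreviation "R2 \<equiv> ([f2, u2], \<rho>2, [u, h2])"
abbreviation "r2 \<equiv> ([u, h2], inv2 C \<rho>2, [f2, u2])"

lemma homs:
  "phom [w1] A1 A" "phom [w2] A2 A" "phom [f1] A1 B" "phom [f2] A2 B" "phom [u] B' B" "phom [g] B' X"
  "inW [w1]" "inW [w2]" "inW [u]"
  using G F1 F2 by (auto simp: frac_Hom_def phom_single inW_single)

lemma squares:
  "phom [u1] D1 A1" "phom [h1] D1 B'" "phom [u2] D2 A2" "phom [h2] D2 B'" "inW [u1]" "inW [u2]"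
  "pinv R1 r1 ([f1] @ [u1]) ([u] @ [h1])" "pinv R2 r2 ([f2] @ [u2]) ([u] @ [h2])"
  using filled_square_path[OF Q1] filled_square_path[OF Q2] homs by (simp_all add: phom_def)

lemma comp_frac_Hom:
  "(D1, w1 \<cdot> u1, g \<cdot> h1) \<in> frac_Hom C W A X" "(D2, w2 \<cdot> u2, g \<cdot> h2) \<in> frac_Hom C W A X"
  using homs squares BF2[of u1 w1] BF2[of u2 w2]
  by (auto simp: frac_Hom_def phom_def inW_single Hom_def)

lemma repr_path:
  assumes "(A3, v1, v2, \<alpha>, \<beta>) \<in> frac_reps C W (A1, w1, f1) (A2, w2, f2)"
  shows "phom [v1] A3 A1" "phom [v2] A3 A2" "inW [w1, v1]"
    "pinv ([w1, v1], \<alpha>, [w2, v2]) ([w2, v2], inv2 C \<alpha>, [w1, v1]) [w1, v1] [w2, v2]"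
    "parr ([f1, v1], \<beta>, [f2, v2]) [f1, v1] [f2, v2]"
proof -
  have h: "phom [v1] A3 A1" "phom [v2] A3 A2" "w1 \<cdot> v1 \<in> W" "\<alpha> \<in> Isos C (w1 \<cdot> v1) (w2 \<cdot> v2)"
    "\<beta> \<in> Cells C (f1 \<cdot> v1) (f2 \<cdot> v2)"
    using assms by (auto simp: frac_reps_def phom_single)
  then have "path [w1, v1]" "path [w2, v2]" "path [f1, v1]" "path [f2, v2]"
    using homs by (auto simp: phom_def)
  then show "phom [v1] A3 A1" "phom [v2] A3 A2" "inW [w1, v1]"
    "pinv ([w1, v1], \<alpha>, [w2, v2]) ([w2, v2], inv2 C \<alpha>, [w1, v1]) [w1, v1] [w2, v2]"
    "parr ([f1, v1], \<beta>, [f2, v2]) [f1, v1] [f2, v2]"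
    using h by (auto simp: inW_def parr_triple intro!: pinv_triple)
qed

lemma squares_path:
  assumes r: "(A3, v1, v2, \<alpha>, \<beta>) \<in> frac_reps C W (A1, w1, f1) (A2, w2, f2)"
    and s: "filled_square C W v1 u1 (D3, u3, u4, \<eta>1)" "filled_square C W v2 u2 (D4, u5, u6, \<eta>2)"
      "filled_square C W u3 u5 (D5, u7, u8, \<eta>3)"
  shows "phom [u3] D3 A3" "phom [u4] D3 D1" "phom [u5] D4 A3" "phom [u6] D4 D2" "phom [u7] D5 D3" "phom [u8] D5 D4"
    "inW [u3]" "inW [u5]" "inW [u7]"
    "pinv ([v1, u3], \<eta>1, [u1, u4]) ([u1, u4], inv2 C \<eta>1, [v1, u3]) [v1, u3] [u1, u4]"
    "pinv ([v2, u5], \<eta>2, [u2, u6]) ([u2, u6], inv2 C \<eta>2, [v2, u5]) [v2, u5] [u2, u6]"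
    "pinv ([u3, u7], \<eta>3, [u5, u8]) ([u5, u8], inv2 C \<eta>3, [u3, u7]) [u3, u7] [u5, u8]"
proof -
  note v = repr_path(1,2)[OF r]
  note a = filled_square_path[OF s(1)] and b = filled_square_path[OF s(2)] and c = filled_square_path[OF s(3)]
  show *: "phom [u3] D3 A3" "phom [u4] D3 D1" "phom [u5] D4 A3" "phom [u6] D4 D2" "inW [u3]" "inW [u5]"
    "pinv ([v1, u3], \<eta>1, [u1, u4]) ([u1, u4], inv2 C \<eta>1, [v1, u3]) [v1, u3] [u1, u4]"
    "pinv ([v2, u5], \<eta>2, [u2, u6]) ([u2, u6], inv2 C \<eta>2, [v2, u5]) [v2, u5] [u2, u6]"
    using a b v squares by (simp_all add: phom_def)
  then show "phom [u7] D5 D3" "phom [u8] D5 D4" "inW [u7]"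
    "pinv ([u3, u7], \<eta>3, [u5, u8]) ([u5, u8], inv2 C \<eta>3, [u3, u7]) [u3, u7] [u5, u8]"
    using c by (simp_all add: phom_def)
qed

text \<open>Supplies the parameters of \<open>whisker_peq\<close>: the lists \<open>a\<close>,
  \<open>x\<close>, \<open>y\<close> are \<open>[u3, u7]\<close>, \<open>[u4, u7]\<close>,
  \<open>[u6, u8]\<close>, and \<open>E1\<close>, \<open>E2\<close> are \<eta>1 restricted along
  \<open>u7\<close> and \<eta>3 followed by the restriction of \<eta>2. The induced quintuple is the
  result for lists, conjugated by flattenings.\<close>

lemma whisker_data_path:
  fixes D3 D4 D5 :: 'o and u3 u4 u5 u6 u7 u8 :: 'm and \<eta>1 \<eta>2 \<eta>3 lam :: 'c
  assumes r: "(A3, v1, v2, \<alpha>, \<beta>) \<in> frac_reps C W (A1, w1, f1) (A2, w2, f2)"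
    and d: "whisker_data C W u f1 f2 (D1, u1, h1, \<rho>1) (D2, u2, h2, \<rho>2) (A3, v1, v2, \<alpha>, \<beta>)
      (D3, u3, u4, \<eta>1) (D4, u5, u6, \<eta>2) (D5, u7, u8, \<eta>3) lam"
  defines "E1 \<equiv> ([v1, u3], \<eta>1, [u1, u4]) \<triangleleft> [u7]"
    and "e1 \<equiv> ([u1, u4], inv2 C \<eta>1, [v1, u3]) \<triangleleft> [u7]"
    and "E2 \<equiv> ([v2, u5], \<eta>2, [u2, u6]) \<triangleleft> [u8] \<odot> [v2] \<triangleright> ([u3, u7], \<eta>3, [u5, u8])"
    and "e2 \<equiv> [v2] \<triangleright> ([u5, u8], inv2 C \<eta>3, [u3, u7]) \<odot> ([u2, u6], inv2 C \<eta>2, [v2, u5]) \<triangleleft> [u8]"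
    and "Lm \<equiv> ([h1, u4, u7], lam, [h2, u6, u8])"
    and "rep \<equiv> whisker_rep C g w1 w2 (D1, u1, h1, \<rho>1) (D2, u2, h2, \<rho>2) (A3, v1, v2, \<alpha>, \<beta>)
      (D3, u3, u4, \<eta>1) (D4, u5, u6, \<eta>2) (D5, u7, u8, \<eta>3) lam"
  defines "M \<equiv> [w2] \<triangleright> E2 \<odot> ([w1, v1], \<alpha>, [w2, v2]) \<triangleleft> [u3, u7] \<odot> [w1] \<triangleright> e1"
  shows "phom [u3, u7] D5 A3" "phom [u4, u7] D5 D1" "phom [u6, u8] D5 D2" "inW [u3, u7]"
    "pinv E1 e1 ([v1] @ [u3, u7]) ([u1] @ [u4, u7])" "pinv E2 e2 ([v2] @ [u3, u7]) ([u2] @ [u6, u8])"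
    "parr Lm ([h1] @ [u4, u7]) ([h2] @ [u6, u8])"
    "[u] \<triangleright> Lm = R2 \<triangleleft> [u6, u8] \<odot> ([f2] \<triangleright> E2 \<odot> ([f1, v1], \<beta>, [f2, v2]) \<triangleleft> [u3, u7] \<odot> [f1] \<triangleright> e1) \<odot> r1 \<triangleleft> [u4, u7]"
    "rep_path (w1 \<cdot> u1) (w2 \<cdot> u2) (g \<cdot> h1) (g \<cdot> h2) rep = ([u4 \<cdot> u7], [u6 \<cdot> u8],
      [w2 \<cdot> u2] \<triangleright> unflat [u6, u8] \<odot> unflat [w2, u2] \<triangleleft> [u6, u8] \<odot> M
        \<odot> flat [w1, u1] \<triangleleft> [u4, u7] \<odot> [w1 \<cdot> u1] \<triangleright> flat [u4, u7],
      [g \<cdot> h2] \<triangleright> unflat [u6, u8] \<odot> unflat [g, h2] \<triangleleft> [u6, u8] \<odot> [g] \<triangleright> Lm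
        \<odot> flat [g, h1] \<triangleleft> [u4, u7] \<odot> [g \<cdot> h1] \<triangleright> flat [u4, u7])"
    "rep \<in> frac_reps C W (D1, w1 \<cdot> u1, g \<cdot> h1) (D2, w2 \<cdot> u2, g \<cdot> h2)"
    "parr M [w1, u1, u4, u7] [w2, u2, u6, u8]"
proof -
  note v = repr_path[OF r]
  have s: "filled_square C W v1 u1 (D3, u3, u4, \<eta>1)" "filled_square C W v2 u2 (D4, u5, u6, \<eta>2)"
    "filled_square C W u3 u5 (D5, u7, u8, \<eta>3)" "lam \<in> Cells C (h1 \<cdot> (u4 \<cdot> u7)) (h2 \<cdot> (u6 \<cdot> u8))"
    "u \<rhd> lam = whisker_target C u f1 f2 (D1, u1, h1, \<rho>1) (D2, u2, h2, \<rho>2) (A3, v1, v2, \<alpha>, \<beta>)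
      (D3, u3, u4, \<eta>1) (D4, u5, u6, \<eta>2) (D5, u7, u8, \<eta>3)"
    using d by (auto simp: whisker_data_def)
  note q = squares_path[OF r s(1-3)]
  note ph = homs squares v q
  show h: "phom [u3, u7] D5 A3" "phom [u4, u7] D5 D1" "phom [u6, u8] D5 D2"
    using phom_append[OF q(5,1)] phom_append[OF q(5,2)] phom_append[OF q(6,4)] by simp_all
  show inW: "inW [u3, u7]"
    using inW_append[OF q(7,9)] h by (simp add: phom_def)
  have P: "path [f1, u1, u4, u7]" "path [f1, v1, u3, u7]" "path [f2, v2, u3, u7]" "path [u, h1, u4, u7]"
    "path [w1, u1, u4, u7]" "path [w1, v1, u3, u7]" "path [w2, v2, u3, u7]" "path [v1, u3, u7]"
    "path [u1, u4, u7]" "path [v2, u3, u7]" "path [v2, u5, u8]" "path [h1, u4, u7]" "path [h2, u6, u8]"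
    "path [g, h1, u4, u7]" "path [u2, u6, u8]" "path [w2, u2, u6, u8]"
    using ph by (auto simp: phom_def)
  show E1: "pinv E1 e1 ([v1] @ [u3, u7]) ([u1] @ [u4, u7])"
    using pinv_pr[OF q(10), of "[u7]"] P by (simp add: E1_def e1_def)
  show E2: "pinv E2 e2 ([v2] @ [u3, u7]) ([u2] @ [u6, u8])"
  proof -
    have "pinv ([v2] \<triangleright> ([u3, u7], \<eta>3, [u5, u8])) ([v2] \<triangleright> ([u5, u8], inv2 C \<eta>3, [u3, u7]))
        [v2, u3, u7] [v2, u5, u8]"
      using pinv_pl[OF q(12), of "[v2]"] P by simp
    moreover have "pinv (([v2, u5], \<eta>2, [u2, u6]) \<triangleleft> [u8]) (([u2, u6], inv2 C \<eta>2, [v2, u5]) \<triangleleft> [u8])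
        [v2, u5, u8] [u2, u6, u8]"
      using pinv_pr[OF q(11), of "[u8]"] P by simp
    ultimately show ?thesis
      using pinv_pv by (simp add: E2_def e2_def)
  qed
  have Lm: "parr ([h1, u4, u7], lam, [h2, u6, u8]) [h1, u4, u7] [h2, u6, u8]"
    using s(4) P by (simp add: parr_triple)
  then show "parr Lm ([h1] @ [u4, u7]) ([h2] @ [u6, u8])"
    by (simp add: Lm_def)
  note t = whisker_target_path[OF v(5) pinvD(2)[OF q(10)] pinvD(1)[OF q(11)] pinvD(1)[OF q(12)] _ _ P(1-4),
      OF _ _ pinvD(2)[OF squares(7), simplified] pinvD(1)[OF squares(8), simplified], simplified]
  show "[u] \<triangleright> Lm = R2 \<triangleleft> [u6, u8] \<odot> ([f2] \<triangleright> E2 \<odot> ([f1, v1], \<beta>, [f2, v2]) \<triangleleft> [u3, u7] \<odot> [f1] \<triangleright> e1) \<odot> r1 \<triangleleft> [u4, u7]"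
    unfolding Lm_def pl_triple[OF Lm P(4)] E2_def e1_def s(5) by (rule t(1))
  define T where "T = transport C w1 v1 w2 v2 \<alpha> u1 u2 (D3, u3, u4, \<eta>1) (D4, u5, u6, \<eta>2) (D5, u7, u8, \<eta>3)"
  note m = transport_path[OF pinvD(1)[OF v(4)] pinvD(2)[OF q(10)] pinvD(1)[OF q(11)] pinvD(1)[OF q(12)] _ _ P(5-7),
      simplified, of D3 D4 D5, folded T_def]
  have M: "M = ([w1, u1, u4, u7], T, [w2, u2, u6, u8])" "parr M [w1, u1, u4, u7] [w2, u2, u6, u8]"
    using m by (simp_all add: M_def E2_def e1_def)
  show "parr M [w1, u1, u4, u7] [w2, u2, u6, u8]"
    by fact
  have gl: "[g] \<triangleright> Lm = ([g, h1, u4, u7], g \<rhd> lam, [g, h2, u6, u8])" "parr ([g] \<triangleright> Lm) [g, h1, u4, u7] [g, h2, u6, u8]"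
    using pl_parr_triple[OF refl Lm P(14)] by (simp_all add: Lm_def)
  note c1 = flat_conj(1,2)[OF M(2)[unfolded M(1)], folded M(1)]
  note c2 = flat_conj(1,2)[OF gl(2)[unfolded gl(1)], folded gl(1)]
  have rep: "rep = (D5, u4 \<cdot> u7, u6 \<cdot> u8,
     inv2 C (assoc C w2 u2 (u6 \<cdot> u8)) \<bullet> T \<bullet> assoc C w1 u1 (u4 \<cdot> u7),
     inv2 C (assoc C g h2 (u6 \<cdot> u8)) \<bullet> (g \<rhd> lam) \<bullet> assoc C g h1 (u4 \<cdot> u7))"
    by (simp add: rep_def whisker_rep_def T_def)
  show "rep_path (w1 \<cdot> u1) (w2 \<cdot> u2) (g \<cdot> h1) (g \<cdot> h2) rep = ([u4 \<cdot> u7], [u6 \<cdot> u8],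
      [w2 \<cdot> u2] \<triangleright> unflat [u6, u8] \<odot> unflat [w2, u2] \<triangleleft> [u6, u8] \<odot> M
        \<odot> flat [w1, u1] \<triangleleft> [u4, u7] \<odot> [w1 \<cdot> u1] \<triangleright> flat [u4, u7],
      [g \<cdot> h2] \<triangleright> unflat [u6, u8] \<odot> unflat [g, h2] \<triangleleft> [u6, u8] \<odot> [g] \<triangleright> Lm
        \<odot> flat [g, h1] \<triangleleft> [u4, u7] \<odot> [g \<cdot> h1] \<triangleright> flat [u4, u7])"
    unfolding rep rep_path_def c1(1) c2(1) by simp
  have "pinv ([w1] \<triangleright> e1) ([w1] \<triangleright> E1) [w1, u1, u4, u7] [w1, v1, u3, u7]"
    using pinv_pl[OF pinv_sym[OF E1], of "[w1]"] P by simp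
  moreover have "pinv (([w1, v1], \<alpha>, [w2, v2]) \<triangleleft> [u3, u7]) (([w2, v2], inv2 C \<alpha>, [w1, v1]) \<triangleleft> [u3, u7])
      [w1, v1, u3, u7] [w2, v2, u3, u7]"
    using pinv_pr[OF v(4), of "[u3, u7]"] P by simp
  moreover have "pinv ([w2] \<triangleright> E2) ([w2] \<triangleright> e2) [w2, v2, u3, u7] [w2, u2, u6, u8]"
    using pinv_pl[OF E2, of "[w2]"] P by simp
  ultimately have i: "pinv ([w1] \<triangleright> e1) ([w1] \<triangleright> E1) [w1, u1, u4, u7] [w1, v1, u3, u7]"
    and "\<exists>M'. pinv M M' [w1, u1, u4, u7] [w2, u2, u6, u8]"
    unfolding M_def using pinv_pv by blast+
  then obtain M' where M': "pinv M M' [w1, u1, u4, u7] [w2, u2, u6, u8]"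
    by blast
  then obtain Y where "pinv ([w1 \<cdot> u1, u4 \<cdot> u7],
      inv2 C (assoc C w2 u2 (u6 \<cdot> u8)) \<bullet> T \<bullet> assoc C w1 u1 (u4 \<cdot> u7), [w2 \<cdot> u2, u6 \<cdot> u8]) Y
      [w1 \<cdot> u1, u4 \<cdot> u7] [w2 \<cdot> u2, u6 \<cdot> u8]"
    using flat_conj(3)[OF M(2)[unfolded M(1)] M'[unfolded M(1)], folded M(1)] unfolding c1(1) by blast
  note iso = pinv_Isos(1)[OF this]
  \<comment> \<open>The first leg of the quintuple is isomorphic through \<open>e1\<close> to the
    restriction of \<open>w1 \<cdot> v1\<close> along \<open>[u3, u7]\<close>, so BF5
    applies.\<close>
  have "inW [w1, v1, u3, u7]"
    using inW_append[OF v(3) inW] P by simp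
  then have "inW [w1, u1, u4, u7]"
    using inW_iso i by blast
  then have "inW [w1 \<cdot> u1, u4 \<cdot> u7]"
    using inW_iso[OF _ pinv_flat2[of "[w1, u1]" "[u4, u7]"]] P by simp
  then show "rep \<in> frac_reps C W (D1, w1 \<cdot> u1, g \<cdot> h1) (D2, w2 \<cdot> u2, g \<cdot> h2)"
    using iso c2(2) h unfolding rep c2(1)
    by (auto simp: frac_reps_def inW_def parr_triple phom_def Hom_def)
qed

text \<open>\<open>whisker_peq\<close> gives the equivalence for spans with two-element legs such as
  \<open>[w1, u1]\<close>, and \<open>path_equiv_conj\<close> carries it to the composite legs
  \<open>w1 \<cdot> u1\<close> and \<open>g \<cdot> h1\<close>.\<close>

lemma whisker_rep_equiv:
  assumes e: "(r, r') \<in> frac_equiv C W (A1, w1, f1) (A2, w2, f2)"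
    and d: "whisker_data C W u f1 f2 (D1, u1, h1, \<rho>1) (D2, u2, h2, \<rho>2) r S1 S2 S3 lam"
    and d': "whisker_data C W u f1 f2 (D1, u1, h1, \<rho>1) (D2, u2, h2, \<rho>2) r' S1' S2' S3' lam'"
  shows "(whisker_rep C g w1 w2 (D1, u1, h1, \<rho>1) (D2, u2, h2, \<rho>2) r S1 S2 S3 lam,
      whisker_rep C g w1 w2 (D1, u1, h1, \<rho>1) (D2, u2, h2, \<rho>2) r' S1' S2' S3' lam')
    \<in> frac_equiv C W (D1, w1 \<cdot> u1, g \<cdot> h1) (D2, w2 \<cdot> u2, g \<cdot> h2)"
proof -
  obtain A3 v1 v2 \<alpha> \<beta> where r: "r = (A3, v1, v2, \<alpha>, \<beta>)"
    by (cases r)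
  obtain A3' v1' v2' \<alpha>' \<beta>' where r': "r' = (A3', v1', v2', \<alpha>', \<beta>')"
    by (cases r')
  obtain D3 u3 u4 \<eta>1 D4 u5 u6 \<eta>2 D5 u7 u8 \<eta>3 where
    S: "S1 = (D3, u3, u4, \<eta>1)" "S2 = (D4, u5, u6, \<eta>2)" "S3 = (D5, u7, u8, \<eta>3)"
    by (metis surj_pair)
  obtain D3' u3' u4' \<eta>1' D4' u5' u6' \<eta>2' D5' u7' u8' \<eta>3' where
    S': "S1' = (D3', u3', u4', \<eta>1')" "S2' = (D4', u5', u6', \<eta>2')" "S3' = (D5', u7', u8', \<eta>3')"
    by (metis surj_pair)
  note eq = frac_equivD[OF F1 F2 e[unfolded r r']]
  note p = whisker_data_path[OF eq(1) d[unfolded r S]]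
  note p' = whisker_data_path[OF eq(2) d'[unfolded r' S']]
  note v = repr_path[OF eq(1)] and v' = repr_path[OF eq(2)]
  have sp: "[x] @ [y] = [x, y]" for x y :: 'm
    by simp
  have t: "parr ([w1, v1], \<alpha>, [w2, v2]) ([w1] @ [v1]) ([w2] @ [v2])"
    "parr ([f1, v1], \<beta>, [f2, v2]) ([f1] @ [v1]) ([f2] @ [v2])"
    "parr ([w1, v1'], \<alpha>', [w2, v2']) ([w1] @ [v1']) ([w2] @ [v2'])"
    "parr ([f1, v1'], \<beta>', [f2, v2']) ([f1] @ [v1']) ([f2] @ [v2'])"
    using pinvD(1)[OF v(4)] pinvD(1)[OF v'(4)] v(5) v'(5) by simp_all
  note X = whisker_peq[OF homs(1-6) squares(1-4) homs(9) squares(5-8) v(1,2) t(1,2) v'(1,2) t(3,4)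
    eq(3)[unfolded rep_path_def prod.case] p(1-8) p'(1-8), unfolded sp]
  have fl: "pinv (flat [x, y]) (unflat [x, y]) [x \<cdot> y] [x, y]" if "phom [x, y] a b" for x y a b
    using pinv_flat[of "[x, y]"] that by (simp add: phom_def)
  note c = phom_append[OF squares(1) homs(1), unfolded sp] phom_append[OF squares(3) homs(2), unfolded sp]
    phom_append[OF squares(2) homs(6), unfolded sp] phom_append[OF squares(4) homs(6), unfolded sp]
  have gl: "parr ([g] \<triangleright> ([h1, u4, u7], lam, [h2, u6, u8])) ([g, h1] @ [u4, u7]) ([g, h2] @ [u6, u8])"
    using parr_pl[OF p(7), of "[g]"] phom_append[OF p(2) c(3)] by (simp add: phom_def)
  have m: "parr ([w2] \<triangleright> (([v2, u5], \<eta>2, [u2, u6]) \<triangleleft> [u8] \<odot> [v2] \<triangleright> ([u3, u7], \<eta>3, [u5, u8])) \<odot>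
      ([w1, v1], \<alpha>, [w2, v2]) \<triangleleft> [u3, u7] \<odot> [w1] \<triangleright> (([u1, u4], inv2 C \<eta>1, [v1, u3]) \<triangleleft> [u7]))
      ([w1, u1] @ [u4, u7]) ([w2, u2] @ [u6, u8])"
    using p(11) by simp
  have "path_equiv [w1 \<cdot> u1] [w2 \<cdot> u2] [g \<cdot> h1] [g \<cdot> h2]
      (rep_path (w1 \<cdot> u1) (w2 \<cdot> u2) (g \<cdot> h1) (g \<cdot> h2)
        (whisker_rep C g w1 w2 (D1, u1, h1, \<rho>1) (D2, u2, h2, \<rho>2) r S1 S2 S3 lam))
      (rep_path (w1 \<cdot> u1) (w2 \<cdot> u2) (g \<cdot> h1) (g \<cdot> h2)
        (whisker_rep C g w1 w2 (D1, u1, h1, \<rho>1) (D2, u2, h2, \<rho>2) r' S1' S2' S3' lam'))"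
    unfolding r r' S S' p(9) p'(9)
    by (rule path_equiv_conj[OF c p(2,3) p'(2,3) fl[OF c(1)] fl[OF c(2)] fl[OF c(3)] fl[OF c(4)]
      fl[OF p(2)] fl[OF p(3)] fl[OF p'(2)] fl[OF p'(3)] m gl X])
  then show ?thesis
    using frac_equivI'[OF comp_frac_Hom] p(10) p'(10) unfolding r r' S S' by blast
qed

text \<open>Pronk's selected quintuple comes from an admissible set of data, so the comparison of
  arbitrary data applies to it. What has to be checked is that restricting the third square along
  \<open>p\<close> also restricts the target pasting along \<open>p\<close>.\<close>

lemma chosen_whisker_data:
  assumes choices: "choices_C C W CW" "choices_D C W DW"
    and cw: "CW f1 u = (D1, u1, h1, \<rho>1)" "CW f2 u = (D2, u2, h2, \<rho>2)"
    and r: "r \<in> frac_reps C W (A1, w1, f1) (A2, w2, f2)"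
  shows "\<exists>S1 S2 S3 lam. whisker_data C W u f1 f2 (D1, u1, h1, \<rho>1) (D2, u2, h2, \<rho>2) r S1 S2 S3 lam \<and>
    chosen_whisker_rep C CW DW (B', u, g) (A1, w1, f1) (A2, w2, f2) r
      = whisker_rep C g w1 w2 (D1, u1, h1, \<rho>1) (D2, u2, h2, \<rho>2) r S1 S2 S3 lam"
proof -
  obtain A3 v1 v2 \<alpha> \<beta> where req: "r = (A3, v1, v2, \<alpha>, \<beta>)"
    by (cases r)
  note r' = r[unfolded req]
  note v = repr_path[OF r']
  obtain D3 u3 u4 \<eta>1 where S1: "CW v1 u1 = (D3, u3, u4, \<eta>1)"
    by (cases "CW v1 u1")
  obtain D4 u5 u6 \<eta>2 where S2: "CW v2 u2 = (D4, u5, u6, \<eta>2)"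
    by (cases "CW v2 u2")
  obtain D5 u7 u8 \<eta>3 where S3: "CW u3 u5 = (D5, u7, u8, \<eta>3)"
    by (cases "CW u3 u5")
  have cC: "filled_square C W a b (CW a b)" if "phom [a] x y" "phom [b] z y" "inW [b]" for a b x y z
    using choices(1) that by (auto simp: choices_C_def phom_single inW_single)
  have s1: "filled_square C W v1 u1 (D3, u3, u4, \<eta>1)"
    using cC[OF v(1) squares(1,5)] by (simp add: S1)
  have s2: "filled_square C W v2 u2 (D4, u5, u6, \<eta>2)"
    using cC[OF v(2) squares(3,6)] by (simp add: S2)
  have q12: "phom [u3] D3 A3" "phom [u5] D4 A3" "inW [u5]"
    using filled_square_path[OF s1] filled_square_path[OF s2] v(1,2) squares by (simp_all add: phom_def)
  have s3: "filled_square C W u3 u5 (D5, u7, u8, \<eta>3)"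
    using cC[OF q12] by (simp add: S3)
  note q = squares_path[OF r' s1 s2 s3]
  define t where "t = whisker_target C u f1 f2 (D1, u1, h1, \<rho>1) (D2, u2, h2, \<rho>2) (A3, v1, v2, \<alpha>, \<beta>)
    (D3, u3, u4, \<eta>1) (D4, u5, u6, \<eta>2) (D5, u7, u8, \<eta>3)"
  have P: "path [f1, u1, u4, u7]" "path [f1, v1, u3, u7]" "path [f2, v2, u3, u7]" "path [u, h1, u4, u7]"
    "path [u, h2, u6, u8]" "path [h1, u4, u7]" "path [h2, u6, u8]"
    using homs squares v(1,2) q by (auto simp: phom_def)
  note w = whisker_target_path[OF v(5) pinvD(2)[OF q(10)] pinvD(1)[OF q(11)], OF _ _ _ _ _ _ _
      pinvD(2)[OF squares(7), simplified] pinvD(1)[OF squares(8), simplified]]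
  note w1 = w[OF pinvD(1)[OF q(12)] _ _ P(1-4), simplified, of D1 D2 A3 \<alpha> D3 D4 D5, folded t_def]
  define H1 where "H1 = h1 \<cdot> (u4 \<cdot> u7)"
  define H2 where "H2 = h2 \<cdot> (u6 \<cdot> u8)"
  have cH: "rcomp [h1, u4, u7] = H1" "rcomp [h2, u6, u8] = H2"
    by (simp_all add: H1_def H2_def)
  have hH: "phom [H1] D5 B'" "phom [H2] D5 B'"
    using P(6,7) squares q unfolding H1_def H2_def by (auto simp: phom_def)
  have t: "t \<in> Cells C (u \<cdot> H1) (u \<cdot> H2)"
    using w1(2) by (simp add: parr_triple H1_def H2_def)
  obtain D p \<kappa> where dw: "DW u H1 H2 t = (D, p, \<kappa>)"
    by (cases "DW u H1 H2 t")
  have "BF4a_triple C W u H1 H2 t (D, p, \<kappa>)"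
    using choices(2) homs hH t unfolding choices_D_def dw[symmetric] by (metis phom_single inW_single)
  then have p: "p \<in> W" "phom [p] D D5" "\<kappa> \<in> Cells C (H1 \<cdot> p) (H2 \<cdot> p)" "rw C u H1 u H2 t p = u \<rhd> \<kappa>"
    using hH by (auto simp: BF4a_triple_def phom_single Hom_def)
  have Pp: "path [h1, u4, u7, p]" "path [h2, u6, u8, p]" "path [H1, p]" "path [H2, p]" "path [u, H1, p]"
    "path [u, H2, p]" "path [u3, u7, p]" "path [u5, u8, p]" "path [u, H1]" "path [u, H2]" "path [u, h1, u4, u7, p]"
    "path [f1, u1, u4, u7, p]" "path [f1, v1, u3, u7, p]" "path [f2, v2, u3, u7, p]"
    using homs squares v(1,2) q hH p by (auto simp: phom_def)
  define \<eta> where "\<eta> = rw C u3 u7 u5 u8 \<eta>3 p"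
  define lam where "lam = (h2 \<rhd> assoc C u6 u8 p) \<bullet> assoc C h2 (u6 \<cdot> u8) p \<bullet> \<kappa>
      \<bullet> inv2 C (assoc C h1 (u4 \<cdot> u7) p) \<bullet> (h1 \<rhd> inv2 C (assoc C u4 u7 p))"
  have eta: "pinv ([u3, u7, p], \<eta>, [u5, u8, p]) (([u5, u8], inv2 C \<eta>3, [u3, u7]) \<triangleleft> [p]) [u3, u7, p] [u5, u8, p]"
    "([u3, u7], \<eta>3, [u5, u8]) \<triangleleft> [p] = ([u3, u7, p], \<eta>, [u5, u8, p])"
    using pinv_pr[OF q(12), of "[p]"] pr_triple[OF pinvD(1)[OF q(12)], of "[p]"] Pp
    by (simp_all add: \<eta>_def)
  have s3': "filled_square C W u3 u5 (D, u7 \<cdot> p, u8 \<cdot> p, \<eta>)"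
  proof (rule filled_squareI)
    show "inW [u7 \<cdot> p]"
      using BF2[of p u7] q p by (simp add: inW_single phom_def)
    show "phom [u7 \<cdot> p] D (src C u3)" "phom [u8 \<cdot> p] D (src C u5)"
      using q p by (simp_all add: phom_def)
    show "\<eta> \<in> Isos C (u3 \<cdot> (u7 \<cdot> p)) (u5 \<cdot> (u8 \<cdot> p))"
      using pinv_Isos(1)[OF eta(1)] by simp
  qed
  have k: "parr ([H1, p], \<kappa>, [H2, p]) [H1, p] [H2, p]"
    using p Pp by (simp add: parr_triple)
  \<comment> \<open>For lists, \<open>lam\<close> is just \<kappa> read between
    \<open>[h1, u4, u7, p]\<close> and \<open>[h2, u6, u8, p]\<close>.\<close>
  define L where "L = flat [h2, u6, u8] \<triangleleft> [p] \<odot> ([H1, p], \<kappa>, [H2, p]) \<odot> unflat [h1, u4, u7] \<triangleleft> [p]"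
  note f = pinv_flat[OF P(6), unfolded cH] pinv_flat[OF P(7), unfolded cH]
  have f1: "parr (unflat [h1, u4, u7] \<triangleleft> [p]) [h1, u4, u7, p] [H1, p]"
    and f2: "parr (flat [h2, u6, u8] \<triangleleft> [p]) [H2, p] [h2, u6, u8, p]"
    using parr_pr[OF pinvD(2)[OF f(1)], of "[p]"] parr_pr[OF pinvD(1)[OF f(2)], of "[p]"] Pp by simp_all
  have L: "L = ([h1, u4, u7, p], lam, [h2, u6, u8, p])" "parr L [h1, u4, u7, p] [h2, u6, u8, p]"
  proof -
    note e1 = flat3(2)[OF Pp(1), folded H1_def] and e2 = flat3(1)[OF Pp(2), folded H2_def]
    note a = pv_parr_triple[OF refl e1 f1 k]
    note b = pv_parr_triple[OF e2 a f2]
    have "\<kappa> \<in> Cell C" "dom2 C \<kappa> = (h1 \<cdot> (u4 \<cdot> u7)) \<cdot> p" "cod2 C \<kappa> = (h2 \<cdot> (u6 \<cdot> u8)) \<cdot> p"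
      using p(3) by (simp_all add: Cells_def H1_def H2_def)
    then have "((h2 \<rhd> assoc C u6 u8 p) \<bullet> assoc C h2 (u6 \<cdot> u8) p) \<bullet> \<kappa>
      \<bullet> inv2 C (assoc C h1 (u4 \<cdot> u7) p) \<bullet> (h1 \<rhd> inv2 C (assoc C u4 u7 p)) = lam"
      using Pp(1,2) by (simp add: lam_def)
    then show "L = ([h1, u4, u7, p], lam, [h2, u6, u8, p])"
      unfolding L_def b(1) by simp
    show "parr L [h1, u4, u7, p] [h2, u6, u8, p]"
      unfolding L_def using b(2) .
  qed
  have tH: "parr ([u, H1], t, [u, H2]) [u, H1] [u, H2]"
    using t Pp by (simp add: parr_triple)
  \<comment> \<open>\<open>[u, H1]\<close> and \<open>[u, h1, u4, u7]\<close> have the same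
    composite, so \<open>t\<close> is a cell for either reading; the two readings differ by
    flattenings.\<close>
  have tH': "([u, H1], t, [u, H2]) = [u] \<triangleright> unflat [h2, u6, u8] \<odot> ([u, h1, u4, u7], t, [u, h2, u6, u8]) \<odot>
      [u] \<triangleright> flat [h1, u4, u7]"
    using t P Pp hH unfolding flat_def unflat_def cH
    by (intro path_cell_eqI) (simp_all add: pv_type pl_type Cells_def H1_def H2_def)
  \<comment> \<open>The defining equation of the triple chosen by \<open>DW\<close>, read for
    lists.\<close>
  have "[u] \<triangleright> ([H1, p], \<kappa>, [H2, p]) = ([u, H1], t, [u, H2]) \<triangleleft> [p]"
    using pl_triple[OF k Pp(5)] pr_triple[OF tH, of "[p]"] Pp p(4) by simp
  then have "[u] \<triangleright> L = ([u] \<triangleright> (flat [h2, u6, u8] \<odot> unflat [h2, u6, u8]) \<odot> ([u, h1, u4, u7], t, [u, h2, u6, u8]) \<odot>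
      [u] \<triangleright> (flat [h1, u4, u7] \<odot> unflat [h1, u4, u7])) \<triangleleft> [p]"
    unfolding L_def by (simp add: tH' pl_pv pr_pv pl_pr pv_assoc)
  also have "\<dots> = ([u, h1, u4, u7], t, [u, h2, u6, u8]) \<triangleleft> [p]"
    using pinvD(4)[OF f(1)] pinvD(4)[OF f(2)] parr_id_left[OF w1(2)] parr_id_right[OF w1(2)]
    by (simp add: pl_pid pv_assoc)
  also have "\<dots> = ([u, h1, u4, u7, p], whisker_target C u f1 f2 (D1, u1, h1, \<rho>1) (D2, u2, h2, \<rho>2)
      (A3, v1, v2, \<alpha>, \<beta>) (D3, u3, u4, \<eta>1) (D4, u5, u6, \<eta>2) (D, u7 \<cdot> p, u8 \<cdot> p, \<eta>), [u, h2, u6, u8, p])"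
  proof -
    \<comment> \<open>The target for the absorbed square is obtained with the lists
      \<open>[u7, p]\<close> and \<open>[u8, p]\<close>. Because right whiskering is strictly
      associative, it is the old target restricted along \<open>p\<close>.\<close>
    note w2 = w[of "[u7, p]" \<eta> "[u8, p]", simplified, OF pinvD(1)[OF eta(1)]]
    show ?thesis
      unfolding w1(1) using w2(1) Pp by (simp add: pdistr flip: eta(2))
  qed
  finally have "u \<rhd> lam = whisker_target C u f1 f2 (D1, u1, h1, \<rho>1) (D2, u2, h2, \<rho>2)
      (A3, v1, v2, \<alpha>, \<beta>) (D3, u3, u4, \<eta>1) (D4, u5, u6, \<eta>2) (D, u7 \<cdot> p, u8 \<cdot> p, \<eta>)"
    using pl_triple[OF L(2)[unfolded L(1)] Pp(11)] by (simp add: L(1))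
  moreover have "lam \<in> Cells C (h1 \<cdot> (u4 \<cdot> (u7 \<cdot> p))) (h2 \<cdot> (u6 \<cdot> (u8 \<cdot> p)))"
    using L by (simp add: parr_triple)
  ultimately have "whisker_data C W u f1 f2 (D1, u1, h1, \<rho>1) (D2, u2, h2, \<rho>2) r
      (D3, u3, u4, \<eta>1) (D4, u5, u6, \<eta>2) (D, u7 \<cdot> p, u8 \<cdot> p, \<eta>) lam"
    using s1 s2 s3' by (simp add: whisker_data_def req)
  moreover have "chosen_whisker_rep C CW DW (B', u, g) (A1, w1, f1) (A2, w2, f2) r
      = whisker_rep C g w1 w2 (D1, u1, h1, \<rho>1) (D2, u2, h2, \<rho>2) r
        (D3, u3, u4, \<eta>1) (D4, u5, u6, \<eta>2) (D, u7 \<cdot> p, u8 \<cdot> p, \<eta>) lam"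
    by (simp add: chosen_whisker_rep_def req cw S1 S2 S3 lam_def \<eta>_def dw[unfolded H1_def H2_def t_def])
  ultimately show ?thesis
    by blast
qed

end

theorem proposition7p1:
  fixes C :: "('o, 'm, 'c, 'x) bicat_scheme" (structure)
    and W :: "'m set"
    and CW :: "'m \<Rightarrow> 'm \<Rightarrow> 'o \<times> 'm \<times> 'm \<times> 'c"
    and DW :: "'m \<Rightarrow> 'm \<Rightarrow> 'm \<Rightarrow> 'c \<Rightarrow> 'o \<times> 'm \<times> 'c"
    and \<Gamma> :: "('o \<times> 'm \<times> 'm \<times> 'c \<times> 'c) set"
  assumes "BF C W"
    and "choices_C C W CW"
    and "choices_D C W DW"
    and "(B', u, g) \<in> frac_Hom C W B X"
    and "(A1, w1, f1) \<in> frac_Hom C W A B"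
    and "(A2, w2, f2) \<in> frac_Hom C W A B"
    and "\<Gamma> \<in> frac_Cells C W (A1, w1, f1) (A2, w2, f2)"
    and "(A3, v1, v2, \<alpha>, \<beta>) \<in> \<Gamma>"
    and "CW f1 u = (D1, u1, h1, \<rho>1)"
    and "CW f2 u = (D2, u2, h2, \<rho>2)"
    and "whisker_data C W u f1 f2 (D1, u1, h1, \<rho>1) (D2, u2, h2, \<rho>2) (A3, v1, v2, \<alpha>, \<beta>)
           (D3, u3, u4, \<eta>1) (D4, u5, u6, \<eta>2) (D5, u7, u8, \<eta>3) lam"
  shows "frac_whisker C W CW DW (B', u, g) (A1, w1, f1) (A2, w2, f2) \<Gamma>
           \<in> frac_Cells C W (frac_comp C CW (B', u, g) (A1, w1, f1))
                            (frac_comp C CW (B', u, g) (A2, w2, f2)) \<and>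
         whisker_rep C g w1 w2 (D1, u1, h1, \<rho>1) (D2, u2, h2, \<rho>2) (A3, v1, v2, \<alpha>, \<beta>)
           (D3, u3, u4, \<eta>1) (D4, u5, u6, \<eta>2) (D5, u7, u8, \<eta>3) lam
           \<in> frac_whisker C W CW DW (B', u, g) (A1, w1, f1) (A2, w2, f2) \<Gamma> \<and>
         (\<forall>r' S1' S2' S3' lam'.
           r' \<in> \<Gamma> \<longrightarrow>
           whisker_data C W u f1 f2 (D1, u1, h1, \<rho>1) (D2, u2, h2, \<rho>2) r' S1' S2' S3' lam' \<longrightarrow>
           (whisker_rep C g w1 w2 (D1, u1, h1, \<rho>1) (D2, u2, h2, \<rho>2) (A3, v1, v2, \<alpha>, \<beta>)
              (D3, u3, u4, \<eta>1) (D4, u5, u6, \<eta>2) (D5, u7, u8, \<eta>3) lam,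
            whisker_rep C g w1 w2 (D1, u1, h1, \<rho>1) (D2, u2, h2, \<rho>2) r' S1' S2' S3' lam')
           \<in> frac_equiv C W (frac_comp C CW (B', u, g) (A1, w1, f1))
                            (frac_comp C CW (B', u, g) (A2, w2, f2)))"
proof -
  interpret BF C W
    by fact
  have cC: "filled_square C W f u (CW f u)" if "(A', w, f) \<in> frac_Hom C W A B" for A' w f
    using assms(2,4) that by (auto simp: choices_C_def frac_Hom_def)
  interpret whisker_setting C W A B X B' A1 A2 D1 D2 u g w1 f1 w2 f2 u1 h1 u2 h2 \<rho>1 \<rho>2
    using assms(4-6) cC[OF assms(5)] cC[OF assms(6)] assms(9,10) by unfold_locales simp_all
  let ?E = "frac_equiv C W (A1, w1, f1) (A2, w2, f2)"
  let ?E' = "frac_equiv C W (D1, w1 \<cdot> u1, g \<cdot> h1) (D2, w2 \<cdot> u2, g \<cdot> h2)"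
  let ?rep = "whisker_rep C g w1 w2 (D1, u1, h1, \<rho>1) (D2, u2, h2, \<rho>2)"
  let ?data = "whisker_data C W u f1 f2 (D1, u1, h1, \<rho>1) (D2, u2, h2, \<rho>2)"
  let ?chosen = "chosen_whisker_rep C CW DW (B', u, g) (A1, w1, f1) (A2, w2, f2)"
  define r where "r = (A3, v1, v2, \<alpha>, \<beta>)"
  define R where "R = ?rep r (D3, u3, u4, \<eta>1) (D4, u5, u6, \<eta>2) (D5, u7, u8, \<eta>3) lam"
  have r: "r \<in> \<Gamma>" "?data r (D3, u3, u4, \<eta>1) (D4, u5, u6, \<eta>2) (D5, u7, u8, \<eta>3) lam"
    using assms(8,11) by (simp_all add: r_def)
  have comp: "frac_comp C CW (B', u, g) (A1, w1, f1) = (D1, w1 \<cdot> u1, g \<cdot> h1)"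
    "frac_comp C CW (B', u, g) (A2, w2, f2) = (D2, w2 \<cdot> u2, g \<cdot> h2)"
    using assms(9,10) by (simp_all add: frac_comp_def)
  \<comment> \<open>As \<Gamma> is a class of the quotient, all its members are related to one
    \<open>x\<close>; symmetry and transitivity then relate any two of them.\<close>
  obtain x where "\<Gamma> = ?E `` {x}"
    using assms(7) unfolding frac_Cells_def by (elim quotientE)
  then have x: "(x, s) \<in> ?E" if "s \<in> \<Gamma>" for s
    using that by simp
  have \<Gamma>: "(s, s') \<in> ?E" if "s \<in> \<Gamma>" "s' \<in> \<Gamma>" for s s'
    by (rule frac_equiv_trans[OF assms(5,6) frac_equiv_sym[OF assms(5,6) x[OF that(1)]] x[OF that(2)]])
  have reps: "s \<in> frac_reps C W (A1, w1, f1) (A2, w2, f2)" if "s \<in> \<Gamma>" for s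
    by (rule frac_equiv_reps[OF \<Gamma>[OF that that]])
  have equiv: "(R, ?rep s S1 S2 S3 lam') \<in> ?E'" if "s \<in> \<Gamma>" "?data s S1 S2 S3 lam'" for s S1 S2 S3 lam'
    unfolding R_def by (rule whisker_rep_equiv[OF \<Gamma>[OF r(1) that(1)] r(2) that(2)])
  \<comment> \<open>The selected quintuple of each representative is induced by some data, hence
    equivalent to \<open>R\<close>.\<close>
  have chosen: "(R, ?chosen s) \<in> ?E'" if s: "s \<in> \<Gamma>" for s
  proof -
    obtain S1 S2 S3 lam' where "?data s S1 S2 S3 lam'" "?chosen s = ?rep s S1 S2 S3 lam'"
      using chosen_whisker_data[OF assms(2,3,9,10) reps[OF s]] by (elim exE conjE)
    then show ?thesis
      using equiv[OF s] by simp
  qed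
  have RR: "(R, R) \<in> ?E'"
    using equiv[OF r] by (simp add: R_def)
  \<comment> \<open>All terms of the union in \<open>frac_whisker\<close> are therefore the class of
    \<open>R\<close>, and the union is this class because \<Gamma> is nonempty.\<close>
  have "?E' `` {?chosen s} = ?E' `` {R}" if "s \<in> \<Gamma>" for s
    using frac_equiv_trans[OF comp_frac_Hom chosen[OF that]]
      frac_equiv_trans[OF comp_frac_Hom frac_equiv_sym[OF comp_frac_Hom chosen[OF that]]]
    by (intro equalityI subsetI) (simp_all only: Image_singleton_iff)
  then have w: "frac_whisker C W CW DW (B', u, g) (A1, w1, f1) (A2, w2, f2) \<Gamma> = ?E' `` {R}"
    unfolding frac_whisker_def comp using r(1) by auto
  have "R \<in> frac_reps C W (D1, w1 \<cdot> u1, g \<cdot> h1) (D2, w2 \<cdot> u2, g \<cdot> h2)"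
    by (rule frac_equiv_reps[OF RR])
  then have "?E' `` {R} \<in> frac_Cells C W (D1, w1 \<cdot> u1, g \<cdot> h1) (D2, w2 \<cdot> u2, g \<cdot> h2)"
    unfolding frac_Cells_def by (rule quotientI)
  then show ?thesis
    unfolding comp w r_def[symmetric] R_def[symmetric] using RR by (simp add: equiv)
qed

end
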